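(* Let $\{\psi_i(\cdot)=T_i(\cdot)+t_i\}_{i=1}^N$ be a planar box-like self-affine IFS satisfying the rectangular open set condition (ROSC), with all $T_i$ diagonal. Let $\mathcal P=(p_i)_{i=1}^N$ be a positive probability vector and $\mu$ the self-affine measure associated with $\mathcal P$. For every $q\ge0$, either $$\text{(i)}\quad\max\{\gamma_A(q),\gamma_B(q)\}\le t(q)\qquad\text{or}\qquad\text{(ii)}\quad\min\{\gamma_A(q),\gamma_B(q)\}\ge t(q).$$ (a) If (i) holds, $$\begin{aligned}\tau_\mu(q)&=\max\{\gamma_A(q),\gamma_B(q)\}\\&=\max\Big\{x+y:\sum_{i=1}^Np_i^qa_i^xb_i^y=1,\ \gamma_B(q)-\tau_B(q)\le x\le\tau_A(q)\Big\}\\&=\max\Big\{x+y:\sum_{i=1}^Np_i^qa_i^xb_i^y=1,\ \gamma_A(q)-\tau_A(q)\le y\le\tau_B(q)\Big\}.\end{aligned}$$ (b) If (ii) holds, $$\begin{aligned}\tau_\mu(q)&=\min\Big\{x+y:\sum_{i=1}^Np_i^qa_i^xb_i^y=1,\ \tau_A(q)\le x\le\gamma_B(q)-\tau_B(q)\Big\}\\&=\min\Big\{x+y:\sum_{i=1}^Np_i^qa_i^xb_i^y=1,\ \tau_B(q)\le y\le\gamma_A(q)-\tau_A(q)\Big\}.\end{aligned}$$ Moreover (in case (ii)): (b1) if $\sum_{i=1}^Np_i^qa_i^{\tau_A(q)}b_i^{\gamma_A(q)-\tau_A(q)}\log(a_i/b_i)\ge0$, then $\tau_\mu(q)=\gamma_A(q)$;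 (b2) if $\sum_{i=1}^Np_i^qb_i^{\tau_B(q)}a_i^{\gamma_B(q)-\tau_B(q)}\log(a_i/b_i)\le0$, then $\tau_\mu(q)=\gamma_B(q)$; (b3) otherwise, there exist $x\in[\tau_A(q),\gamma_B(q)-\tau_B(q)]$ and $y\in[\tau_B(q),\gamma_A(q)-\tau_A(q)]$ satisfying $\sum_{i=1}^Np_i^qa_i^xb_i^y=1$ such that $\sum_{i=1}^Np_i^qa_i^xb_i^y\log(a_i/b_i)=0$ and $$\tau_\mu(q)=x+y<\min\{\gamma_A(q),\gamma_B(q)\}.$$
   Context: Planar box-like self-affine IFS with diagonal linear parts: finitely many maps $\psi_i(\xi)=T_i\xi+t_i$ on $\mathbb R^2$, $t_i\in\mathbb R^2$, $T_i=\begin{pmatrix}\pm a_i&0\\0&\pm b_i\end{pmatrix}$, $0<a_i,b_i<1$. ROSC: the sets $\psi_i((0,1)^2)$, $1\le i\le N$, are pairwise disjoint subsets of $(0,1)^2$. A positive probability vector has $p_i>0$, $\sum p_i=1$; $\mu$ is the unique Borel probability measure with $\mu=\sum_{i=1}^Np_i\,\mu\circ\psi_i^{-1}$. $\mu^x,\mu^y$ are the projections of $\mu$ to the $x$- and $y$-axis. $L^q$-spectrum: for a compactly supported Borel probability measure $\nu$ on $\mathbb R^n$ and $q\ge0$, $\mathcal D^q_\delta(\nu)=\sum_Q\nu(Q)^q$ over closed cubes $Q$ of the $\delta$-mesh of $\mathbb R^n$ (for $q=0$, the number of cubes with $\nu(Q)>0$), and $\tau_\nu(q)=\lim_{\delta\to0+}\frac{\log\mathcal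 D^q_\delta(\nu)}{-\log\delta}$ when the limit exists; it exists for $\mu^x$, $\mu^y$ (and, under the present hypotheses, for $\mu$). Put $\tau_A(q)=\tau_{\mu^x}(q)$, $\tau_B(q)=\tau_{\mu^y}(q)$, $t(q)=\tau_A(q)+\tau_B(q)$. $\gamma_A(q)$ and $\gamma_B(q)$ are the unique real solutions of $$\sum_{i=1}^Np_i^qa_i^{\tau_A(q)}b_i^{\gamma_A(q)-\tau_A(q)}=1,\qquad\sum_{i=1}^Np_i^qa_i^{\gamma_B(q)-\tau_B(q)}b_i^{\tau_B(q)}=1.$$ *)

theory Defs
  imports "HOL-Analysis.Analysis"
begin

definition affine_map :: "real^2^2 \<Rightarrow> real^2 \<Rightarrow> real^2 \<Rightarrow> real^2" where
  "affine_map M v \<xi> = M *v \<xi> + v"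

text \<open>The linear parts are $T_i = \mathrm{diag}(\pm a_i, \pm b_i)$ with arbitrary signs.\<close>

definition diagonal_box_like_ifs ::
  "nat \<Rightarrow> (nat \<Rightarrow> real^2^2) \<Rightarrow> (nat \<Rightarrow> real) \<Rightarrow> (nat \<Rightarrow> real) \<Rightarrow> bool" where
  "diagonal_box_like_ifs N T a b \<longleftrightarrow>
     (\<forall>i\<in>{1..N}. T i $ 1 $ 2 = 0 \<and> T i $ 2 $ 1 = 0 \<and>
        \<bar>T i $ 1 $ 1\<bar> = a i \<and> \<bar>T i $ 2 $ 2\<bar> = b i \<and>
        0 < a i \<and> a i < 1 \<and> 0 < b i \<and> b i < 1)"

definition ROSC :: "nat \<Rightarrow> (nat \<Rightarrow> real^2^2) \<Rightarrow> (nat \<Rightarrow> real^2) \<Rightarrow> bool" where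
  "ROSC N T v \<longleftrightarrow>
     (\<forall>i\<in>{1..N}. affine_map (T i) (v i) ` box 0 1 \<subseteq> box 0 1) \<and>
     disjoint_family_on (\<lambda>i. affine_map (T i) (v i) ` box 0 1) {1..N}"

definition positive_prob_vector :: "nat \<Rightarrow> (nat \<Rightarrow> real) \<Rightarrow> bool" where
  "positive_prob_vector N p \<longleftrightarrow> (\<forall>i\<in>{1..N}. 0 < p i) \<and> (\<Sum>i=1..N. p i) = 1"

text \<open>For a contracting system and a probability vector exactly one Borel measure satisfies
  this predicate.\<close>

definition self_affine_measure ::
  "nat \<Rightarrow> (nat \<Rightarrow> real^2^2) \<Rightarrow> (nat \<Rightarrow> real^2) \<Rightarrow> (nat \<Rightarrow> real) \<Rightarrow> (real^2) measure \<Rightarrow> bool" where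
  "self_affine_measure N T v p \<mu> \<longleftrightarrow>
     sets \<mu> = sets borel \<and> emeasure \<mu> (space \<mu>) = 1 \<and>
     (\<forall>E\<in>sets borel. measure \<mu> E = (\<Sum>i=1..N. p i * measure \<mu> (affine_map (T i) (v i) -` E)))"

definition mesh :: "real \<Rightarrow> 'a::euclidean_space set set" where
  "mesh \<delta> = {cbox (\<delta> *\<^sub>R k) (\<delta> *\<^sub>R (k + One)) |k. \<forall>e\<in>Basis. k \<bullet> e \<in> \<int>}"

text \<open>Only cubes of positive measure are summed: for compactly supported \<open>\<nu>\<close> there are finitely
  many of them, and for \<open>q = 0\<close> the sum counts them.\<close>

definition Lq_sum :: "'a::euclidean_space measure \<Rightarrow> real \<Rightarrow> real \<Rightarrow> real" where
  "Lq_sum \<nu> q \<delta> = (\<Sum>Q\<in>{Q\<in>mesh \<delta>. 0 < measure \<nu> Q}. measure \<nu> Q powr q)"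

definition has_Lq_spectrum :: "'a::euclidean_space measure \<Rightarrow> real \<Rightarrow> real \<Rightarrow> bool" where
  "has_Lq_spectrum \<nu> q s \<longleftrightarrow> ((\<lambda>\<delta>. ln (Lq_sum \<nu> q \<delta>) / (- ln \<delta>)) \<longlongrightarrow> s) (at_right 0)"

definition Lq_spectrum :: "'a::euclidean_space measure \<Rightarrow> real \<Rightarrow> real" where
  "Lq_spectrum \<nu> q = (THE s. has_Lq_spectrum \<nu> q s)"

definition tau_A :: "(real^2) measure \<Rightarrow> real \<Rightarrow> real" where
  "tau_A \<mu> q = Lq_spectrum (distr \<mu> borel (\<lambda>\<xi>. \<xi> $ 1)) q"

definition tau_B :: "(real^2) measure \<Rightarrow> real \<Rightarrow> real" where
  "tau_B \<mu> q = Lq_spectrum (distr \<mu> borel (\<lambda>\<xi>. \<xi> $ 2)) q"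

definition gamma_A ::
  "nat \<Rightarrow> (nat \<Rightarrow> real) \<Rightarrow> (nat \<Rightarrow> real) \<Rightarrow> (nat \<Rightarrow> real) \<Rightarrow> (real^2) measure \<Rightarrow> real \<Rightarrow> real" where
  "gamma_A N a b p \<mu> q =
     (THE g. (\<Sum>i=1..N. p i powr q * a i powr (tau_A \<mu> q) * b i powr (g - tau_A \<mu> q)) = 1)"

definition gamma_B ::
  "nat \<Rightarrow> (nat \<Rightarrow> real) \<Rightarrow> (nat \<Rightarrow> real) \<Rightarrow> (nat \<Rightarrow> real) \<Rightarrow> (real^2) measure \<Rightarrow> real \<Rightarrow> real" where
  "gamma_B N a b p \<mu> q =
     (THE g. (\<Sum>i=1..N. p i powr q * a i powr (g - tau_B \<mu> q) * b i powr (tau_B \<mu> q)) = 1)"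

definition is_maximum :: "real set \<Rightarrow> real \<Rightarrow> bool" where
  "is_maximum S m \<longleftrightarrow> m \<in> S \<and> (\<forall>s\<in>S. s \<le> m)"

definition is_minimum :: "real set \<Rightarrow> real \<Rightarrow> bool" where
  "is_minimum S m \<longleftrightarrow> m \<in> S \<and> (\<forall>s\<in>S. m \<le> s)"

end

theory Submission
  imports Defs
begin

text \<open>
  At scale \<open>\<delta>\<close> the measure is cut along the words \<open>w\<close> whose cylinder, the image of the unit
  square under the composed map, has shorter side about \<open>\<delta>\<close>. These cylinders have disjoint
  interiors and both their sides are at least a constant times \<open>\<delta>\<close>, so that a mesh square of
  size \<open>\<delta>\<close> meets boundedly many of them (\<open>card_cylinders_meeting_square\<close>). The \<open>q\<close>-th power
  sum over the squares is therefore comparable to the sum of the power sums of the pieces. Each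
  piece is flat: across its shorter side the mesh does not resolve it, so it contributes
  \<open>p\<^sub>w\<^sup>q\<close> times the power sum of a projection of the measure, taken along the longer (major)
  side of length \<open>\<alpha>\<close> at scale \<open>\<delta> / \<alpha>\<close> (\<open>square_sum_comparable\<close>). The exponents \<open>\<tau>A\<close> and
  \<open>\<tau>B\<close> of these one-dimensional sums exist because the sums are submultiplicative for
  \<open>q \<ge> 1\<close> and supermultiplicative for \<open>q \<le> 1\<close>, up to constants
  (\<open>strip_sum_exponent_exists\<close>), an argument that allows the projected pieces to overlap. Up to factors
  \<open>\<delta>\<^sup>\<epsilon>\<close>, then, the sum to be estimated is that of \<open>p\<^sub>w\<^sup>q (\<alpha> / \<delta>)\<^sup>\<tau>\<close>, with \<open>\<tau>\<close> the exponent
  of the major direction (\<open>square_sum_bounds\<close>).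

  Whenever \<open>\<Phi> x y = 1\<close>, the numbers \<open>p\<^sub>w\<^sup>q a\<^sub>w\<^sup>x b\<^sub>w\<^sup>y\<close> are probabilities on the cut. Up to
  constants, the term of \<open>w\<close> is its probability times \<open>\<delta>\<close> to the power \<open>-(x + y)\<close> times
  \<open>\<alpha> / \<delta>\<close> to the power \<open>\<tau> - z\<close>, where \<open>z\<close> is the coordinate of \<open>(x, y)\<close> in the
  major direction. If \<open>\<tau> \<le> z\<close> the last factor is bounded above, which yields upper bounds
  \<open>x + y\<close> for the exponent (\<open>growth_leI\<close>); if \<open>z \<le> \<tau>\<close> it is bounded below. If \<open>z > \<tau>\<close> it
  decays with the aspect ratio of the cylinder, whose logarithm is a random walk with drift
  \<open>\<Psi> x y\<close> under these probabilities. When the drift does not point towards that kind of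
  cylinder, such an aspect ratio is a deviation of the walk from its drift. The deviation is a
  martingale of variance \<open>O(log (1 / \<delta>))\<close>, and so costs only a factor
  \<open>\<delta>\<^sup>\<epsilon>\<close> (\<open>growth_geI\<close>).

  The curve \<open>\<Phi> = 1\<close> is decreasing and passes through \<open>(\<tau>A, \<gamma>A - \<tau>A)\<close> and
  \<open>(\<gamma>B - \<tau>B, \<tau>B)\<close>. If it runs below \<open>(\<tau>A, \<tau>B)\<close>, its points between these two are lower
  bounds, and the two ends together dominate all cylinders (\<open>spectrum_max_on_arc\<close>). If it runs
  above, every point between the two is an upper bound, and a matching lower bound comes from an
  end where the drift has the right sign or, failing that, from a zero of the drift in between
  (\<open>spectrum_min_on_arc\<close>). That zero beats both ends strictly because \<open>\<Phi>\<close> is strictly convex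
  along the line \<open>x' + y' = x + y\<close>, on which the drift is its derivative.
\<close>

section \<open>Power sums over covering families\<close>

text \<open>The power of a sum of boundedly many terms is comparable to the sum of the powers, for every
  \<open>q \<ge> 0\<close>. For \<open>q = 0\<close> both sides count positive terms, since \<open>0 powr 0 = 0\<close>.\<close>

lemma powr_sum_le:
  fixes f :: "'i \<Rightarrow> real"
  assumes "finite A" "\<And>x. x \<in> A \<Longrightarrow> 0 \<le> f x" "real (card A) \<le> m" "0 \<le> q"
  shows "(\<Sum>x\<in>A. f x) powr q \<le> m powr q * (\<Sum>x\<in>A. f x powr q)"
proof (cases "A = {}")
  case False
  obtain y where y: "y \<in> A" "\<And>x. x \<in> A \<Longrightarrow> f x \<le> f y"
  proof -
    have "Max (f ` A) \<in> f ` A" using False assms(1) by (intro Max_in) auto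
    then obtain y where "y \<in> A" "f y = Max (f ` A)" by auto
    then show ?thesis using that[of y] assms(1) by simp
  qed
  have "(\<Sum>x\<in>A. f x) \<le> real (card A) * f y"
    using y by (intro sum_bounded_above) auto
  also have "\<dots> \<le> m * f y"
    using assms y by (intro mult_right_mono) auto
  finally have "(\<Sum>x\<in>A. f x) powr q \<le> (m * f y) powr q"
    using assms by (intro powr_mono2 sum_nonneg) auto
  also have "\<dots> = m powr q * f y powr q"
    using assms y by (subst powr_mult) auto
  also have "\<dots> \<le> m powr q * (\<Sum>x\<in>A. f x powr q)"
    using assms y by (intro mult_left_mono member_le_sum) auto
  finally show ?thesis .
qed simp

lemma sum_powr_le:
  fixes f :: "'i \<Rightarrow> real"
  assumes "finite A" "\<And>x. x \<in> A \<Longrightarrow> 0 \<le> f x" "real (card A) \<le> m" "0 \<le> q"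
  shows "(\<Sum>x\<in>A. f x powr q) \<le> m * (\<Sum>x\<in>A. f x) powr q"
proof -
  have "(\<Sum>x\<in>A. f x powr q) \<le> real (card A) * (\<Sum>x\<in>A. f x) powr q"
    using assms by (intro sum_bounded_above powr_mono2 member_le_sum) auto
  also have "\<dots> \<le> m * (\<Sum>x\<in>A. f x) powr q"
    using assms by (intro mult_right_mono) auto
  finally show ?thesis .
qed

text \<open>The comparison behind all changes of mesh: each member of one family is covered by at most
  \<open>m\<close> members of the other, each of which is used at most \<open>m\<close> times.\<close>

lemma sum_powr_covered_le:
  fixes e :: "'i \<Rightarrow> real" and f :: "'j \<Rightarrow> real"
  assumes "finite A" "finite B" "0 \<le> q"
    and e0: "\<And>x. x \<in> A \<Longrightarrow> 0 \<le> e x" and f0: "\<And>y. y \<in> B \<Longrightarrow> 0 \<le> f y"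
    and cover: "\<And>x. x \<in> A \<Longrightarrow> e x \<le> (\<Sum>y | y \<in> B \<and> R x y. f y)"
    and m1: "\<And>x. x \<in> A \<Longrightarrow> real (card {y \<in> B. R x y}) \<le> m"
    and m2: "\<And>y. y \<in> B \<Longrightarrow> real (card {x \<in> A. R x y}) \<le> m"
  shows "(\<Sum>x\<in>A. e x powr q) \<le> m powr q * m * (\<Sum>y\<in>B. f y powr q)"
proof -
  have "(\<Sum>x\<in>A. e x powr q) \<le> (\<Sum>x\<in>A. m powr q * (\<Sum>y | y \<in> B \<and> R x y. f y powr q))"
  proof (rule sum_mono)
    fix x assume x: "x \<in> A"
    have "e x powr q \<le> (\<Sum>y | y \<in> B \<and> R x y. f y) powr q"
      using assms x by (intro powr_mono2) auto
    also have "\<dots> \<le> m powr q * (\<Sum>y | y \<in> B \<and> R x y. f y powr q)"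
      using assms x by (intro powr_sum_le) auto
    finally show "e x powr q \<le> m powr q * (\<Sum>y | y \<in> B \<and> R x y. f y powr q)" .
  qed
  also have "\<dots> = m powr q * (\<Sum>x\<in>A. \<Sum>y | y \<in> B \<and> R x y. f y powr q)"
    by (simp only: sum_distrib_left)
  also have "\<dots> = m powr q * (\<Sum>y\<in>B. \<Sum>x | x \<in> A \<and> R x y. f y powr q)"
    using sum.swap_restrict[OF assms(1,2), of "\<lambda>x y. f y powr q" R] by simp
  also have "\<dots> \<le> m powr q * (\<Sum>y\<in>B. m * f y powr q)"
    using m2 by (intro mult_left_mono sum_mono) (auto intro!: mult_right_mono)
  finally show ?thesis
    by (simp add: sum_distrib_left mult.assoc)
qed

lemma powr_le_tangent:
  fixes t q :: real
  assumes "0 \<le> q" "q \<le> 1" "0 \<le> t"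
  shows "t powr q \<le> 1 + q * (t - 1)"
proof (cases "t = 0 \<or> q = 0 \<or> q = 1")
  case True
  then show ?thesis using assms by auto
next
  case False
  have "t powr q * 1 powr (1 - q) \<le> q * t + (1 - q) * 1"
    using False assms by (intro Youngs_inequality_0) auto
  then show ?thesis by (simp add: algebra_simps)
qed

lemma powr_ge_tangent:
  fixes t q :: real
  assumes "1 \<le> q" "0 \<le> t"
  shows "1 + q * (t - 1) \<le> t powr q"
proof -
  have "(t powr q) powr (1/q) \<le> 1 + (1/q) * (t powr q - 1)"
    using assms by (intro powr_le_tangent) auto
  moreover have "(t powr q) powr (1/q) = t"
    using assms by (simp add: powr_powr)
  ultimately have "q * t \<le> q * (1 + (1/q) * (t powr q - 1))"
    using assms by (intro mult_left_mono) auto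
  then show ?thesis
    using assms by (simp add: algebra_simps)
qed

text \<open>Jensen's inequality for the power function comes from its tangent at the weighted mean
  \<open>m\<close>: the tangent is linear, so its weighted sum is, up to the normalisation of the weights,
  exactly the power of the sum.\<close>

lemma weighted_tangent:
  fixes p x :: "'i \<Rightarrow> real"
  assumes W: "finite W" "\<And>w. w \<in> W \<Longrightarrow> 0 \<le> p w" "\<And>w. w \<in> W \<Longrightarrow> 0 \<le> x w"
    and "(\<Sum>w\<in>W. p w * x w) \<noteq> 0"
  obtains m where "0 < m"
    "(\<Sum>w\<in>W. p w * x w) powr q
      = sum p W powr (q - 1) * (\<Sum>w\<in>W. p w * (m powr q * (1 + q * (x w / m - 1))))"
proof -
  define P m where "P = sum p W" and "m = (\<Sum>w\<in>W. p w * x w) / P"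
  have "P \<noteq> 0"
    using assms sum_nonneg_eq_0_iff[OF W(1), of p] unfolding P_def by auto
  moreover have "0 \<le> P" "0 \<le> (\<Sum>w\<in>W. p w * x w)" using W by (auto simp: P_def intro: sum_nonneg)
  ultimately have P: "0 < P" and m: "0 < m" using assms(4) by (auto simp: m_def)
  have eq: "(\<Sum>w\<in>W. p w * x w) = P * m" using P by (simp add: m_def)
  have "(\<Sum>w\<in>W. p w * (m powr q * (1 + q * (x w / m - 1))))
      = m powr q * ((1 - q) * P + q / m * (\<Sum>w\<in>W. p w * x w))"
    by (simp add: P_def sum_distrib_left sum.distrib[symmetric] algebra_simps sum_subtractf)
  also have "\<dots> = m powr q * P"
    using m by (simp add: eq algebra_simps)
  also have "P powr (q - 1) * \<dots> = (P * m) powr q"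
    using P m by (simp add: powr_mult powr_diff)
  finally show ?thesis using that[OF m] by (simp add: eq P_def)
qed

lemma powr_sum_le_weighted:
  fixes p x :: "'i \<Rightarrow> real"
  assumes W: "finite W" "\<And>w. w \<in> W \<Longrightarrow> 0 \<le> p w" "\<And>w. w \<in> W \<Longrightarrow> 0 \<le> x w" and "1 \<le> q"
  shows "(\<Sum>w\<in>W. p w * x w) powr q \<le> sum p W powr (q - 1) * (\<Sum>w\<in>W. p w * x w powr q)"
proof (cases "(\<Sum>w\<in>W. p w * x w) = 0")
  case True
  then show ?thesis using W by (auto intro!: mult_nonneg_nonneg sum_nonneg)
next
  case False
  obtain m where m: "0 < m" "(\<Sum>w\<in>W. p w * x w) powr q
      = sum p W powr (q - 1) * (\<Sum>w\<in>W. p w * (m powr q * (1 + q * (x w / m - 1))))"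
    by (rule weighted_tangent[of W p x q]) (use W False in blast)+
  have "m powr q * (1 + q * (x w / m - 1)) \<le> x w powr q" if "w \<in> W" for w
    using mult_left_mono[OF powr_ge_tangent[of q "x w / m"], of "m powr q"] W(3)[OF that] m(1) \<open>1 \<le> q\<close>
    by (simp add: powr_divide)
  then show ?thesis unfolding m(2) using W by (intro mult_left_mono sum_mono) auto
qed

lemma powr_sum_ge_weighted:
  fixes p x :: "'i \<Rightarrow> real"
  assumes W: "finite W" "\<And>w. w \<in> W \<Longrightarrow> 0 \<le> p w" "\<And>w. w \<in> W \<Longrightarrow> 0 \<le> x w" and "0 \<le> q" "q \<le> 1"
  shows "sum p W powr (q - 1) * (\<Sum>w\<in>W. p w * x w powr q) \<le> (\<Sum>w\<in>W. p w * x w) powr q"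
proof (cases "(\<Sum>w\<in>W. p w * x w) = 0")
  case True
  then have "\<forall>w\<in>W. p w * x w = 0" using W by (simp add: sum_nonneg_eq_0_iff)
  then have "(\<Sum>w\<in>W. p w * x w powr q) = 0" by (intro sum.neutral) auto
  then show ?thesis by simp
next
  case False
  obtain m where m: "0 < m" "(\<Sum>w\<in>W. p w * x w) powr q
      = sum p W powr (q - 1) * (\<Sum>w\<in>W. p w * (m powr q * (1 + q * (x w / m - 1))))"
    by (rule weighted_tangent[of W p x q]) (use W False in blast)+
  have "x w powr q \<le> m powr q * (1 + q * (x w / m - 1))" if "w \<in> W" for w
    using mult_left_mono[OF powr_le_tangent[of q "x w / m"], of "m powr q"] W(3)[OF that] m(1) assms(4,5)
    by (simp add: powr_divide)
  then show ?thesis unfolding m(2) using W by (intro mult_left_mono sum_mono) auto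
qed

lemma card_mesh_meeting:
  fixes X :: "real set" and \<rho> L :: real
  assumes "0 < \<rho>" "0 \<le> L" and diam: "\<And>x y. x \<in> X \<Longrightarrow> y \<in> X \<Longrightarrow> \<bar>x - y\<bar> \<le> L"
  shows "finite {k::int. \<exists>x\<in>X. \<rho> * k \<le> x \<and> x \<le> \<rho> * (k + 1)}" (is "finite ?K")
    and "real (card {k::int. \<exists>x\<in>X. \<rho> * k \<le> x \<and> x \<le> \<rho> * (k + 1)}) \<le> 2 * L / \<rho> + 2"
proof -
  have "finite ?K \<and> real (card ?K) \<le> 2 * L / \<rho> + 2"
  proof (cases "X = {}")
    case False
    then obtain x0 where x0: "x0 \<in> X" by blast
    have L: "0 \<le> L" using diam[OF x0 x0] by simp
    define u v where "u = (x0 - L) / \<rho> - 1" and "v = (x0 + L) / \<rho>"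
    have uv: "v - u = 2 * L / \<rho> + 1" by (simp add: u_def v_def diff_divide_distrib add_divide_distrib)
    have sub: "?K \<subseteq> {\<lceil>u\<rceil>..\<lfloor>v\<rfloor>}"
    proof
      fix k assume "k \<in> ?K"
      then obtain x where x: "x \<in> X" "\<rho> * k \<le> x" "x \<le> \<rho> * (k + 1)" by auto
      have "\<rho> * k \<le> x0 + L" "x0 - L \<le> \<rho> * (k + 1)"
        using x diam[OF x(1) x0] by (auto simp: abs_le_iff)
      then have "u \<le> k" "k \<le> v"
        using assms(1) by (auto simp: u_def v_def field_simps)
      then show "k \<in> {\<lceil>u\<rceil>..\<lfloor>v\<rfloor>}" by (auto simp: ceiling_le_iff le_floor_iff)
    qed
    then have "card ?K \<le> card {\<lceil>u\<rceil>..\<lfloor>v\<rfloor>}" by (intro card_mono) auto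
    also have "\<dots> = nat (\<lfloor>v\<rfloor> - \<lceil>u\<rceil> + 1)" by simp
    finally have "real (card ?K) \<le> real (nat (\<lfloor>v\<rfloor> - \<lceil>u\<rceil> + 1))" by simp
    also have "\<dots> \<le> max 0 (v - u + 1)"
      using of_int_floor_le[of v] le_of_int_ceiling[of u] by linarith
    also have "\<dots> = 2 * L / \<rho> + 2" using uv L assms(1) by simp
    finally show ?thesis using sub finite_subset by blast
  next
    case True
    then show ?thesis using assms by simp
  qed
  then show "finite ?K" "real (card ?K) \<le> 2 * L / \<rho> + 2" by auto
qed

section \<open>Subadditive functions of a real variable\<close>

text \<open>Fekete's argument: the limit is the infimum of \<open>H t / t\<close> with \<open>H = G + C\<close>
  subadditive.\<close>

lemma subadditive_limit:
  fixes G :: "real \<Rightarrow> real"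
  assumes sub: "\<And>s t. 0 < s \<Longrightarrow> 0 < t \<Longrightarrow> G (s + t) \<le> G s + G t + C"
    and bound: "\<And>t. 0 < t \<Longrightarrow> \<bar>G t\<bar> \<le> c1 + c2 * t"
  shows "\<exists>l. ((\<lambda>t. G t / t) \<longlongrightarrow> l) at_top"
proof -
  define H where "H t = G t + C" for t
  have H: "H (s + t) \<le> H s + H t" if "0 < s" "0 < t" for s t
    using sub[OF that] by (simp add: H_def)
  have Hmult: "H (real (Suc n) * s + r) \<le> real (Suc n) * H s + H r" if "0 < s" "0 < r" for n s r
  proof (induction n)
    case 0
    show ?case using H[of s r] that by simp
  next
    case (Suc n)
    have "H (s + (real (Suc n) * s + r)) \<le> H s + H (real (Suc n) * s + r)"
      using that by (intro H) (auto intro: add_nonneg_pos)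
    then show ?case using Suc by (simp add: algebra_simps)
  qed
  define B where "B = c1 + \<bar>C\<bar> + \<bar>c2\<bar>"
  have c1: "0 \<le> B"
    using bound[of 1] by (simp add: B_def)
  have Hb: "\<bar>H t\<bar> \<le> (c1 + \<bar>C\<bar>) + \<bar>c2\<bar> * t" if "0 < t" for t
  proof -
    have "c2 * t \<le> \<bar>c2\<bar> * t" using that by (intro mult_right_mono) auto
    then show ?thesis using bound[OF that] unfolding H_def by linarith
  qed
  define l where "l = (INF t\<in>{1..}. H t / t)"
  have low: "- (\<bar>c1 + \<bar>C\<bar>\<bar> + \<bar>c2\<bar>) \<le> H t / t" if "1 \<le> t" for t
  proof -
    have "c1 + \<bar>C\<bar> \<le> \<bar>c1 + \<bar>C\<bar>\<bar> * t"
      using that mult_left_mono[of 1 t "\<bar>c1 + \<bar>C\<bar>\<bar>"] by (simp add: abs_le_iff)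
    then have "\<bar>H t\<bar> \<le> (\<bar>c1 + \<bar>C\<bar>\<bar> + \<bar>c2\<bar>) * t"
      using Hb[of t] that by (simp add: algebra_simps)
    then have "- (\<bar>c1 + \<bar>C\<bar>\<bar> + \<bar>c2\<bar>) * t \<le> H t" by (simp add: abs_le_iff algebra_simps)
    then show ?thesis using that by (subst pos_le_divide_eq) auto
  qed
  have bdd: "bdd_below ((\<lambda>t. H t / t) ` {1..})"
    using low by (intro bdd_belowI2[of _ "- (\<bar>c1 + \<bar>C\<bar>\<bar> + \<bar>c2\<bar>)"]) auto
  have lle: "l \<le> H t / t" if "1 \<le> t" for t
    unfolding l_def using that by (intro cINF_lower[OF bdd]) auto
  have "((\<lambda>t. H t / t) \<longlongrightarrow> l) at_top"
  proof (rule tendstoI)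
    fix e :: real assume e: "0 < e"
    obtain s where s: "1 \<le> s" "H s / s < l + e / 2"
    proof -
      have "\<exists>s\<in>{1..}. H s / s < l + e / 2"
        unfolding l_def using e bdd by (subst cINF_less_iff[symmetric]) auto
      then show ?thesis using that by auto
    qed
    define D where "D = 2 * s * \<bar>l + e / 2\<bar> + \<bar>c1 + \<bar>C\<bar>\<bar> + \<bar>c2\<bar> * (2 * s)"
    have D: "0 \<le> D" using s by (simp add: D_def)
    have "\<forall>\<^sub>F t in at_top. max (3 * s) (4 * (D + 1) / e) \<le> t"
      by (rule eventually_ge_at_top)
    then show "\<forall>\<^sub>F t in at_top. dist (H t / t) l < e"
    proof eventually_elim
      case (elim t)
      have t: "3 * s \<le> t" "4 * (D + 1) / e \<le> t" "1 \<le> t" using elim s by auto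
      \<comment> \<open>Stopping one step short of the quotient keeps the remainder \<open>r\<close> between \<open>s\<close> and
        \<open>2 s\<close>, so that it is positive.\<close>
      define n where "n = nat \<lfloor>(t - s) / s\<rfloor> - 1"
      define r where "r = t - real (Suc n) * s"
      have "2 \<le> \<lfloor>(t - s) / s\<rfloor>" using t s by (simp add: le_floor_iff field_simps)
      then have n: "real (Suc n) = of_int \<lfloor>(t - s) / s\<rfloor>" unfolding n_def by linarith
      have "real (Suc n) \<le> (t - s) / s" "(t - s) / s < real (Suc n) + 1"
        unfolding n by linarith+
      then have r: "s \<le> r" "r \<le> 2 * s"
        using s unfolding r_def by (auto simp: field_simps)
      have H1: "H t \<le> real (Suc n) * H s + H r"
        using Hmult[of s r n] s r by (simp add: r_def)
      have H2: "real (Suc n) * H s \<le> real (Suc n) * (s * (l + e / 2))"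
        using s by (intro mult_left_mono) (auto simp: field_simps)
      have H3: "real (Suc n) * (s * (l + e / 2)) = t * (l + e / 2) - r * (l + e / 2)"
        by (simp add: r_def algebra_simps)
      have H4: "- (r * (l + e / 2)) \<le> 2 * s * \<bar>l + e / 2\<bar>"
      proof -
        have "- (r * (l + e / 2)) \<le> r * \<bar>l + e / 2\<bar>"
          using r s by (metis abs_ge_minus_self abs_mult abs_of_nonneg order.trans zero_le_one)
        also have "\<dots> \<le> 2 * s * \<bar>l + e / 2\<bar>" using r by (intro mult_right_mono) auto
        finally show ?thesis .
      qed
      have H5: "H r \<le> \<bar>c1 + \<bar>C\<bar>\<bar> + \<bar>c2\<bar> * (2 * s)"
      proof -
        have "\<bar>c2\<bar> * r \<le> \<bar>c2\<bar> * (2 * s)" using r by (intro mult_left_mono) auto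
        then show ?thesis using Hb[of r] r s by linarith
      qed
      from H1 H2 H3 H4 H5 have "H t \<le> t * (l + e / 2) + D" unfolding D_def by linarith
      moreover have "D < t * (e / 2)"
      proof -
        have "4 * (D + 1) \<le> t * e" using t e by (simp add: field_simps)
        then show ?thesis using D by simp
      qed
      ultimately have "H t < t * (l + e / 2) + t * (e / 2)" by linarith
      then have "H t < t * (l + e)" by (simp add: algebra_simps)
      then have "H t / t < l + e" using t by (simp add: field_simps)
      moreover have "l \<le> H t / t" using t by (intro lle) auto
      ultimately show ?case by (simp add: dist_real_def)
    qed
  qed
  moreover have "((\<lambda>t. C / t) \<longlongrightarrow> 0) at_top"
    by (intro tendsto_divide_0[OF tendsto_const] filterlim_at_top_imp_at_infinity filterlim_ident)
  ultimately have "((\<lambda>t. H t / t - C / t) \<longlongrightarrow> l - 0) at_top"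
    by (rule tendsto_diff)
  moreover have "H t / t - C / t = G t / t" for t by (simp add: H_def diff_divide_distrib[symmetric])
  ultimately show ?thesis by auto
qed

section \<open>Words and stopping families\<close>

locale diagonal_self_affine =
  fixes N :: nat and T :: "nat \<Rightarrow> real^2^2" and v :: "nat \<Rightarrow> real^2"
    and p :: "nat \<Rightarrow> real" and \<mu> :: "(real^2) measure" and q :: real
  assumes diagonal: "i \<in> {1..N} \<Longrightarrow> c \<noteq> d \<Longrightarrow> T i $ c $ d = 0"
    and contracting: "i \<in> {1..N} \<Longrightarrow> 0 < \<bar>T i $ c $ c\<bar> \<and> \<bar>T i $ c $ c\<bar> < 1"
    and rosc: "ROSC N T v"
    and prob: "positive_prob_vector N p"
    and self_affine: "self_affine_measure N T v p \<mu>"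
    and q_nonneg: "0 \<le> q"
begin

abbreviation \<psi> :: "nat \<Rightarrow> real^2 \<Rightarrow> real^2" where "\<psi> i \<equiv> affine_map (T i) (v i)"

abbreviation letters :: "nat set" where "letters \<equiv> {1..N}"

text \<open>The head of a word acts first, so that prepending a letter subdivides a cylinder.\<close>

primrec wmap :: "nat list \<Rightarrow> real^2 \<Rightarrow> real^2" where
  "wmap [] = id"
| "wmap (i # w) = wmap w \<circ> \<psi> i"

definition scale :: "2 \<Rightarrow> nat list \<Rightarrow> real" where
  "scale c w = (\<Prod>i\<leftarrow>w. \<bar>T i $ c $ c\<bar>)"

definition weight :: "nat list \<Rightarrow> real" where
  "weight w = (\<Prod>i\<leftarrow>w. p i)"

text \<open>The extensions of \<open>w\<close> at which \<open>P\<close> holds for the first time, cut off after \<open>n\<close> more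
  letters.\<close>

primrec stopping :: "(nat list \<Rightarrow> bool) \<Rightarrow> nat \<Rightarrow> nat list \<Rightarrow> nat list set" where
  "stopping P 0 w = {w}"
| "stopping P (Suc n) w = (if P w then {w} else (\<Union>i\<in>letters. stopping P n (i # w)))"

lemma p_pos: "i \<in> letters \<Longrightarrow> 0 < p i"
  and sum_p: "(\<Sum>i\<in>letters. p i) = 1"
  using prob unfolding positive_prob_vector_def by auto

lemma letters_nonempty: "letters \<noteq> {}"
  using sum_p by (metis sum.empty zero_neq_one)

lemma psi_component: "i \<in> letters \<Longrightarrow> \<psi> i \<xi> $ c = T i $ c $ c * \<xi> $ c + v i $ c"
proof -
  assume i: "i \<in> letters"
  have "(\<Sum>d\<in>UNIV. T i $ c $ d * \<xi> $ d) = (\<Sum>d\<in>UNIV. if d = c then T i $ c $ c * \<xi> $ c else 0)"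
    using diagonal[OF i] by (intro sum.cong) auto
  then show ?thesis by (simp add: affine_map_def matrix_vector_mult_def)
qed

lemma scale_Cons: "scale c (i # w) = \<bar>T i $ c $ c\<bar> * scale c w"
  and scale_Nil: "scale c [] = 1"
  by (simp_all add: scale_def)

lemma weight_Cons: "weight (i # w) = p i * weight w"
  and weight_Nil: "weight [] = 1"
  by (simp_all add: weight_def)

lemma scale_pos: "set w \<subseteq> letters \<Longrightarrow> 0 < scale c w"
  by (induction w) (use contracting in \<open>auto simp: scale_Cons scale_Nil\<close>)

lemma scale_le_1: "set w \<subseteq> letters \<Longrightarrow> scale c w \<le> 1"
proof (induction w)
  case (Cons i w)
  have "\<bar>T i $ c $ c\<bar> * scale c w \<le> 1 * 1"
    using Cons contracting[of i c] scale_pos[of w c] by (intro mult_mono) auto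
  then show ?case by (simp add: scale_Cons)
qed (simp add: scale_Nil)

lemma weight_pos: "set w \<subseteq> letters \<Longrightarrow> 0 < weight w"
  by (induction w) (use p_pos in \<open>auto simp: weight_Cons weight_Nil\<close>)

lemma wmap_component:
  assumes "set w \<subseteq> letters"
  obtains s u where "\<bar>s\<bar> = scale c w" "\<And>\<xi>. wmap w \<xi> $ c = s * \<xi> $ c + u"
proof -
  have "\<exists>s u. \<bar>s\<bar> = scale c w \<and> (\<forall>\<xi>. wmap w \<xi> $ c = s * \<xi> $ c + u)"
    using assms
  proof (induction w)
    case Nil
    have "\<bar>1\<bar> = scale c [] \<and> (\<forall>\<xi>. wmap [] \<xi> $ c = 1 * \<xi> $ c + 0)" by (simp add: scale_Nil)
    then show ?case by blast
  next
    case (Cons i w)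
    then obtain s u where su: "\<bar>s\<bar> = scale c w" "\<And>\<xi>. wmap w \<xi> $ c = s * \<xi> $ c + u"
      by auto
    have "\<bar>s * T i $ c $ c\<bar> = scale c (i # w)"
      "\<And>\<xi>. wmap (i # w) \<xi> $ c = (s * T i $ c $ c) * \<xi> $ c + (s * v i $ c + u)"
      using su Cons.prems by (simp_all add: scale_Cons abs_mult psi_component algebra_simps)
    then show ?case by blast
  qed
  then show ?thesis using that by blast
qed

lemma wmap_component_dist:
  assumes "set w \<subseteq> letters"
  shows "\<bar>wmap w \<xi> $ c - wmap w \<eta> $ c\<bar> = scale c w * \<bar>\<xi> $ c - \<eta> $ c\<bar>"
proof -
  obtain s u where su: "\<bar>s\<bar> = scale c w" "\<And>\<xi>. wmap w \<xi> $ c = s * \<xi> $ c + u"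
    by (rule wmap_component[OF assms, of c]) auto
  have "wmap w \<xi> $ c - wmap w \<eta> $ c = s * (\<xi> $ c - \<eta> $ c)"
    by (simp only: su(2) right_diff_distrib)
  then show ?thesis using su(1) by (simp add: abs_mult)
qed

lemma continuous_wmap: "continuous_on UNIV (wmap w)"
proof (induction w)
  case (Cons i w)
  have "continuous_on UNIV (\<psi> i)"
    unfolding affine_map_def by (intro continuous_intros)
  then show ?case
    using Cons continuous_on_compose[of UNIV "\<psi> i" "wmap w"] continuous_on_subset by auto
qed (simp add: id_def)

lemma inj_wmap:
  assumes "set w \<subseteq> letters"
  shows "inj (wmap w)"
proof (rule injI)
  fix \<xi> \<eta> assume eq: "wmap w \<xi> = wmap w \<eta>"
  have "\<xi> $ c = \<eta> $ c" for c
  proof -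
    obtain s u where su: "\<bar>s\<bar> = scale c w" "\<And>\<xi>. wmap w \<xi> $ c = s * \<xi> $ c + u"
      by (rule wmap_component[OF assms, of c]) auto
    have "s \<noteq> 0" using su(1) scale_pos[OF assms, of c] by auto
    then show ?thesis using su(2)[of \<xi>] su(2)[of \<eta>] eq by simp
  qed
  then show "\<xi> = \<eta>" by (simp add: vec_eq_iff)
qed

lemma sets_mu [measurable_cong, simp]: "sets \<mu> = sets borel"
  using self_affine unfolding self_affine_measure_def by simp

lemma space_mu [simp]: "space \<mu> = UNIV"
  using sets_eq_imp_space_eq[OF sets_mu] by simp

sublocale finite_measure \<mu>
  using self_affine unfolding self_affine_measure_def by (intro finite_measureI) simp

lemma measure_UNIV [simp]: "measure \<mu> UNIV = 1"
  using self_affine unfolding self_affine_measure_def by (simp add: measure_def)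

lemma measure_le_1: "measure \<mu> E \<le> 1"
  using bounded_measure[of E] by simp

lemma mu_self_affine: "E \<in> sets borel \<Longrightarrow> measure \<mu> E = (\<Sum>i\<in>letters. p i * measure \<mu> (\<psi> i -` E))"
  using self_affine unfolding self_affine_measure_def by simp

lemma wmap_vimage_borel [measurable]: "E \<in> sets borel \<Longrightarrow> wmap w -` E \<in> sets borel"
  using borel_measurable_continuous_onI[OF continuous_wmap[of w]] by (auto simp: measurable_def)

lemma finite_stopping: "finite (stopping P n w)"
  by (induction n arbitrary: w) auto

lemma stopping_suffix: "u \<in> stopping P n w \<Longrightarrow> \<exists>z. u = z @ w \<and> set z \<subseteq> letters \<and> length z \<le> n"
proof (induction n arbitrary: w)
  case (Suc n)
  show ?case
  proof (cases "P w")
    case False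
    with Suc.prems obtain i where i: "i \<in> letters" "u \<in> stopping P n (i # w)" by auto
    from Suc.IH[OF i(2)] obtain z where "u = z @ i # w" "set z \<subseteq> letters" "length z \<le> n" by auto
    then have "u = (z @ [i]) @ w" "set (z @ [i]) \<subseteq> letters" "length (z @ [i]) \<le> Suc n"
      using i by auto
    then show ?thesis by blast
  qed (use Suc.prems in auto)
qed simp

lemma stopping_disjoint:
  assumes "i \<noteq> j"
  shows "stopping P n (i # w) \<inter> stopping P n (j # w) = {}"
proof (rule ccontr)
  assume "\<not> ?thesis"
  then obtain u where "u \<in> stopping P n (i # w)" "u \<in> stopping P n (j # w)" by auto
  then obtain z z' where "u = z @ i # w" "u = z' @ j # w"
    using stopping_suffix by blast
  then have "(z @ [i]) @ w = (z' @ [j]) @ w" by simp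
  then show False using assms by (metis append_same_eq last_snoc)
qed

text \<open>A function that splits its mass among the children of each word has the same total on every
  cut of the tree. Cylinder masses, Gibbs weights and martingales are all summed in this way.\<close>

lemma sum_stopping:
  fixes F :: "nat list \<Rightarrow> real"
  assumes "\<And>u. set u \<subseteq> letters \<Longrightarrow> F u = (\<Sum>i\<in>letters. F (i # u))"
  shows "set w \<subseteq> letters \<Longrightarrow> (\<Sum>u\<in>stopping P n w. F u) = F w"
proof (induction n arbitrary: w)
  case (Suc n)
  show ?case
  proof (cases "P w")
    case False
    then have "(\<Sum>u\<in>stopping P (Suc n) w. F u) = (\<Sum>i\<in>letters. \<Sum>u\<in>stopping P n (i # w). F u)"
      using stopping_disjoint[of _ _ P n w]
      by (simp add: sum.UNION_disjoint finite_stopping)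
    also have "\<dots> = F w" using Suc.IH Suc.prems assms[of w] by simp
    finally show ?thesis .
  qed simp
qed simp

text \<open>The self-affinity of the measure, iterated along a cut.\<close>

lemma measure_stopping:
  assumes [measurable]: "E \<in> sets borel"
  shows "measure \<mu> E = (\<Sum>w\<in>stopping P n []. weight w * measure \<mu> (wmap w -` E))"
proof -
  have "(\<Sum>w\<in>stopping P n []. weight w * measure \<mu> (wmap w -` E))
      = weight [] * measure \<mu> (wmap [] -` E)"
  proof (rule sum_stopping)
    fix u
    have "weight u * measure \<mu> (wmap u -` E) = weight u * (\<Sum>i\<in>letters. p i * measure \<mu> (\<psi> i -` (wmap u -` E)))"
      by (subst mu_self_affine) auto
    also have "\<dots> = (\<Sum>i\<in>letters. weight (i # u) * measure \<mu> (wmap (i # u) -` E))"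
      by (simp add: sum_distrib_left weight_Cons vimage_comp mult_ac)
    finally show "weight u * measure \<mu> (wmap u -` E) = (\<Sum>i\<in>letters. weight (i # u) * measure \<mu> (wmap (i # u) -` E))" .
  qed simp
  then show ?thesis by (simp add: weight_Nil)
qed

lemma wmap_image_box_disjoint:
  assumes "u \<in> stopping P n w" "u' \<in> stopping P n w" "u \<noteq> u'" "set w \<subseteq> letters"
  shows "wmap u ` box 0 1 \<inter> wmap u' ` box 0 1 = {}"
  using assms
proof (induction n arbitrary: w)
  case (Suc n)
  have sub: "wmap u ` box 0 1 \<subseteq> wmap (i # w) ` box 0 1" 
    if u: "u \<in> stopping P n (i # w)" and i: "i \<in> letters" for u i w
  proof -
    have z: "wmap (z @ w) ` box 0 1 \<subseteq> wmap w ` box 0 1" if "set z \<subseteq> letters" for z w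
      using that
    proof (induction z)
      case (Cons j z)
      have "\<psi> j ` box 0 1 \<subseteq> box 0 1" using rosc Cons.prems unfolding ROSC_def by auto
      then have "wmap ((j # z) @ w) ` box 0 1 \<subseteq> wmap (z @ w) ` box 0 1"
        by (auto simp: image_subset_iff)
      then show ?case using Cons by auto
    qed simp
    show ?thesis using stopping_suffix[OF u] z by blast
  qed
  show ?case
  proof (cases "P w")
    case False
    with Suc.prems obtain i j where i: "i \<in> letters" "u \<in> stopping P n (i # w)"
      and j: "j \<in> letters" "u' \<in> stopping P n (j # w)" by auto
    show ?thesis
    proof (cases "i = j")
      case True
      then show ?thesis using Suc.IH[of "i # w"] i j Suc.prems by auto
    next
      case False
      then have "\<psi> i ` box 0 1 \<inter> \<psi> j ` box 0 1 = {}"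
        using rosc i j unfolding ROSC_def disjoint_family_on_def by auto
      then have "wmap (i # w) ` box 0 1 \<inter> wmap (j # w) ` box 0 1 = {}"
        using inj_wmap[OF Suc.prems(4)] by (force simp: inj_def)
      then show ?thesis using sub[OF i(2,1)] sub[OF j(2,1)] by blast
    qed
  qed (use Suc.prems in auto)
qed simp

lemma stopping_letters: "u \<in> stopping P n [] \<Longrightarrow> set u \<subseteq> letters \<and> length u \<le> n"
  using stopping_suffix by fastforce

lemma stopping_stops:
  assumes "\<And>w. set w \<subseteq> letters \<Longrightarrow> n \<le> length w \<Longrightarrow> P w"
  shows "u \<in> stopping P n [] \<Longrightarrow> P u"
proof -
  have "u \<in> stopping P k w \<Longrightarrow> set w \<subseteq> letters \<Longrightarrow> n \<le> k + length w \<Longrightarrow> P u" for k w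
  proof (induction k arbitrary: w)
    case 0
    then show ?case using assms by simp
  next
    case (Suc k)
    show ?case
    proof (cases "P w")
      case False
      with Suc.prems obtain i where i: "i \<in> letters" "u \<in> stopping P k (i # w)" by auto
      then show ?thesis using Suc.IH[OF i(2)] Suc.prems by auto
    qed (use Suc.prems in auto)
  qed
  then show "u \<in> stopping P n [] \<Longrightarrow> P u" by auto
qed

lemma stopping_invariant:
  assumes "R []" "\<And>w i. set w \<subseteq> letters \<Longrightarrow> i \<in> letters \<Longrightarrow> \<not> P w \<Longrightarrow> R (i # w)"
  shows "u \<in> stopping P n [] \<Longrightarrow> R u"
proof -
  have "u \<in> stopping P n w \<Longrightarrow> set w \<subseteq> letters \<Longrightarrow> R w \<Longrightarrow> R u" for w
  proof (induction n arbitrary: w)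
    case (Suc n)
    show ?case
    proof (cases "P w")
      case False
      with Suc.prems obtain i where i: "i \<in> letters" "u \<in> stopping P n (i # w)" by auto
      then show ?thesis using Suc.IH[OF i(2)] Suc.prems assms(2)[OF _ i(1) False] by auto
    qed (use Suc.prems in auto)
  qed simp
  then show "u \<in> stopping P n [] \<Longrightarrow> R u" using assms(1) by auto
qed

definition ratios :: "real set" where
  "ratios = (\<lambda>(i, c). \<bar>T i $ c $ c\<bar>) ` (letters \<times> UNIV)"

definition lo :: real where "lo = Min ratios"

definition hi :: real where "hi = Max ratios"

lemma lo_hi:
  shows "0 < lo" "lo < 1" "0 < hi" "hi < 1"
    and lo_le: "i \<in> letters \<Longrightarrow> lo \<le> \<bar>T i $ c $ c\<bar>"
    and le_hi: "i \<in> letters \<Longrightarrow> \<bar>T i $ c $ c\<bar> \<le> hi"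
proof -
  have S: "finite ratios" "ratios \<noteq> {}" unfolding ratios_def using letters_nonempty by auto
  have *: "0 < x \<and> x < 1" if "x \<in> ratios" for x using that contracting unfolding ratios_def by auto
  show "0 < lo" "lo < 1" "0 < hi" "hi < 1"
    using *[OF Min_in[OF S]] *[OF Max_in[OF S]] by (auto simp: lo_def hi_def)
  assume "i \<in> letters"
  then have "\<bar>T i $ c $ c\<bar> \<in> ratios" unfolding ratios_def by force
  then show "lo \<le> \<bar>T i $ c $ c\<bar>" "\<bar>T i $ c $ c\<bar> \<le> hi" using S by (auto simp: lo_def hi_def)
qed

section \<open>The support of the measure\<close>

lemma psi_unit_interval:
  assumes i: "i \<in> letters" and x: "0 \<le> x" "x \<le> 1"
  shows "0 \<le> T i $ c $ c * x + v i $ c" "T i $ c $ c * x + v i $ c \<le> 1"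
proof -
  have open_case: "0 < T i $ c $ c * x + v i $ c \<and> T i $ c $ c * x + v i $ c < 1" if "0 < x" "x < 1" for x
  proof -
    have "(\<chi> c. x) \<in> box (0::real^2) 1" using that by (simp add: mem_box_cart)
    then have "\<psi> i (\<chi> c. x) \<in> box 0 1" using rosc i unfolding ROSC_def by blast
    then have "0 < \<psi> i (\<chi> c. x) $ c \<and> \<psi> i (\<chi> c. x) $ c < 1" by (simp add: mem_box_cart)
    then show ?thesis by (simp add: psi_component[OF i])
  qed
  have "closure {0<..<1::real} = {0..1}" by (intro closure_greaterThanLessThan) auto
  then have "x \<in> closure {0<..<1}" using x by simp
  moreover have "(\<lambda>x. T i $ c $ c * x + v i $ c) ` closure {0<..<1} \<subseteq> {0..1}"
    using open_case
    by (intro image_closure_subset continuous_intros) (auto simp: image_subset_iff intro: less_imp_le)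
  ultimately have "T i $ c $ c * x + v i $ c \<in> {0..1}" by blast
  then show "0 \<le> T i $ c $ c * x + v i $ c" "T i $ c $ c * x + v i $ c \<le> 1" by auto
qed

lemma psi_neighbourhood:
  assumes i: "i \<in> letters" and r: "0 \<le> r" and h: "\<bar>T i $ c $ c\<bar> \<le> h" and x: "- r \<le> x" "x \<le> 1 + r"
  shows "- (h * r) \<le> T i $ c $ c * x + v i $ c" "T i $ c $ c * x + v i $ c \<le> 1 + h * r"
proof -
  define y where "y = max 0 (min 1 x)"
  have y: "0 \<le> y" "y \<le> 1" "\<bar>x - y\<bar> \<le> r" using x r by (auto simp: y_def)
  have "\<bar>T i $ c $ c * (x - y)\<bar> \<le> h * r"
    unfolding abs_mult using h y by (intro mult_mono) auto
  then show "- (h * r) \<le> T i $ c $ c * x + v i $ c" "T i $ c $ c * x + v i $ c \<le> 1 + h * r"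
    using psi_unit_interval[OF i y(1,2), of c] by (auto simp: abs_le_iff algebra_simps)
qed

text \<open>The measure is only assumed to be a Borel probability. Its support is found by contraction:
  each map carries the \<open>r\<close>-neighbourhood of the unit square into the \<open>h r\<close>-neighbourhood with
  \<open>h < 1\<close>, so by self-affinity all neighbourhoods have the same mass as the square.\<close>

theorem measure_unit_square: "measure \<mu> (cbox 0 1) = 1"
proof -
  define h where "h = hi"
  have lo: "0 < h" "h < 1" "\<And>i c. i \<in> letters \<Longrightarrow> \<bar>T i $ c $ c\<bar> \<le> h"
    using lo_hi by (auto simp: h_def)
  define E where "E r = {\<xi>::real^2. \<forall>c. - r \<le> \<xi> $ c \<and> \<xi> $ c \<le> 1 + r}" for r
  have E_cbox: "E r = cbox (\<chi> c. - r) (\<chi> c. 1 + r)" for r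
    by (auto simp: E_def mem_box_cart)
  have [measurable]: "E r \<in> sets borel" for r unfolding E_cbox by simp
  have step: "measure \<mu> (E r) \<le> measure \<mu> (E (h * r))" if "0 \<le> r" for r
  proof -
    have "E r \<subseteq> \<psi> i -` E (h * r)" if "i \<in> letters" for i
      using psi_neighbourhood[OF that \<open>0 \<le> r\<close> lo(3)[OF that]] psi_component[OF that] by (auto simp: E_def)
    moreover have "\<psi> i -` E (h * r) \<in> sets borel" for i
      using wmap_vimage_borel[of "E (h * r)" "[i]"] by simp
    ultimately have "measure \<mu> (E r) \<le> measure \<mu> (\<psi> i -` E (h * r))" if "i \<in> letters" for i
      using that by (intro finite_measure_mono) auto
    then have "(\<Sum>i\<in>letters. p i * measure \<mu> (E r)) \<le> (\<Sum>i\<in>letters. p i * measure \<mu> (\<psi> i -` E (h * r)))"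
      using p_pos by (intro sum_mono mult_left_mono) (auto intro: less_imp_le)
    also have "\<dots> = measure \<mu> (E (h * r))" by (rule mu_self_affine[symmetric]) simp
    finally show ?thesis using sum_p by (simp add: sum_distrib_right[symmetric])
  qed
  have iter: "measure \<mu> (E r) \<le> measure \<mu> (E (h ^ n * r))" if "0 \<le> r" for r n
  proof (induction n)
    case (Suc n)
    have "measure \<mu> (E (h ^ n * r)) \<le> measure \<mu> (E (h * (h ^ n * r)))"
      using that lo by (intro step) auto
    then show ?case using Suc by (simp add: mult.assoc)
  qed simp
  have E0: "E 0 = cbox 0 1" by (auto simp: E_def mem_box_cart)
  have le: "measure \<mu> (E r) \<le> measure \<mu> (E 0)" if r: "0 \<le> r" for r
  proof -
    have lim0: "(\<lambda>n. h ^ n * r) \<longlonglongrightarrow> 0"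
      using lo by (intro tendsto_mult_left_zero LIMSEQ_power_zero) auto
    have Int: "(\<Inter>n. E (h ^ n * r)) = E 0"
    proof (intro equalityI subsetI)
      fix \<xi> assume \<xi>: "\<xi> \<in> (\<Inter>n. E (h ^ n * r))"
      have "0 \<le> \<xi> $ c \<and> \<xi> $ c \<le> 1" for c
      proof
        have "- (h ^ n * r) \<le> \<xi> $ c" "\<xi> $ c \<le> 1 + h ^ n * r" for n using \<xi> by (auto simp: E_def)
        then show "0 \<le> \<xi> $ c" "\<xi> $ c \<le> 1"
          using LIMSEQ_le_const2[OF tendsto_minus[OF lim0], of "\<xi> $ c"]
            LIMSEQ_le_const[OF tendsto_add[OF tendsto_const lim0], of "\<xi> $ c" 1] by auto
      qed
      then show "\<xi> \<in> E 0" by (simp add: E_def)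
    next
      fix \<xi> assume \<xi>: "\<xi> \<in> E 0"
      have "\<xi> \<in> E (h ^ n * r)" for n
      proof -
        have "0 \<le> h ^ n * r" using lo r by simp
        then show ?thesis using \<xi> unfolding E_def by (smt (verit) mem_Collect_eq)
      qed
      then show "\<xi> \<in> (\<Inter>n. E (h ^ n * r))" by blast
    qed
    have "decseq (\<lambda>n. E (h ^ n * r))"
    proof (rule decseq_SucI)
      fix n
      have "h ^ Suc n * r \<le> h ^ n * r" using lo r by (intro mult_right_mono power_decreasing) auto
      then show "E (h ^ Suc n * r) \<subseteq> E (h ^ n * r)"
        unfolding E_def by (smt (verit) Collect_mono)
    qed
    then have "(\<lambda>n. measure \<mu> (E (h ^ n * r))) \<longlonglongrightarrow> measure \<mu> (\<Inter>n. E (h ^ n * r))"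
      by (intro finite_Lim_measure_decseq) auto
    then show ?thesis unfolding Int
      using iter[OF r] by (intro LIMSEQ_le_const) auto
  qed
  have "(\<lambda>n. measure \<mu> (E (real n))) \<longlonglongrightarrow> measure \<mu> (\<Union>n. E (real n))"
  proof (intro finite_Lim_measure_incseq)
    show "incseq (\<lambda>n. E (real n))"
      unfolding incseq_def E_def by (smt (verit) Collect_mono of_nat_mono)
  qed auto
  moreover have "(\<Union>n. E (real n)) = UNIV"
  proof (rule UNIV_eq_I[symmetric])
    fix \<xi> :: "real^2"
    obtain n where n: "norm \<xi> \<le> real n" using real_arch_simple by blast
    have "\<bar>\<xi> $ c\<bar> \<le> real n" for c using component_le_norm_cart[of \<xi> c] n by linarith
    then have "\<xi> \<in> E (real n)" unfolding E_def by (auto simp: abs_le_iff) (smt (verit, best))+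
    then show "\<xi> \<in> (\<Union>n. E (real n))" by blast
  qed
  ultimately have "(\<lambda>n. measure \<mu> (E (real n))) \<longlonglongrightarrow> 1" by simp
  then have "1 \<le> measure \<mu> (E 0)" by (rule LIMSEQ_le_const2) (use le in auto)
  then show ?thesis using E0 measure_le_1[of "E 0"] by simp
qed

end

section \<open>Strips and mesh sums\<close>

context diagonal_self_affine
begin

definition strip :: "2 \<Rightarrow> real \<Rightarrow> int \<Rightarrow> (real^2) set" where
  "strip c \<delta> k = {\<xi>. \<delta> * k \<le> \<xi> $ c \<and> \<xi> $ c \<le> \<delta> * (k + 1)}"

text \<open>Index \<open>-1\<close> belongs here because its closed mesh interval contains \<open>0\<close>.\<close>

definition mesh_range :: "real \<Rightarrow> int set" where
  "mesh_range \<delta> = {-1..\<lfloor>1 / \<delta>\<rfloor>}"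

text \<open>The power sum of a projection of \<open>\<mu>\<close>, with the mesh intervals lifted to strips in the
  plane.\<close>

definition strip_sum :: "2 \<Rightarrow> real \<Rightarrow> real" where
  "strip_sum c \<delta> = (\<Sum>k\<in>mesh_range \<delta>. measure \<mu> (strip c \<delta> k) powr q)"

lemma mem_strip: "\<xi> \<in> strip c \<delta> k \<longleftrightarrow> \<delta> * k \<le> \<xi> $ c \<and> \<xi> $ c \<le> \<delta> * (k + 1)"
  by (simp add: strip_def)

lemma mem_unit_square: "\<xi> \<in> cbox (0::real^2) 1 \<longleftrightarrow> (\<forall>c. 0 \<le> \<xi> $ c \<and> \<xi> $ c \<le> 1)"
  by (simp add: mem_box_cart)

lemma borel_slab [measurable]: "{\<xi>::real^2. \<alpha> \<le> s * \<xi> $ c + u \<and> s * \<xi> $ c + u \<le> \<beta>} \<in> sets borel"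
proof -
  have "closed {\<xi>::real^2. \<alpha> \<le> s * \<xi> $ c + u \<and> s * \<xi> $ c + u \<le> \<beta>}"
    by (intro closed_Collect_conj closed_Collect_le continuous_intros)
  then show ?thesis by (rule borel_closed)
qed

lemma borel_strip [measurable]: "strip c \<delta> k \<in> sets borel"
  using borel_slab[of "\<delta> * k" 1 c 0 "\<delta> * (k + 1)"] by (simp add: strip_def)

lemma finite_mesh_range [simp]: "finite (mesh_range \<delta>)"
  by (simp add: mesh_range_def)

lemma card_mesh_range:
  assumes "0 < \<delta>"
  shows "real (card (mesh_range \<delta>)) \<le> 1 / \<delta> + 2"
proof -
  have "0 \<le> \<lfloor>1 / \<delta>\<rfloor>" using assms by simp
  then have "real (card (mesh_range \<delta>)) = of_int \<lfloor>1 / \<delta>\<rfloor> + 2"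
    by (simp add: mesh_range_def)
  then show ?thesis using of_int_floor_le[of "1 / \<delta>"] by linarith
qed

lemma mem_mesh_range:
  assumes "0 < \<delta>" "0 \<le> x" "x \<le> 1" "\<delta> * real_of_int k \<le> x" "x \<le> \<delta> * (real_of_int k + 1)"
  shows "k \<in> mesh_range \<delta>"
proof -
  have "0 \<le> \<delta> * (real_of_int k + 1)" "\<delta> * real_of_int k \<le> 1" using assms by auto
  then have "0 \<le> real_of_int k + 1"
    using assms(1) by (simp only: zero_le_mult_iff) auto
  moreover have "real_of_int k \<le> 1 / \<delta>"
    using \<open>\<delta> * real_of_int k \<le> 1\<close> assms(1) by (simp add: field_simps)
  ultimately have "-1 \<le> k" "real_of_int k \<le> 1 / \<delta>" by linarith+
  then show ?thesis by (auto simp: mesh_range_def le_floor_iff)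
qed

lemma mesh_covers:
  assumes "0 < \<delta>"
  obtains k where "\<delta> * real_of_int k \<le> x" "x \<le> \<delta> * (real_of_int k + 1)"
proof -
  have "\<delta> * of_int \<lfloor>x / \<delta>\<rfloor> \<le> x" "x \<le> \<delta> * (of_int \<lfloor>x / \<delta>\<rfloor> + 1)"
    using floor_divide_lower[OF assms, of x] floor_divide_upper[OF assms, of x]
    by (simp_all add: mult.commute less_imp_le)
  then show ?thesis by (rule that)
qed

lemma mesh_range_covers:
  assumes "0 < \<delta>" "0 \<le> x" "x \<le> 1"
  obtains k where "k \<in> mesh_range \<delta>" "\<delta> * real_of_int k \<le> x" "x \<le> \<delta> * (real_of_int k + 1)"
  using mesh_covers[OF assms(1), of x] mem_mesh_range[OF assms] by metis

lemma strips_cover: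
  assumes "0 < \<delta>" "\<xi> \<in> cbox 0 1"
  shows "\<exists>k\<in>mesh_range \<delta>. \<xi> \<in> strip c \<delta> k"
proof -
  have "0 \<le> \<xi> $ c" "\<xi> $ c \<le> 1" using assms(2) by (auto simp: mem_unit_square)
  then obtain k where "k \<in> mesh_range \<delta>" "\<delta> * real_of_int k \<le> \<xi> $ c" "\<xi> $ c \<le> \<delta> * (real_of_int k + 1)"
    by (rule mesh_range_covers[OF assms(1)])
  then show ?thesis by (auto simp: mem_strip)
qed

lemma measure_inter_unit_square:
  assumes [measurable]: "E \<in> sets borel"
  shows "measure \<mu> (E \<inter> cbox 0 1) = measure \<mu> E"
proof -
  have "measure \<mu> (UNIV - cbox 0 1) = 0"
    using finite_measure_compl[of "cbox 0 1"] measure_unit_square by simp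
  moreover have "measure \<mu> (E - cbox 0 1) \<le> measure \<mu> (UNIV - cbox 0 1)"
    by (intro finite_measure_mono) auto
  ultimately have "measure \<mu> (E - cbox 0 1) = 0" using measure_nonneg[of \<mu>] by (simp add: order_antisym)
  then show ?thesis
    using finite_measure_Union[of "E \<inter> cbox 0 1" "E - cbox 0 1"] by (simp add: Int_Diff_Un Int_Diff_disjoint)
qed

lemma measure_eq_0:
  assumes "E \<in> sets borel" "E \<inter> cbox 0 1 = {}"
  shows "measure \<mu> E = 0"
  using measure_inter_unit_square[OF assms(1)] assms(2) by simp

text \<open>In the stopping decomposition of a measure, only the cylinders that reach the given set
  count; every use below selects those near some strip or square.\<close>

lemma measure_stopping_meeting:
  assumes E: "E \<in> sets borel" and W: "W \<subseteq> stopping P n []"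
    and miss: "\<And>w. w \<in> stopping P n [] - W \<Longrightarrow> wmap w -` E \<inter> cbox 0 1 = {}"
  shows "measure \<mu> E = (\<Sum>w\<in>W. weight w * measure \<mu> (wmap w -` E))"
  unfolding measure_stopping[OF E, of P n]
proof (rule sum.mono_neutral_right[OF finite_stopping W])
  show "\<forall>w\<in>stopping P n [] - W. weight w * measure \<mu> (wmap w -` E) = 0"
    using measure_eq_0[OF wmap_vimage_borel[OF E] miss] by simp
qed

lemma wmap_unit_square:
  "set w \<subseteq> letters \<Longrightarrow> \<xi> \<in> cbox 0 1 \<Longrightarrow> wmap w \<xi> \<in> cbox 0 1"
proof (induction w arbitrary: \<xi>)
  case (Cons i w)
  have "\<psi> i \<xi> \<in> cbox 0 1"
    using Cons.prems psi_unit_interval[of i] by (auto simp: mem_unit_square psi_component)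
  then show ?case using Cons by simp
qed simp

lemma sum_measure_covered_le:
  fixes E :: "'i \<Rightarrow> (real^2) set" and F :: "'j \<Rightarrow> (real^2) set"
  assumes fin: "finite A" "finite B"
    and [measurable]: "\<And>x. E x \<in> sets borel" "\<And>y. F y \<in> sets borel"
    and cover: "\<And>x \<xi>. x \<in> A \<Longrightarrow> \<xi> \<in> E x \<Longrightarrow> \<xi> \<in> cbox 0 1 \<Longrightarrow> \<exists>y\<in>B. \<xi> \<in> F y"
    and m1: "\<And>x. x \<in> A \<Longrightarrow> real (card {y \<in> B. E x \<inter> F y \<inter> cbox 0 1 \<noteq> {}}) \<le> m"
    and m2: "\<And>y. y \<in> B \<Longrightarrow> real (card {x \<in> A. E x \<inter> F y \<inter> cbox 0 1 \<noteq> {}}) \<le> m"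
  shows "(\<Sum>x\<in>A. measure \<mu> (E x) powr q) \<le> m powr q * m * (\<Sum>y\<in>B. measure \<mu> (F y) powr q)"
proof (rule sum_powr_covered_le[OF fin q_nonneg _ _ _ m1 m2])
  fix x assume x: "x \<in> A"
  let ?Y = "{y \<in> B. E x \<inter> F y \<inter> cbox 0 1 \<noteq> {}}"
  have "measure \<mu> (E x) = measure \<mu> (E x \<inter> cbox 0 1)"
    by (simp add: measure_inter_unit_square)
  also have "\<dots> \<le> measure \<mu> (\<Union>y\<in>?Y. F y)"
  proof (intro finite_measure_mono subsetI)
    fix \<xi> assume \<xi>: "\<xi> \<in> E x \<inter> cbox 0 1"
    then obtain y where "y \<in> B" "\<xi> \<in> F y" using cover[OF x] by blast
    then show "\<xi> \<in> (\<Union>y\<in>?Y. F y)" using \<xi> by blast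
  qed (use fin in auto)
  also have "\<dots> \<le> (\<Sum>y\<in>?Y. measure \<mu> (F y))"
    using fin by (intro finite_measure_subadditive_finite) auto
  finally show "measure \<mu> (E x) \<le> (\<Sum>y\<in>?Y. measure \<mu> (F y))" .
qed auto

lemma card_le_mesh_meeting:
  assumes "0 < \<rho>" "0 \<le> L" "\<And>x y. x \<in> X \<Longrightarrow> y \<in> X \<Longrightarrow> \<bar>x - y\<bar> \<le> L"
    and "\<And>k. k \<in> A \<Longrightarrow> \<exists>x\<in>X. \<rho> * real_of_int k \<le> x \<and> x \<le> \<rho> * (real_of_int k + 1)"
    and "2 * L / \<rho> + 2 \<le> m"
  shows "real (card A) \<le> m"
proof -
  have "card A \<le> card {k::int. \<exists>x\<in>X. \<rho> * k \<le> x \<and> x \<le> \<rho> * (k + 1)}"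
    using card_mesh_meeting(1)[of \<rho> L X, OF assms(1-3)] assms(4) by (intro card_mono) auto
  then show ?thesis
    using card_mesh_meeting(2)[of \<rho> L X, OF assms(1-3)] assms(5) by linarith
qed

text \<open>Under an affine map of slope \<open>s\<close>, the mesh of size \<open>\<delta>\<close> pulls back to intervals of length
  \<open>\<delta> / \<bar>s\<bar>\<close>, whatever the orientation; these and the mesh of size \<open>\<rho>\<close> meet boundedly
  often as soon as the two lengths are comparable.\<close>

lemma affine_preimage_strip_meets:
  fixes G :: "int \<Rightarrow> (real^2) set"
  assumes d: "0 < \<delta>" "0 < \<rho>" and K: "\<bar>s\<bar> * \<rho> \<le> K * \<delta>" "\<delta> \<le> K * (\<bar>s\<bar> * \<rho>)" "0 < K"
    and G: "\<And>k. G k = {\<xi>. \<delta> * k \<le> s * \<xi> $ c + u \<and> s * \<xi> $ c + u \<le> \<delta> * (k + 1)}"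
  shows "real (card {j \<in> B. G k \<inter> strip c \<rho> j \<inter> S \<noteq> {}}) \<le> 2 * K + 2"
    and "real (card {k \<in> A. G k \<inter> strip c \<rho> j \<inter> S \<noteq> {}}) \<le> 2 * K + 2"
proof -
  have s: "s \<noteq> 0" using d K by auto
  show "real (card {j \<in> B. G k \<inter> strip c \<rho> j \<inter> S \<noteq> {}}) \<le> 2 * K + 2"
  proof (rule card_le_mesh_meeting[OF d(2)])
    let ?X = "{x. \<delta> * k \<le> s * x + u \<and> s * x + u \<le> \<delta> * (k + 1)}"
    show "0 \<le> \<delta> / \<bar>s\<bar>" using d by simp
    show "\<bar>x - y\<bar> \<le> \<delta> / \<bar>s\<bar>" if "x \<in> ?X" "y \<in> ?X" for x y
    proof -
      have "\<bar>s * x - s * y\<bar> \<le> \<delta>" using that by (simp add: abs_le_iff algebra_simps)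
      then have "\<bar>x - y\<bar> * \<bar>s\<bar> \<le> \<delta>" by (metis abs_mult mult.commute right_diff_distrib)
      then show ?thesis using s by (simp add: pos_le_divide_eq)
    qed
    show "\<exists>x\<in>?X. \<rho> * real_of_int j \<le> x \<and> x \<le> \<rho> * (real_of_int j + 1)"
      if "j \<in> {j \<in> B. G k \<inter> strip c \<rho> j \<inter> S \<noteq> {}}" for j
      using that by (auto simp: G mem_strip)
    have "2 * (\<delta> / \<bar>s\<bar>) / \<rho> = 2 * (\<delta> / (\<bar>s\<bar> * \<rho>))" by simp
    also have "\<dots> \<le> 2 * K" using K s d by (simp add: pos_divide_le_eq)
    finally show "2 * (\<delta> / \<bar>s\<bar>) / \<rho> + 2 \<le> 2 * K + 2" by simp
  qed
  show "real (card {k \<in> A. G k \<inter> strip c \<rho> j \<inter> S \<noteq> {}}) \<le> 2 * K + 2"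
  proof (rule card_le_mesh_meeting[OF d(1)])
    let ?Y = "(\<lambda>x. s * x + u) ` {x. \<rho> * j \<le> x \<and> x \<le> \<rho> * (j + 1)}"
    show "0 \<le> \<bar>s\<bar> * \<rho>" using d by simp
    show "\<bar>x - y\<bar> \<le> \<bar>s\<bar> * \<rho>" if xy: "x \<in> ?Y" "y \<in> ?Y" for x y
    proof -
      obtain x' y' where x': "x = s * x' + u" "\<rho> * j \<le> x'" "x' \<le> \<rho> * (j + 1)"
        and y': "y = s * y' + u" "\<rho> * j \<le> y'" "y' \<le> \<rho> * (j + 1)"
        using xy by auto
      have "\<bar>x' - y'\<bar> \<le> \<rho>" using x' y' by (simp add: abs_le_iff algebra_simps)
      moreover have "\<bar>x - y\<bar> = \<bar>s\<bar> * \<bar>x' - y'\<bar>" using x' y' by (simp add: abs_mult[symmetric] algebra_simps)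
      ultimately show ?thesis by (simp add: mult_left_mono)
    qed
    show "\<exists>x\<in>?Y. \<delta> * real_of_int k \<le> x \<and> x \<le> \<delta> * (real_of_int k + 1)"
      if "k \<in> {k \<in> A. G k \<inter> strip c \<rho> j \<inter> S \<noteq> {}}" for k
      using that by (auto simp: G mem_strip)
    show "2 * (\<bar>s\<bar> * \<rho>) / \<delta> + 2 \<le> 2 * K + 2" using K d by (simp add: pos_divide_le_eq)
  qed
qed

lemma affine_strip_sum:
  fixes G :: "int \<Rightarrow> (real^2) set"
  assumes d: "0 < \<delta>" "0 < \<rho>" and K: "\<bar>s\<bar> * \<rho> \<le> K * \<delta>" "\<delta> \<le> K * (\<bar>s\<bar> * \<rho>)" "0 < K"
    and G: "\<And>k. G k = {\<xi>. \<delta> * k \<le> s * \<xi> $ c + u \<and> s * \<xi> $ c + u \<le> \<delta> * (k + 1)}"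
    and A: "finite A"
  shows "(\<Sum>k\<in>A. measure \<mu> (G k) powr q) \<le> (2 * K + 2) powr q * (2 * K + 2) * strip_sum c \<rho>"
    and "(\<And>k \<xi>. \<xi> \<in> G k \<Longrightarrow> \<xi> \<in> cbox 0 1 \<Longrightarrow> k \<in> A) \<Longrightarrow>
      strip_sum c \<rho> \<le> (2 * K + 2) powr q * (2 * K + 2) * (\<Sum>k\<in>A. measure \<mu> (G k) powr q)"
proof -
  have [measurable]: "G k \<in> sets borel" for k unfolding G by measurable
  note meets = affine_preimage_strip_meets[OF d K G]
  show "(\<Sum>k\<in>A. measure \<mu> (G k) powr q) \<le> (2 * K + 2) powr q * (2 * K + 2) * strip_sum c \<rho>"
    unfolding strip_sum_def
  proof (rule sum_measure_covered_le)
    fix k \<xi> assume "\<xi> \<in> cbox (0::real^2) 1"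
    then show "\<exists>j\<in>mesh_range \<rho>. \<xi> \<in> strip c \<rho> j" by (rule strips_cover[OF d(2)])
  qed (use A meets in auto)
  show "strip_sum c \<rho> \<le> (2 * K + 2) powr q * (2 * K + 2) * (\<Sum>k\<in>A. measure \<mu> (G k) powr q)"
    if all: "\<And>k \<xi>. \<xi> \<in> G k \<Longrightarrow> \<xi> \<in> cbox 0 1 \<Longrightarrow> k \<in> A"
    unfolding strip_sum_def
  proof (rule sum_measure_covered_le)
    fix j \<xi> assume \<xi>: "\<xi> \<in> cbox (0::real^2) 1"
    obtain k where "\<delta> * real_of_int k \<le> s * \<xi> $ c + u" "s * \<xi> $ c + u \<le> \<delta> * (real_of_int k + 1)"
      using mesh_covers[OF d(1)] by metis
    then have "\<xi> \<in> G k" by (simp add: G)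
    then show "\<exists>k\<in>A. \<xi> \<in> G k" using all \<xi> by blast
  qed (use A meets in \<open>auto simp: Int_commute\<close>)
qed

text \<open>A size \<open>g\<close> that shrinks at least geometrically along words, but by a bounded factor in each
  step, is within that factor of \<open>r\<close> on the cut at level \<open>r\<close>; the cut uses words of length
  \<open>O(log (1 / r))\<close>, so the cut-off in \<open>stopping\<close> is never reached prematurely.\<close>

lemma stopping_size:
  fixes g :: "nat list \<Rightarrow> real"
  assumes r: "0 < r" "r < 1"
    and g: "g [] = 1"
      "\<And>w i. set w \<subseteq> letters \<Longrightarrow> i \<in> letters \<Longrightarrow> lo * g w \<le> g (i # w)"
      "\<And>w. set w \<subseteq> letters \<Longrightarrow> g w \<le> hi ^ length w"
    and w: "w \<in> stopping (\<lambda>w. g w \<le> r) (nat \<lceil>ln r / ln hi\<rceil>) []"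
  shows "set w \<subseteq> letters" "g w \<le> r" "lo * r \<le> g w" "real (length w) \<le> ln r / ln hi + 1"
proof -
  let ?n = "nat \<lceil>ln r / ln hi\<rceil>"
  have n0: "0 \<le> ln r / ln hi" using r lo_hi(1-4) by (simp add: divide_nonpos_neg)
  have n: "ln r / ln hi \<le> real ?n" "real ?n \<le> ln r / ln hi + 1"
    using n0 by linarith+
  have hin: "hi ^ ?n \<le> r"
  proof -
    have "real ?n * ln hi \<le> ln r" using n(1) r lo_hi(1-4) by (simp add: neg_divide_le_eq)
    then have "ln (hi ^ ?n) \<le> ln r" using r lo_hi(1-4) by (simp add: ln_realpow)
    then show ?thesis using r lo_hi(1-4) by (subst (asm) ln_le_cancel_iff) auto
  qed
  show "set w \<subseteq> letters" using stopping_letters[OF w] by simp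
  show "real (length w) \<le> ln r / ln hi + 1" using stopping_letters[OF w] n by linarith
  show "g w \<le> r"
  proof (rule stopping_stops[OF _ w])
    fix u assume u: "set u \<subseteq> letters" "?n \<le> length u"
    have "hi ^ length u \<le> hi ^ ?n" using u lo_hi(1-4) by (intro power_decreasing) auto
    then show "g u \<le> r" using g(3)[OF u(1)] hin by linarith
  qed
  show "lo * r \<le> g w"
  proof (rule stopping_invariant[OF _ _ w])
    have "lo * r \<le> 1 * 1" using r lo_hi(1-4) by (intro mult_mono) auto
    then show "lo * r \<le> g []" using g(1) by simp
    fix u i assume u: "set u \<subseteq> letters" "i \<in> letters" "\<not> g u \<le> r"
    have "lo * r \<le> lo * g u" using r lo_hi(1-4) u by (intro mult_left_mono) auto
    then show "lo * r \<le> g (i # u)" using g(2)[OF u(1,2)] by linarith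
  qed
qed

lemma scale_le_power:
  assumes "set w \<subseteq> letters"
  shows "scale c w \<le> hi ^ length w"
  using assms
proof (induction w)
  case (Cons i w)
  have hi: "0 \<le> hi" using lo_hi(3) by simp
  have "\<bar>T i $ c $ c\<bar> * scale c w \<le> hi * hi ^ length w"
    using Cons le_hi[of i c] scale_pos[of w c] hi by (intro mult_mono) auto
  then show ?case by (simp add: scale_Cons)
qed (simp add: scale_Nil)

lemma strip_sum_bounds:
  assumes "0 < \<delta>"
  shows "(1 / \<delta> + 2) powr (- q) \<le> strip_sum c \<delta>" "strip_sum c \<delta> \<le> 1 / \<delta> + 2"
proof -
  have "measure \<mu> UNIV \<le> measure \<mu> (cbox 0 1)" by (simp add: measure_unit_square)
  also have "\<dots> \<le> measure \<mu> (\<Union>k\<in>mesh_range \<delta>. strip c \<delta> k)"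
  proof (intro finite_measure_mono subsetI)
    fix \<xi> :: "real^2" assume "\<xi> \<in> cbox 0 1"
    then show "\<xi> \<in> (\<Union>k\<in>mesh_range \<delta>. strip c \<delta> k)" using strips_cover[OF assms] by blast
  qed auto
  also have "\<dots> \<le> (\<Sum>k\<in>mesh_range \<delta>. measure \<mu> (strip c \<delta> k))"
    by (intro finite_measure_subadditive_finite) auto
  finally have "1 \<le> (\<Sum>k\<in>mesh_range \<delta>. measure \<mu> (strip c \<delta> k))" by simp
  then have "1 powr q \<le> (\<Sum>k\<in>mesh_range \<delta>. measure \<mu> (strip c \<delta> k)) powr q"
    using q_nonneg by (intro powr_mono2) auto
  also have "\<dots> \<le> (1 / \<delta> + 2) powr q * strip_sum c \<delta>"
    unfolding strip_sum_def using q_nonneg card_mesh_range[OF assms] by (intro powr_sum_le) auto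
  finally show "(1 / \<delta> + 2) powr (- q) \<le> strip_sum c \<delta>"
    using assms by (simp add: powr_minus field_simps add_pos_pos)
  have "strip_sum c \<delta> \<le> real (card (mesh_range \<delta>)) * 1"
    unfolding strip_sum_def
  proof (intro sum_bounded_above)
    fix k
    show "measure \<mu> (strip c \<delta> k) powr q \<le> 1"
      using powr_mono2[OF q_nonneg measure_nonneg measure_le_1, of "strip c \<delta> k"] by simp
  qed
  then show "strip_sum c \<delta> \<le> 1 / \<delta> + 2" using card_mesh_range[OF assms] by simp
qed

lemma strip_sum_pos: "0 < \<delta> \<Longrightarrow> 0 < strip_sum c \<delta>"
  using strip_sum_bounds(1)[of \<delta> c] powr_gt_zero[of "1 / \<delta> + 2" "- q"]
  by (smt (verit) divide_pos_pos)

end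

section \<open>Existence of the spectra of the projections\<close>

context diagonal_self_affine
begin

definition coarse_words :: "2 \<Rightarrow> real \<Rightarrow> nat list set" where
  "coarse_words c r = stopping (\<lambda>w. scale c w \<le> r) (nat \<lceil>ln r / ln hi\<rceil>) []"

definition coarse_const :: real where
  "coarse_const = (2 / lo + 2) powr q * (2 / lo + 2)"

lemma coarse_const_pos: "0 < coarse_const"
proof -
  have "0 < 2 / lo + 2" using lo_hi(1) by (intro add_pos_pos) auto
  then show ?thesis unfolding coarse_const_def by (intro mult_pos_pos) auto
qed

lemma finite_coarse_words: "finite (coarse_words c r)"
  by (simp add: coarse_words_def finite_stopping)

lemma coarse_words:
  assumes r: "0 < r" "r < 1" and w: "w \<in> coarse_words c r"
  shows "set w \<subseteq> letters" "scale c w \<le> r" "lo * r \<le> scale c w"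
proof -
  have "lo * scale c u \<le> scale c (i # u)" if "set u \<subseteq> letters" "i \<in> letters" for u i
    using lo_le[OF that(2), of c] scale_pos[OF that(1), of c] by (simp add: scale_Cons)
  then show "set w \<subseteq> letters" "scale c w \<le> r" "lo * r \<le> scale c w"
    using stopping_size[of r "scale c" w, OF r scale_Nil _ scale_le_power] w
    unfolding coarse_words_def by blast+
qed

lemma coarse_words_diameter:
  assumes r: "0 < r" "r < 1" and w: "w \<in> coarse_words c r"
    and \<xi>: "\<xi> \<in> cbox 0 1" "\<eta> \<in> cbox 0 1"
  shows "\<bar>wmap w \<xi> $ c - wmap w \<eta> $ c\<bar> \<le> r"
proof -
  have "0 \<le> \<xi> $ c" "\<xi> $ c \<le> 1" "0 \<le> \<eta> $ c" "\<eta> $ c \<le> 1"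
    using \<xi> by (auto simp: mem_unit_square)
  then have "\<bar>\<xi> $ c - \<eta> $ c\<bar> \<le> 1" by linarith
  then have "scale c w * \<bar>\<xi> $ c - \<eta> $ c\<bar> \<le> r * 1"
    using coarse_words(2)[OF r w] r by (intro mult_mono) auto
  then show ?thesis by (simp add: wmap_component_dist[OF coarse_words(1)[OF r w]])
qed

text \<open>Pulled back along a cylinder of width about \<open>r\<close>, the mesh of size \<open>r \<delta>\<close> becomes a
  mesh of size comparable to \<open>\<delta>\<close>.\<close>

lemma coarse_cylinder_sum:
  assumes r: "0 < r" "r < 1" and d: "0 < \<delta>" and w: "w \<in> coarse_words c r" and A: "finite A"
  defines "S \<equiv> (\<Sum>k\<in>A. measure \<mu> (wmap w -` strip c (r * \<delta>) k) powr q)"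
  shows "S \<le> coarse_const * strip_sum c \<delta>"
    and "(\<And>k \<xi>. wmap w \<xi> \<in> strip c (r * \<delta>) k \<Longrightarrow> \<xi> \<in> cbox 0 1 \<Longrightarrow> k \<in> A) \<Longrightarrow>
      strip_sum c \<delta> \<le> coarse_const * S"
proof -
  note W = coarse_words[OF r w]
  define K where "K = 1 / lo"
  have K: "1 \<le> K" "0 < K" "K * lo = 1" using lo_hi(1,2) by (simp_all add: K_def)
  have rd: "0 < r * \<delta>" using r d by simp
  have const: "coarse_const = (2 * K + 2) powr q * (2 * K + 2)"
    by (simp add: coarse_const_def K_def)
  obtain s u where su: "\<bar>s\<bar> = scale c w" "\<And>\<xi>. wmap w \<xi> $ c = s * \<xi> $ c + u"
    by (rule wmap_component[OF W(1), of c]) auto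
  have "\<bar>s\<bar> * \<delta> \<le> r * \<delta>" using W(2) su d by (intro mult_right_mono) auto
  also have "\<dots> \<le> K * (r * \<delta>)" using K rd mult_right_mono[of 1 K "r * \<delta>"] by simp
  finally have k1: "\<bar>s\<bar> * \<delta> \<le> K * (r * \<delta>)" .
  have "r * \<delta> = K * (lo * r * \<delta>)" using K(3) by (simp add: mult.assoc[symmetric])
  also have "\<dots> \<le> K * (\<bar>s\<bar> * \<delta>)"
    using K d W(3) su by (intro mult_left_mono mult_right_mono) auto
  finally have k2: "r * \<delta> \<le> K * (\<bar>s\<bar> * \<delta>)" .
  have G: "wmap w -` strip c (r * \<delta>) k = {\<xi>. r * \<delta> * real_of_int k \<le> s * \<xi> $ c + u
      \<and> s * \<xi> $ c + u \<le> r * \<delta> * (real_of_int k + 1)}" for k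
    by (auto simp: strip_def su)
  show "S \<le> coarse_const * strip_sum c \<delta>"
    unfolding S_def const by (rule affine_strip_sum(1)[OF rd d k1 k2 K(2) G A])
  show "strip_sum c \<delta> \<le> coarse_const * S"
    if "\<And>k \<xi>. wmap w \<xi> \<in> strip c (r * \<delta>) k \<Longrightarrow> \<xi> \<in> cbox 0 1 \<Longrightarrow> k \<in> A"
    unfolding S_def const by (rule affine_strip_sum(2)[OF rd d k1 k2 K(2) G A]) (use that in auto)
qed

text \<open>Group the fine strips by the coarse strips that they meet. Inside one coarse strip the
  fine masses are averages, over the cylinders near that strip, of rescaled masses; convexity of
  \<open>t \<mapsto> t\<^sup>q\<close> bounds the \<open>q\<close>-th powers of the averages, and the total weight of those
  cylinders is at most the mass of a slightly wider strip.\<close>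

lemma strip_sum_submultiplicative:
  assumes "1 \<le> q"
  obtains C where "0 < C"
    "\<And>r \<delta>. 0 < r \<Longrightarrow> r < 1 \<Longrightarrow> 0 < \<delta> \<Longrightarrow> \<delta> < 1 \<Longrightarrow>
      strip_sum c (r * \<delta>) \<le> C * (strip_sum c r * strip_sum c \<delta>)"
proof -
  \<comment> \<open>An interval of \<open>n\<close> mesh lengths meets at most \<open>2 n + 2\<close> mesh intervals; below
    \<open>n\<close> is at most \<open>6\<close>.\<close>
  define C1 C2 :: real where "C1 = coarse_const" and "C2 = 14 powr q * 14"
  have C1: "0 < C1" and C2: "0 < C2" using coarse_const_pos by (simp_all add: C1_def C2_def)
  show ?thesis
  proof (rule that[of "C1 * C2"])
    show "0 < C1 * C2" using C1 C2 by simp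
    fix r \<delta> :: real assume r: "0 < r" "r < 1" and d: "0 < \<delta>" "\<delta> < 1"
    have rd: "0 < r * \<delta>" "r * \<delta> \<le> r" using r d by (auto simp: mult_le_cancel_left1)
    let ?I = "coarse_words c r"
    note I = coarse_words[OF r, of _ c]
    define S m where "S = strip c (r * \<delta>)" and "m w k = measure \<mu> (wmap w -` S k)" for w k
    have [measurable]: "S k \<in> sets borel" for k by (simp add: S_def)
    define W where "W j = {w \<in> ?I. \<exists>\<xi>\<in>cbox 0 1. r * (real_of_int j - 1) \<le> wmap w \<xi> $ c
        \<and> wmap w \<xi> $ c \<le> r * (real_of_int j + 2)}" for j :: int
    define KK where "KK j = {k \<in> mesh_range (r * \<delta>). strip c r j \<inter> S k \<noteq> {}}" for j
    define P where "P j = sum weight (W j)" for j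
    \<comment> \<open>\<open>B j\<close> leaves room for a whole cylinder, of width at most \<open>r\<close>, around each point of
      the range allowed in \<open>W j\<close>.\<close>
    define B where "B j = {\<xi>::real^2. r * (real_of_int j - 2) \<le> 1 * \<xi> $ c + 0
        \<and> 1 * \<xi> $ c + 0 \<le> r * (real_of_int j + 3)}" for j :: int
    have [measurable]: "B j \<in> sets borel" for j unfolding B_def by measurable
    have W: "W j \<subseteq> ?I" for j by (auto simp: W_def)
    have finW: "finite (W j)" for j using finite_subset[OF W finite_coarse_words] .
    have finKK: "finite (KK j)" for j by (simp add: KK_def)
    have wpos: "0 \<le> weight w" if "w \<in> ?I" for w
      using I(1)[OF that] weight_pos by (simp add: less_imp_le)
    have Wpos: "0 \<le> weight w" if "w \<in> W j" for w j using that wpos W by blast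
    have P0: "0 \<le> P j" for j unfolding P_def using Wpos by (intro sum_nonneg)
    have fine: "measure \<mu> (S k) = (\<Sum>w\<in>W j. weight w * m w k)" if k: "k \<in> KK j" for k j
      unfolding m_def
    proof (rule measure_stopping_meeting[OF _ W[unfolded coarse_words_def]])
      obtain \<eta> where \<eta>: "\<eta> \<in> strip c r j" "\<eta> \<in> S k" using k by (auto simp: KK_def)
      fix w assume w: "w \<in> stopping (\<lambda>w. scale c w \<le> r) (nat \<lceil>ln r / ln hi\<rceil>) [] - W j"
      have "r * (real_of_int j - 1) \<le> wmap w \<xi> $ c" "wmap w \<xi> $ c \<le> r * (real_of_int j + 2)"
        if "wmap w \<xi> \<in> S k" for \<xi>
        using that \<eta> rd(2) by (auto simp: S_def mem_strip algebra_simps)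
      then show "wmap w -` S k \<inter> cbox 0 1 = {}" using w by (auto simp: W_def coarse_words_def)
    qed simp
    have block: "(\<Sum>k\<in>KK j. measure \<mu> (S k) powr q) \<le> C1 * strip_sum c \<delta> * P j powr q" for j
    proof -
      have "(\<Sum>k\<in>KK j. measure \<mu> (S k) powr q)
          \<le> (\<Sum>k\<in>KK j. P j powr (q - 1) * (\<Sum>w\<in>W j. weight w * m w k powr q))"
        unfolding P_def using fine finW Wpos assms
        by (intro sum_mono) (auto simp: m_def intro!: powr_sum_le_weighted)
      also have "\<dots> = P j powr (q - 1) * (\<Sum>w\<in>W j. weight w * (\<Sum>k\<in>KK j. m w k powr q))"
        unfolding sum_distrib_left[symmetric] by (subst sum.swap) (simp add: sum_distrib_left)
      also have "\<dots> \<le> P j powr (q - 1) * (\<Sum>w\<in>W j. weight w * (C1 * strip_sum c \<delta>))"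
        using coarse_cylinder_sum(1)[OF r d(1) subsetD[OF W] finKK] Wpos
        by (intro mult_left_mono sum_mono) (auto simp: m_def S_def C1_def)
      also have "\<dots> = C1 * strip_sum c \<delta> * (P j powr (q - 1) * P j)"
        by (simp add: P_def sum_distrib_right[symmetric])
      also have "P j powr (q - 1) * P j = P j powr q"
        using P0[of j] by (cases "P j = 0") (auto simp: powr_diff)
      finally show ?thesis .
    qed
    have PB: "P j \<le> measure \<mu> (B j)" for j
    proof -
      have "P j = (\<Sum>w\<in>W j. weight w * measure \<mu> (wmap w -` B j))"
        unfolding P_def
      proof (rule sum.cong)
        fix w assume w: "w \<in> W j"
        obtain \<eta> where \<eta>: "\<eta> \<in> cbox 0 1" "r * (real_of_int j - 1) \<le> wmap w \<eta> $ c"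
          "wmap w \<eta> $ c \<le> r * (real_of_int j + 2)"
          using w by (auto simp: W_def)
        have "\<xi> \<in> wmap w -` B j" if "\<xi> \<in> cbox 0 1" for \<xi>
          using coarse_words_diameter[OF r subsetD[OF W w] that \<eta>(1)] \<eta>(2,3)
          by (simp add: B_def abs_le_iff algebra_simps)
        then have "measure \<mu> (cbox 0 1) \<le> measure \<mu> (wmap w -` B j)"
          by (intro finite_measure_mono) auto
        then have "measure \<mu> (wmap w -` B j) = 1"
          using measure_unit_square measure_le_1[of "wmap w -` B j"] by simp
        then show "weight w = weight w * measure \<mu> (wmap w -` B j)" by simp
      qed simp
      also have "\<dots> \<le> (\<Sum>w\<in>?I. weight w * measure \<mu> (wmap w -` B j))"
        using finite_coarse_words wpos W by (intro sum_mono2) auto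
      also have "\<dots> = measure \<mu> (B j)"
        unfolding coarse_words_def by (rule measure_stopping[symmetric]) simp
      finally show ?thesis .
    qed
    have Bsum: "(\<Sum>j\<in>mesh_range r. measure \<mu> (B j) powr q) \<le> C2 * strip_sum c r"
      unfolding C2_def strip_sum_def
    proof (rule sum_measure_covered_le)
      fix j \<xi> assume "\<xi> \<in> cbox (0::real^2) 1"
      then show "\<exists>i\<in>mesh_range r. \<xi> \<in> strip c r i" by (rule strips_cover[OF r(1)])
    next
      fix j
      show "real (card {i \<in> mesh_range r. B j \<inter> strip c r i \<inter> cbox 0 1 \<noteq> {}}) \<le> 14"
        by (rule card_le_mesh_meeting[of r "5 * r" "{r * (real_of_int j - 2)..r * (real_of_int j + 3)}"])
          (use r in \<open>auto simp: B_def mem_strip abs_le_iff algebra_simps\<close>)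
    next
      fix i
      let ?X = "{r * (real_of_int i - 3)..r * (real_of_int i + 3)}"
      show "real (card {j \<in> mesh_range r. B j \<inter> strip c r i \<inter> cbox 0 1 \<noteq> {}}) \<le> 14"
      proof (rule card_le_mesh_meeting[of r "6 * r" ?X])
        fix j assume "j \<in> {j \<in> mesh_range r. B j \<inter> strip c r i \<inter> cbox 0 1 \<noteq> {}}"
        then have "r * real_of_int j \<in> ?X"
          using r by (auto simp: B_def mem_strip algebra_simps)
        then show "\<exists>x\<in>?X. r * real_of_int j \<le> x \<and> x \<le> r * (real_of_int j + 1)"
          using r by (intro bexI[of _ "r * real_of_int j"]) auto
      qed (use r in \<open>auto simp: abs_le_iff algebra_simps\<close>)
    qed auto
    let ?g = "\<lambda>k j. if k \<in> KK j then measure \<mu> (S k) powr q else 0"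
    have "strip_sum c (r * \<delta>) \<le> (\<Sum>k\<in>mesh_range (r * \<delta>). \<Sum>j\<in>mesh_range r. ?g k j)"
      unfolding strip_sum_def S_def[symmetric]
    proof (rule sum_mono)
      fix k assume k: "k \<in> mesh_range (r * \<delta>)"
      show "measure \<mu> (S k) powr q \<le> (\<Sum>j\<in>mesh_range r. ?g k j)"
      proof (cases "S k \<inter> cbox 0 1 = {}")
        case True
        then show ?thesis by (simp add: measure_eq_0 sum_nonneg)
      next
        case False
        then obtain \<xi> where \<xi>: "\<xi> \<in> S k" "\<xi> \<in> cbox 0 1" by auto
        obtain j where j: "j \<in> mesh_range r" "\<xi> \<in> strip c r j"
          using strips_cover[OF r(1) \<xi>(2)] by blast
        have "measure \<mu> (S k) powr q = ?g k j" using j \<xi> k by (auto simp: KK_def)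
        also have "\<dots> \<le> (\<Sum>j\<in>mesh_range r. ?g k j)"
          using j(1) by (intro member_le_sum) auto
        finally show ?thesis .
      qed
    qed
    also have "\<dots> = (\<Sum>j\<in>mesh_range r. \<Sum>k\<in>mesh_range (r * \<delta>). ?g k j)"
      by (rule sum.swap)
    also have "\<dots> = (\<Sum>j\<in>mesh_range r. \<Sum>k\<in>KK j. measure \<mu> (S k) powr q)"
      by (intro sum.cong refl sum.mono_neutral_cong_right) (auto simp: KK_def)
    also have "\<dots> \<le> (\<Sum>j\<in>mesh_range r. C1 * strip_sum c \<delta> * measure \<mu> (B j) powr q)"
    proof (rule sum_mono)
      fix j
      have "C1 * strip_sum c \<delta> * P j powr q \<le> C1 * strip_sum c \<delta> * measure \<mu> (B j) powr q"
        using C1 strip_sum_pos[OF d(1), of c] P0 PB q_nonneg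
        by (intro mult_left_mono powr_mono2) auto
      then show "(\<Sum>k\<in>KK j. measure \<mu> (S k) powr q) \<le> C1 * strip_sum c \<delta> * measure \<mu> (B j) powr q"
        using block[of j] by linarith
    qed
    also have "\<dots> = C1 * strip_sum c \<delta> * (\<Sum>j\<in>mesh_range r. measure \<mu> (B j) powr q)"
      by (simp add: sum_distrib_left)
    also have "\<dots> \<le> C1 * strip_sum c \<delta> * (C2 * strip_sum c r)"
      using C1 strip_sum_pos[OF d(1), of c] Bsum by (intro mult_left_mono) auto
    finally show "strip_sum c (r * \<delta>) \<le> C1 * C2 * (strip_sum c r * strip_sum c \<delta>)"
      by (simp add: mult_ac)
  qed
qed

text \<open>For \<open>q \<le> 1\<close> the power function is concave and the inequality reverses. Now the cylinders
  are those that meet a coarse strip, so that their total weight is at least its mass, and the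
  fine strips are those near it, so that they cover these cylinders.\<close>

lemma strip_sum_supermultiplicative:
  assumes "q \<le> 1"
  obtains C where "0 < C"
    "\<And>r \<delta>. 0 < r \<Longrightarrow> r < 1 \<Longrightarrow> 0 < \<delta> \<Longrightarrow> \<delta> < 1 \<Longrightarrow>
      strip_sum c r * strip_sum c \<delta> \<le> C * strip_sum c (r * \<delta>)"
proof -
  define C1 where "C1 = coarse_const"
  have C1: "0 < C1" using coarse_const_pos by (simp add: C1_def)
  show ?thesis
    \<comment> \<open>Each fine strip lies near at most \<open>10 = 2 * 4 + 2\<close> coarse ones.\<close>
  proof (rule that[of "C1 * 10"])
    show "0 < C1 * 10" using C1 by simp
    fix r \<delta> :: real assume r: "0 < r" "r < 1" and d: "0 < \<delta>" "\<delta> < 1"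
    have rd: "0 < r * \<delta>" "r * \<delta> \<le> r" using r d by (auto simp: mult_le_cancel_left1)
    let ?I = "coarse_words c r"
    note I = coarse_words[OF r, of _ c]
    define S m where "S = strip c (r * \<delta>)" and "m w k = measure \<mu> (wmap w -` S k)" for w k
    have [measurable]: "S k \<in> sets borel" for k by (simp add: S_def)
    define W where "W j = {w \<in> ?I. \<exists>\<xi>\<in>cbox 0 1. wmap w \<xi> \<in> strip c r j}" for j
    define KK where "KK j = {k \<in> mesh_range (r * \<delta>). \<exists>x. r * (real_of_int j - 1) \<le> x
        \<and> x \<le> r * (real_of_int j + 2) \<and> r * \<delta> * k \<le> x \<and> x \<le> r * \<delta> * (k + 1)}" for j
    define P where "P j = sum weight (W j)" for j
    have W: "W j \<subseteq> ?I" for j by (auto simp: W_def)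
    have finW: "finite (W j)" for j using finite_subset[OF W finite_coarse_words] .
    have finKK: "finite (KK j)" for j by (simp add: KK_def)
    have wpos: "0 \<le> weight w" if "w \<in> ?I" for w
      using I(1)[OF that] weight_pos by (simp add: less_imp_le)
    have Wpos: "0 \<le> weight w" if "w \<in> W j" for w j using that wpos W by blast
    have P0: "0 \<le> P j" for j unfolding P_def using Wpos by (intro sum_nonneg)
    have D0: "0 < strip_sum c \<delta>" by (rule strip_sum_pos[OF d(1)])
    have SP: "measure \<mu> (strip c r j) \<le> P j" for j
    proof -
      have "measure \<mu> (strip c r j) = (\<Sum>w\<in>W j. weight w * measure \<mu> (wmap w -` strip c r j))"
        by (rule measure_stopping_meeting[OF _ W[unfolded coarse_words_def]])
          (auto simp: W_def coarse_words_def)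
      also have "\<dots> \<le> (\<Sum>w\<in>W j. weight w * 1)"
        using Wpos measure_le_1 by (intro sum_mono mult_left_mono) auto
      finally show ?thesis by (simp add: P_def)
    qed
    have piece: "strip_sum c \<delta> \<le> C1 * (\<Sum>k\<in>KK j. m w k powr q)" if w: "w \<in> W j" for w j
      unfolding m_def S_def C1_def
    proof (rule coarse_cylinder_sum(2)[OF r d(1) subsetD[OF W w] finKK])
      obtain \<eta> where \<eta>: "\<eta> \<in> cbox 0 1" "wmap w \<eta> \<in> strip c r j" using w by (auto simp: W_def)
      fix k \<xi> assume \<xi>: "wmap w \<xi> \<in> strip c (r * \<delta>) k" "\<xi> \<in> cbox 0 1"
      have "0 \<le> wmap w \<xi> $ c" "wmap w \<xi> $ c \<le> 1"
        using wmap_unit_square[OF I(1)[OF subsetD[OF W w]] \<xi>(2)] by (auto simp: mem_unit_square)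
      moreover have x: "r * \<delta> * real_of_int k \<le> wmap w \<xi> $ c"
        "wmap w \<xi> $ c \<le> r * \<delta> * (real_of_int k + 1)"
        using \<xi>(1) by (auto simp: mem_strip)
      ultimately have "k \<in> mesh_range (r * \<delta>)" by (rule mem_mesh_range[OF rd(1)])
      moreover have "r * (real_of_int j - 1) \<le> wmap w \<xi> $ c" "wmap w \<xi> $ c \<le> r * (real_of_int j + 2)"
        using coarse_words_diameter[OF r subsetD[OF W w] \<xi>(2) \<eta>(1)] \<eta>(2)
        by (auto simp: mem_strip abs_le_iff algebra_simps)
      ultimately show "k \<in> KK j" using x by (auto simp: KK_def)
    qed
    have block: "P j powr q * strip_sum c \<delta> \<le> C1 * (\<Sum>k\<in>KK j. measure \<mu> (S k) powr q)" for j
    proof -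
      have "P j powr q * strip_sum c \<delta> = P j powr (q - 1) * (P j * strip_sum c \<delta>)"
        using P0[of j] by (cases "P j = 0") (auto simp: powr_diff)
      also have "P j * strip_sum c \<delta> = (\<Sum>w\<in>W j. weight w * strip_sum c \<delta>)"
        by (simp add: P_def sum_distrib_right)
      also have "P j powr (q - 1) * \<dots>
          \<le> P j powr (q - 1) * (\<Sum>w\<in>W j. weight w * (C1 * (\<Sum>k\<in>KK j. m w k powr q)))"
        using Wpos piece by (intro mult_left_mono sum_mono) auto
      also have "\<dots> = C1 * (P j powr (q - 1) * (\<Sum>w\<in>W j. \<Sum>k\<in>KK j. weight w * m w k powr q))"
        by (simp add: sum_distrib_left mult_ac)
      also have "\<dots> = C1 * (\<Sum>k\<in>KK j. P j powr (q - 1) * (\<Sum>w\<in>W j. weight w * m w k powr q))"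
        by (subst sum.swap) (simp add: sum_distrib_left)
      also have "\<dots> \<le> C1 * (\<Sum>k\<in>KK j. measure \<mu> (S k) powr q)"
      proof (intro mult_left_mono sum_mono)
        fix k
        have "(\<Sum>w\<in>W j. weight w * m w k) \<le> (\<Sum>w\<in>?I. weight w * m w k)"
          using finite_coarse_words wpos W by (intro sum_mono2) (auto simp: m_def)
        also have "\<dots> = measure \<mu> (S k)"
          unfolding coarse_words_def m_def by (rule measure_stopping[symmetric]) simp
        finally have "(\<Sum>w\<in>W j. weight w * m w k) powr q \<le> measure \<mu> (S k) powr q"
          using q_nonneg Wpos by (intro powr_mono2 sum_nonneg mult_nonneg_nonneg) (auto simp: m_def)
        moreover have "P j powr (q - 1) * (\<Sum>w\<in>W j. weight w * m w k powr q)
            \<le> (\<Sum>w\<in>W j. weight w * m w k) powr q"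
          unfolding P_def using finW Wpos q_nonneg assms
          by (intro powr_sum_ge_weighted) (auto simp: m_def)
        ultimately show "P j powr (q - 1) * (\<Sum>w\<in>W j. weight w * m w k powr q)
            \<le> measure \<mu> (S k) powr q" by linarith
      qed (use C1 in simp)
      finally show ?thesis .
    qed
    have overlap: "real (card {j \<in> mesh_range r. k \<in> KK j}) \<le> 10" for k
    proof -
      let ?Y = "{r * \<delta> * real_of_int k - 2 * r..r * \<delta> * (real_of_int k + 1) + r}"
      show ?thesis
      proof (rule card_le_mesh_meeting[of r "4 * r" ?Y])
        fix j assume "j \<in> {j \<in> mesh_range r. k \<in> KK j}"
        then have "r * real_of_int j \<in> ?Y"
          using r by (auto simp: KK_def algebra_simps)
        then show "\<exists>x\<in>?Y. r * real_of_int j \<le> x \<and> x \<le> r * (real_of_int j + 1)"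
          using r by (intro bexI[of _ "r * real_of_int j"]) auto
      qed (use r rd in \<open>auto simp: abs_le_iff algebra_simps\<close>)
    qed
    have "strip_sum c r * strip_sum c \<delta>
        = (\<Sum>j\<in>mesh_range r. measure \<mu> (strip c r j) powr q * strip_sum c \<delta>)"
      by (simp add: strip_sum_def[of c r] sum_distrib_right)
    also have "\<dots> \<le> (\<Sum>j\<in>mesh_range r. C1 * (\<Sum>k\<in>KK j. measure \<mu> (S k) powr q))"
    proof (rule sum_mono)
      fix j
      have "measure \<mu> (strip c r j) powr q * strip_sum c \<delta> \<le> P j powr q * strip_sum c \<delta>"
        using SP[of j] q_nonneg D0 by (intro mult_right_mono powr_mono2) auto
      then show "measure \<mu> (strip c r j) powr q * strip_sum c \<delta>
          \<le> C1 * (\<Sum>k\<in>KK j. measure \<mu> (S k) powr q)" using block[of j] by linarith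
    qed
    also have "\<dots> = C1 * (\<Sum>j\<in>mesh_range r. \<Sum>k | k \<in> mesh_range (r * \<delta>) \<and> k \<in> KK j.
        measure \<mu> (S k) powr q)"
    proof -
      have "{k. k \<in> mesh_range (r * \<delta>) \<and> k \<in> KK j} = KK j" for j by (auto simp: KK_def)
      then show ?thesis by (simp add: sum_distrib_left)
    qed
    also have "\<dots> = C1 * (\<Sum>k\<in>mesh_range (r * \<delta>). \<Sum>j | j \<in> mesh_range r \<and> k \<in> KK j.
        measure \<mu> (S k) powr q)"
      by (subst sum.swap_restrict) auto
    also have "\<dots> \<le> C1 * (\<Sum>k\<in>mesh_range (r * \<delta>). 10 * measure \<mu> (S k) powr q)"
    proof (intro mult_left_mono sum_mono)
      fix k
      show "(\<Sum>j | j \<in> mesh_range r \<and> k \<in> KK j. measure \<mu> (S k) powr q)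
          \<le> 10 * measure \<mu> (S k) powr q"
        using mult_right_mono[OF overlap[of k], of "measure \<mu> (S k) powr q"] by simp
    qed (use C1 in simp)
    also have "\<dots> = C1 * 10 * strip_sum c (r * \<delta>)"
      by (simp add: strip_sum_def S_def sum_distrib_left mult_ac)
    finally show "strip_sum c r * strip_sum c \<delta> \<le> C1 * 10 * strip_sum c (r * \<delta>)" .
  qed
qed

text \<open>In the variable \<open>t = - ln \<delta>\<close> multiplicativity up to constants is additivity up to
  constants, so Fekete's argument applies to \<open>G\<close> or to \<open>- G\<close>.\<close>

theorem strip_sum_exponent_exists:
  "\<exists>\<tau>. ((\<lambda>\<delta>. ln (strip_sum c \<delta>) / (- ln \<delta>)) \<longlongrightarrow> \<tau>) (at_right 0)"
proof -
  define G where "G t = ln (strip_sum c (exp (- t)))" for t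
  have pos: "0 < strip_sum c (exp (- t))" for t by (rule strip_sum_pos) simp
  have bound: "\<bar>G t\<bar> \<le> (1 + q) * ln 3 + (1 + q) * t" if t: "0 < t" for t
  proof -
    have e: "1 / exp (- t) + 2 = exp t + 2" by (simp add: exp_minus field_simps)
    have e0: "0 < exp t + 2" by (intro add_pos_pos) auto
    have up: "ln (exp t + 2) \<le> ln 3 + t"
    proof -
      have "exp t + 2 \<le> 3 * exp t" using t by simp
      then have "ln (exp t + 2) \<le> ln (3 * exp t)" by (subst ln_le_cancel_iff) (use e0 in auto)
      then show ?thesis by (simp add: ln_mult)
    qed
    have up0: "0 \<le> ln (exp t + 2)" using t by (intro ln_ge_zero) (simp add: add_increasing)
    have "G t \<le> ln (exp t + 2)"
      unfolding G_def using strip_sum_bounds(2)[of "exp (- t)" c] pos[of t] e by (subst ln_le_cancel_iff) (use e0 in auto)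
    moreover have "- q * ln (exp t + 2) \<le> G t"
    proof -
      have "ln ((exp t + 2) powr (- q)) \<le> G t"
        unfolding G_def using strip_sum_bounds(1)[of "exp (- t)" c] pos[of t] e by (subst ln_le_cancel_iff) (use e0 in auto)
      then show ?thesis by (simp add: ln_powr)
    qed
    moreover have "q * ln (exp t + 2) \<le> q * (ln 3 + t)" using up q_nonneg by (rule mult_left_mono)
    moreover have "0 \<le> q * (ln 3 + t)" "0 \<le> ln 3 + t" using t q_nonneg by auto
    ultimately show ?thesis using up by (simp add: abs_le_iff algebra_simps)
  qed
  have "\<exists>l. ((\<lambda>t. G t / t) \<longlongrightarrow> l) at_top"
  proof (cases "1 \<le> q")
    case True
    obtain C where C: "0 < C"
      "\<And>r \<delta>. 0 < r \<Longrightarrow> r < 1 \<Longrightarrow> 0 < \<delta> \<Longrightarrow> \<delta> < 1 \<Longrightarrow> strip_sum c (r * \<delta>) \<le> C * (strip_sum c r * strip_sum c \<delta>)"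
      using strip_sum_submultiplicative[OF True, of c] by blast
    show ?thesis
    proof (rule subadditive_limit[OF _ bound])
      fix s t :: real assume "0 < s" "0 < t"
      then have "strip_sum c (exp (- (s + t))) \<le> C * (strip_sum c (exp (- s)) * strip_sum c (exp (- t)))"
        using C(2)[of "exp (- s)" "exp (- t)"] by (simp add: exp_add[symmetric])
      then have "G (s + t) \<le> ln (C * (strip_sum c (exp (- s)) * strip_sum c (exp (- t))))"
        unfolding G_def using pos[of s] pos[of t] pos[of "s + t"] C(1) by (subst ln_le_cancel_iff) auto
      also have "\<dots> = G s + G t + ln C"
        using pos[of s] pos[of t] C(1) by (simp add: G_def ln_mult)
      finally show "G (s + t) \<le> G s + G t + ln C" .
    qed
  next
    case False
    then have q1: "q \<le> 1" by simp
    obtain C where C: "0 < C"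
      "\<And>r \<delta>. 0 < r \<Longrightarrow> r < 1 \<Longrightarrow> 0 < \<delta> \<Longrightarrow> \<delta> < 1 \<Longrightarrow> strip_sum c r * strip_sum c \<delta> \<le> C * strip_sum c (r * \<delta>)"
      using strip_sum_supermultiplicative[OF q1, of c] by blast
    have "\<exists>l. ((\<lambda>t. (- G t) / t) \<longlongrightarrow> l) at_top"
    proof (rule subadditive_limit)
      fix s t :: real assume "0 < s" "0 < t"
      then have "strip_sum c (exp (- s)) * strip_sum c (exp (- t)) \<le> C * strip_sum c (exp (- (s + t)))"
        using C(2)[of "exp (- s)" "exp (- t)"] by (simp add: exp_add[symmetric])
      then have "ln (strip_sum c (exp (- s)) * strip_sum c (exp (- t))) \<le> ln (C * strip_sum c (exp (- (s + t))))"
        using pos[of s] pos[of t] pos[of "s + t"] C(1) by (subst ln_le_cancel_iff) auto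
      then show "- G (s + t) \<le> - G s + - G t + ln C"
        using pos[of s] pos[of t] pos[of "s + t"] C(1) by (simp add: G_def ln_mult)
    next
      fix t :: real assume "0 < t"
      then show "\<bar>- G t\<bar> \<le> (1 + q) * ln 3 + (1 + q) * t" using bound[of t] by simp
    qed
    then obtain l where "((\<lambda>t. (- G t) / t) \<longlongrightarrow> l) at_top" ..
    then have "((\<lambda>t. - ((- G t) / t)) \<longlongrightarrow> - l) at_top" by (rule tendsto_minus)
    then show ?thesis by auto
  qed
  then obtain l where l: "((\<lambda>t. G t / t) \<longlongrightarrow> l) at_top" ..
  have "filterlim (\<lambda>\<delta>::real. - ln \<delta>) at_top (at_right 0)"
    using ln_at_0 by (simp add: filterlim_uminus_at_top)
  then have "((\<lambda>\<delta>. G (- ln \<delta>) / (- ln \<delta>)) \<longlongrightarrow> l) (at_right 0)"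
    using filterlim_compose[OF l] by blast
  moreover have "\<forall>\<^sub>F \<delta>::real in at_right 0. G (- ln \<delta>) / (- ln \<delta>) = ln (strip_sum c \<delta>) / (- ln \<delta>)"
    by (rule eventually_at_rightI[of 0 1]) (auto simp: G_def)
  ultimately have "((\<lambda>\<delta>. ln (strip_sum c \<delta>) / (- ln \<delta>)) \<longlongrightarrow> l) (at_right 0)"
    by (rule Lim_transform_eventually)
  then show ?thesis ..
qed

end

section \<open>Mesh squares and flat cylinders\<close>

text \<open>Near any point of the closed image of the unit interval, an open subinterval of the image of
  length \<open>2 h\<close> contains a multiple of \<open>h\<close>.\<close>

lemma lattice_point_in_affine_image:
  fixes s u x h :: real
  assumes x: "0 \<le> x" "x \<le> 1" and h: "0 < h" "2 * h \<le> \<bar>s\<bar>"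
  obtains x' and m :: int where "0 < x'" "x' < 1" "s * x' + u = h * m" "\<bar>h * m - (s * x + u)\<bar> \<le> 2 * h"
proof -
  define e where "e = 2 * h / \<bar>s\<bar>"
  define \<alpha> where "\<alpha> = min x (1 - e)"
  have s0: "s \<noteq> 0" using h by auto
  have e: "0 < e" "e \<le> 1" "\<bar>s\<bar> * e = 2 * h" using h s0 by (auto simp: e_def)
  have \<alpha>: "0 \<le> \<alpha>" "\<alpha> + e \<le> 1" "\<alpha> \<le> x" "x \<le> \<alpha> + e" using x e by (auto simp: \<alpha>_def)
  define z where "z = (if 0 < s then s * \<alpha> + u else s * (\<alpha> + e) + u)"
  define m where "m = \<lfloor>z / h\<rfloor> + 1"
  have m: "z < h * m" "h * m < z + 2 * h"
    using floor_divide_lower[OF h(1), of z] floor_divide_upper[OF h(1), of z] h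
    by (auto simp: m_def algebra_simps)
  define x' where "x' = (h * m - u) / s"
  have x': "s * x' + u = h * m" using s0 by (simp add: x'_def)
  have "\<alpha> < x' \<and> x' < \<alpha> + e \<and> \<bar>h * m - (s * x + u)\<bar> \<le> 2 * h"
  proof (cases "0 < s")
    case True
    have z: "z = s * \<alpha> + u" "s * (\<alpha> + e) = s * \<alpha> + 2 * h"
      using True e(3) by (simp_all add: z_def distrib_left)
    have lt: "s * \<alpha> < s * x'" "s * x' < s * (\<alpha> + e)" using m x' z by linarith+
    have le: "s * \<alpha> \<le> s * x" "s * x \<le> s * (\<alpha> + e)"
      using \<alpha> True by (simp_all add: mult_left_mono)
    have "\<bar>h * m - (s * x + u)\<bar> \<le> 2 * h" using m z le by linarith
    moreover have "\<alpha> < x'" "x' < \<alpha> + e" using lt True by simp_all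
    ultimately show ?thesis by blast
  next
    case False
    then have neg: "s < 0" using s0 by simp
    have z: "z = s * (\<alpha> + e) + u" "s * (\<alpha> + e) = s * \<alpha> - 2 * h"
      using neg e(3) by (simp_all add: z_def distrib_left)
    have lt: "s * (\<alpha> + e) < s * x'" "s * x' < s * \<alpha>" using m x' z by linarith+
    have le: "s * (\<alpha> + e) \<le> s * x" "s * x \<le> s * \<alpha>"
      using \<alpha> neg by (simp_all add: mult_left_mono_neg)
    have "\<bar>h * m - (s * x + u)\<bar> \<le> 2 * h" using m z le by linarith
    moreover have "\<alpha> < x'" "x' < \<alpha> + e" using lt neg by (simp_all add: mult_less_cancel_left_neg)
    ultimately show ?thesis by blast
  qed
  then show ?thesis using that[of x' m] x' \<alpha> by auto
qed

context diagonal_self_affine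
begin

text \<open>The height of a word is the shorter side of its cylinder; the longer side is the major one. At
  a tie the first coordinate counts as major.\<close>

definition height :: "nat list \<Rightarrow> real" where
  "height w = min (scale 1 w) (scale 2 w)"

definition major :: "nat list \<Rightarrow> 2" where
  "major w = (if scale 2 w \<le> scale 1 w then 1 else 2)"

definition minor :: "nat list \<Rightarrow> 2" where
  "minor w = (if scale 2 w \<le> scale 1 w then 2 else 1)"

definition flat_words :: "real \<Rightarrow> nat list set" where
  "flat_words \<delta> = stopping (\<lambda>w. height w \<le> \<delta>) (nat \<lceil>ln \<delta> / ln hi\<rceil>) []"

definition square_sum :: "real \<Rightarrow> real" where
  "square_sum \<delta> = (\<Sum>(k, l)\<in>mesh_range \<delta> \<times> mesh_range \<delta>. measure \<mu> (strip 1 \<delta> k \<inter> strip 2 \<delta> l) powr q)"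

text \<open>Each flat cylinder is replaced by the projection of its copy of \<open>\<mu>\<close> to the major
  direction, rescaled to unit length.\<close>

definition word_sum :: "real \<Rightarrow> real" where
  "word_sum \<delta> = (\<Sum>w\<in>flat_words \<delta>. weight w powr q * strip_sum (major w) (\<delta> / scale (major w) w))"

lemma scale_minor: "scale (minor w) w = height w"
  and scale_major: "height w \<le> scale (major w) w"
  by (auto simp: height_def major_def minor_def)

lemma flat_words:
  assumes d: "0 < \<delta>" "\<delta> < 1" and w: "w \<in> flat_words \<delta>"
  shows "set w \<subseteq> letters" "height w \<le> \<delta>" "lo * \<delta> \<le> height w" "real (length w) \<le> ln \<delta> / ln hi + 1"
proof -
  have 1: "height [] = 1" by (simp add: height_def scale_Nil)
  have 2: "lo * height u \<le> height (i # u)" if "set u \<subseteq> letters" "i \<in> letters" for u i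
  proof -
    have "lo * height u \<le> scale c (i # u)" for c
    proof -
      have "lo * height u \<le> lo * scale c u"
        using lo_hi(1) exhaust_2[of c] by (intro mult_left_mono) (auto simp: height_def)
      also have "\<dots> \<le> scale c (i # u)"
        using lo_le[OF that(2), of c] scale_pos[OF that(1), of c] by (simp add: scale_Cons)
      finally show ?thesis .
    qed
    then show ?thesis by (simp add: height_def)
  qed
  have 3: "height u \<le> hi ^ length u" if "set u \<subseteq> letters" for u
    using scale_le_power[OF that, of 1] by (simp add: height_def)
  show "set w \<subseteq> letters" "height w \<le> \<delta>" "lo * \<delta> \<le> height w" "real (length w) \<le> ln \<delta> / ln hi + 1"
    using stopping_size[of \<delta> height w, OF d 1 2 3] w unfolding flat_words_def by blast+
qed

lemma finite_flat_words: "finite (flat_words \<delta>)"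
  by (simp add: flat_words_def finite_stopping)

text \<open>This is where the images of the open square must be disjoint. Each cylinder that meets the square contains in its
  interior a point of a lattice of mesh \<open>h\<close>, proportional to \<open>\<delta>\<close>, near the square. The
  interiors are disjoint, so different cylinders get different points, and there are boundedly
  many. Cylinders are counted here, not mass, so the bound also holds for measures that live on
  the boundaries.\<close>

lemma card_cylinders_meeting_square:
  assumes d: "0 < \<delta>" "\<delta> < 1"
  shows "real (card {w \<in> flat_words \<delta>. wmap w ` cbox 0 1 \<inter> (strip 1 \<delta> k \<inter> strip 2 \<delta> l) \<noteq> {}}) \<le> (4 / lo + 10)\<^sup>2"
    (is "real (card ?V) \<le> _")
proof -
  define h where "h = lo * \<delta> / 2"
  have h: "0 < h" using d lo_hi by (simp add: h_def)
  define X where "X n = {\<delta> * real_of_int n - 2 * h..\<delta> * (real_of_int n + 1) + 2 * h}" for n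
  define M where "M n = {m::int. h * m \<in> X n}" for n
  have MM: "M n \<subseteq> {m. \<exists>x\<in>X n. h * real_of_int m \<le> x \<and> x \<le> h * (real_of_int m + 1)}" for n
    using h by (auto simp: M_def intro!: bexI[of _ "h * _"])
  have diam: "\<bar>x - y\<bar> \<le> \<delta> + 4 * h" if "x \<in> X n" "y \<in> X n" for x y n
    using that by (auto simp: X_def abs_le_iff algebra_simps)
  have finM: "finite (M n)" for n
  proof (rule finite_subset[OF MM], rule card_mesh_meeting(1)[OF h])
    show "0 \<le> \<delta> + 4 * h" using d h by simp
  qed (rule diam)
  have cardM: "real (card (M n)) \<le> 4 / lo + 10" for n
  proof (rule card_le_mesh_meeting[OF h])
    show "\<bar>x - y\<bar> \<le> \<delta> + 4 * h" if "x \<in> X n" "y \<in> X n" for x y by (rule diam[OF that])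
    have "2 * (\<delta> + 4 * h) / h + 2 = 2 * (\<delta> / h) + 10" using h by (simp add: field_simps)
    also have "\<delta> / h = 2 / lo" using d lo_hi by (simp add: h_def)
    finally show "2 * (\<delta> + 4 * h) / h + 2 \<le> 4 / lo + 10" by simp
  qed (use MM[of n] d h in auto)
  define good where "good w m \<longleftrightarrow> fst m \<in> M k \<and> snd m \<in> M l \<and>
      (\<exists>\<eta>\<in>box 0 1. wmap w \<eta> $ 1 = h * real_of_int (fst m) \<and> wmap w \<eta> $ 2 = h * real_of_int (snd m))" for w m
  have "\<exists>m. good w m" if w: "w \<in> ?V" for w
  proof -
    note W = flat_words[OF d, of w]
    have wI: "w \<in> flat_words \<delta>" using w by simp
    obtain \<xi> where \<xi>: "\<xi> \<in> cbox 0 1" "wmap w \<xi> \<in> strip 1 \<delta> k" "wmap w \<xi> \<in> strip 2 \<delta> l" using w by auto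
    have "\<exists>x' m. 0 < x' \<and> x' < 1 \<and> (\<forall>\<eta>. \<eta> $ c = x' \<longrightarrow> wmap w \<eta> $ c = h * real_of_int m) \<and> \<bar>h * real_of_int m - wmap w \<xi> $ c\<bar> \<le> 2 * h" for c
    proof -
      obtain s u where su: "\<bar>s\<bar> = scale c w" "\<And>\<xi>. wmap w \<xi> $ c = s * \<xi> $ c + u"
        by (rule wmap_component[OF W(1)[OF wI], of c]) auto
      have "2 * h \<le> height w" using W(3)[OF wI] by (simp add: h_def)
      also have "height w \<le> \<bar>s\<bar>" using exhaust_2[of c] by (auto simp: height_def su(1))
      finally have s: "2 * h \<le> \<bar>s\<bar>" .
      have "0 \<le> \<xi> $ c" "\<xi> $ c \<le> 1" using \<xi>(1) by (auto simp: mem_unit_square)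
      then obtain x' m where "0 < x'" "x' < 1" "s * x' + u = h * real_of_int m" "\<bar>h * real_of_int m - (s * \<xi> $ c + u)\<bar> \<le> 2 * h"
        by (rule lattice_point_in_affine_image[OF _ _ h s])
      then show ?thesis unfolding su(2) by blast
    qed
    note ex = this
    obtain x1 m1 where m1: "0 < x1" "x1 < 1" "\<And>\<eta>. \<eta> $ 1 = x1 \<Longrightarrow> wmap w \<eta> $ 1 = h * real_of_int m1" "\<bar>h * real_of_int m1 - wmap w \<xi> $ 1\<bar> \<le> 2 * h"
      using ex[of 1] by blast
    obtain x2 m2 where m2: "0 < x2" "x2 < 1" "\<And>\<eta>. \<eta> $ 2 = x2 \<Longrightarrow> wmap w \<eta> $ 2 = h * real_of_int m2" "\<bar>h * real_of_int m2 - wmap w \<xi> $ 2\<bar> \<le> 2 * h"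
      using ex[of 2] by blast
    define \<eta> :: "real^2" where "\<eta> = vector [x1, x2]"
    have \<eta>: "\<eta> $ 1 = x1" "\<eta> $ 2 = x2" by (simp_all add: \<eta>_def)
    have "\<eta> \<in> box 0 1" using m1 m2 \<eta> by (simp add: mem_box_cart forall_2)
    moreover have "m1 \<in> M k" "m2 \<in> M l"
      using m1(4) m2(4) \<xi>(2,3) by (auto simp: M_def X_def mem_strip abs_le_iff)
    ultimately show ?thesis using m1(3)[OF \<eta>(1)] m2(3)[OF \<eta>(2)]
      unfolding good_def by (intro exI[of _ "(m1, m2)"]) auto
  qed
  then have "\<forall>w\<in>?V. \<exists>m. good w m" by blast
  then obtain f where "\<forall>w\<in>?V. good w (f w)" using bchoice[of ?V good] by blast
  then have f: "good w (f w)" if "w \<in> ?V" for w using that by blast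
  have "inj_on f ?V"
  proof (rule inj_onI, rule ccontr)
    fix w w' assume w: "w \<in> ?V" "w' \<in> ?V" "f w = f w'" "w \<noteq> w'"
    obtain \<eta> where \<eta>: "\<eta> \<in> box 0 1" "wmap w \<eta> $ 1 = h * fst (f w)" "wmap w \<eta> $ 2 = h * snd (f w)"
      using f[OF w(1)] unfolding good_def by blast
    obtain \<eta>' where \<eta>': "\<eta>' \<in> box 0 1" "wmap w' \<eta>' $ 1 = h * fst (f w')" "wmap w' \<eta>' $ 2 = h * snd (f w')"
      using f[OF w(2)] unfolding good_def by blast
    have "wmap w \<eta> = wmap w' \<eta>'" using \<eta> \<eta>' w(3) by (simp add: vec_eq_iff forall_2)
    moreover have "wmap w ` box 0 1 \<inter> wmap w' ` box 0 1 = {}"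
      using wmap_image_box_disjoint[of w _ _ "[]" w'] w unfolding flat_words_def by auto
    ultimately show False using \<eta>(1) \<eta>'(1) by (metis IntI empty_iff image_eqI)
  qed
  moreover have "f ` ?V \<subseteq> M k \<times> M l"
    by (rule image_subsetI, drule f) (simp add: good_def mem_Times_iff)
  ultimately have "card ?V \<le> card (M k \<times> M l)" using finM by (intro card_inj_on_le) auto
  then have "real (card ?V) \<le> real (card (M k)) * real (card (M l))"
    by (simp add: card_cartesian_product flip: of_nat_mult)
  also have "\<dots> \<le> (4 / lo + 10) * (4 / lo + 10)" using cardM by (intro mult_mono) (auto intro: order_trans[OF of_nat_0_le_iff])
  finally show ?thesis by (simp add: power2_eq_square)
qed

text \<open>Pulled back along a flat cylinder, the mesh squares become rectangles at least as high as
  the unit square and of width \<open>\<delta> / scale c w\<close>; up to multiplicities of at most \<open>4\<close> in each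
  direction these are strips.\<close>

lemma cylinder_square_sum:
  fixes c d :: 2
  assumes w: "set w \<subseteq> letters" and d: "0 < \<delta>" and flat: "scale d w \<le> \<delta>"
  defines "S \<equiv> (\<Sum>(k, l)\<in>mesh_range \<delta> \<times> mesh_range \<delta>. measure \<mu> (wmap w -` (strip c \<delta> k \<inter> strip d \<delta> l)) powr q)"
  shows "S \<le> 16 powr q * 16 * strip_sum c (\<delta> / scale c w)"
    and "strip_sum c (\<delta> / scale c w) \<le> 16 powr q * 16 * S"
proof -
  define \<rho> where "\<rho> = \<delta> / scale c w"
  have sc: "0 < scale c w" by (rule scale_pos[OF w])
  have \<rho>: "0 < \<rho>" using sc d by (simp add: \<rho>_def)
  obtain s u where su: "\<bar>s\<bar> = scale c w" "\<And>\<xi>. wmap w \<xi> $ c = s * \<xi> $ c + u"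
    by (rule wmap_component[OF w, of c]) auto
  have s\<rho>: "\<bar>s\<bar> * \<rho> = \<delta>" using sc by (simp add: \<rho>_def su)
  define E where "E kl = wmap w -` (strip c \<delta> (fst kl) \<inter> strip d \<delta> (snd kl))" for kl
  have [measurable]: "E kl \<in> sets borel" for kl unfolding E_def by (intro wmap_vimage_borel) auto
  have G: "wmap w -` strip c \<delta> k = {\<xi>. \<delta> * real_of_int k \<le> s * \<xi> $ c + u \<and> s * \<xi> $ c + u \<le> \<delta> * (real_of_int k + 1)}" for k
    by (auto simp: strip_def su)
  have near: "\<bar>s\<bar> * \<rho> \<le> 1 * \<delta>" "\<delta> \<le> 1 * (\<bar>s\<bar> * \<rho>)" "(0::real) < 1" using s\<rho> by simp_all
  have meets:
    "real (card {j \<in> B. wmap w -` strip c \<delta> k \<inter> strip c \<rho> j \<inter> cbox 0 1 \<noteq> {}}) \<le> 4"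
    "real (card {k \<in> A. wmap w -` strip c \<delta> k \<inter> strip c \<rho> j \<inter> cbox 0 1 \<noteq> {}}) \<le> 4" for A B k j
    using affine_preimage_strip_meets[of \<delta> \<rho> s 1 "\<lambda>k. wmap w -` strip c \<delta> k" c u, OF d \<rho> near G] by auto
  have other: "real (card {l \<in> mesh_range \<delta>. wmap w -` strip d \<delta> l \<inter> cbox 0 1 \<noteq> {}}) \<le> 4"
  proof (rule card_le_mesh_meeting[OF d])
    let ?X = "(\<lambda>\<xi>. wmap w \<xi> $ d) ` cbox 0 1"
    show "0 \<le> scale d w" using scale_pos[OF w] by (simp add: less_imp_le)
    show "\<bar>x - y\<bar> \<le> scale d w" if xy: "x \<in> ?X" "y \<in> ?X" for x y
    proof -
      obtain \<xi> \<eta> where \<xi>: "x = wmap w \<xi> $ d" "y = wmap w \<eta> $ d" "\<xi> \<in> cbox 0 1" "\<eta> \<in> cbox 0 1" using xy by auto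
      have "0 \<le> \<xi> $ d" "\<xi> $ d \<le> 1" "0 \<le> \<eta> $ d" "\<eta> $ d \<le> 1" using \<xi> by (auto simp: mem_unit_square)
      then have "\<bar>\<xi> $ d - \<eta> $ d\<bar> \<le> 1" by linarith
      then show ?thesis
        using mult_left_mono[of "\<bar>\<xi> $ d - \<eta> $ d\<bar>" 1 "scale d w"] scale_pos[OF w, of d]
        by (simp add: \<xi> wmap_component_dist[OF w])
    qed
    show "2 * scale d w / \<delta> + 2 \<le> 4" using flat d by (simp add: pos_divide_le_eq)
    show "\<exists>x\<in>?X. \<delta> * real_of_int l \<le> x \<and> x \<le> \<delta> * (real_of_int l + 1)"
      if "l \<in> {l \<in> mesh_range \<delta>. wmap w -` strip d \<delta> l \<inter> cbox 0 1 \<noteq> {}}" for l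
      using that by (auto simp: mem_strip)
  qed
  have m1: "real (card {j \<in> B. E kl \<inter> strip c \<rho> j \<inter> cbox 0 1 \<noteq> {}}) \<le> 16" if B: "finite B" for B kl
  proof -
    have "card {j \<in> B. E kl \<inter> strip c \<rho> j \<inter> cbox 0 1 \<noteq> {}} \<le> card {j \<in> B. wmap w -` strip c \<delta> (fst kl) \<inter> strip c \<rho> j \<inter> cbox 0 1 \<noteq> {}}"
      using B by (intro card_mono) (auto simp: E_def)
    then show ?thesis using meets(1)[of B "fst kl"] by linarith
  qed
  have m2: "real (card {kl \<in> mesh_range \<delta> \<times> mesh_range \<delta>. E kl \<inter> strip c \<rho> j \<inter> cbox 0 1 \<noteq> {}}) \<le> 16" for j
  proof -
    let ?A = "{k \<in> mesh_range \<delta>. wmap w -` strip c \<delta> k \<inter> strip c \<rho> j \<inter> cbox 0 1 \<noteq> {}}"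
    let ?B = "{l \<in> mesh_range \<delta>. wmap w -` strip d \<delta> l \<inter> cbox 0 1 \<noteq> {}}"
    have "card {kl \<in> mesh_range \<delta> \<times> mesh_range \<delta>. E kl \<inter> strip c \<rho> j \<inter> cbox 0 1 \<noteq> {}} \<le> card (?A \<times> ?B)"
      by (intro card_mono) (auto simp: E_def)
    then have "real (card {kl \<in> mesh_range \<delta> \<times> mesh_range \<delta>. E kl \<inter> strip c \<rho> j \<inter> cbox 0 1 \<noteq> {}}) \<le> real (card ?A) * real (card ?B)"
      by (simp add: card_cartesian_product flip: of_nat_mult)
    also have "\<dots> \<le> 4 * 4" using meets(2)[of "mesh_range \<delta>" j] other by (intro mult_mono) auto
    finally show ?thesis by simp
  qed
  have S: "S = (\<Sum>kl\<in>mesh_range \<delta> \<times> mesh_range \<delta>. measure \<mu> (E kl) powr q)"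
    by (simp add: S_def E_def case_prod_beta)
  show "S \<le> 16 powr q * 16 * strip_sum c (\<delta> / scale c w)"
    unfolding S \<rho>_def[symmetric] strip_sum_def
  proof (rule sum_measure_covered_le)
    fix \<xi> assume "\<xi> \<in> cbox (0::real^2) 1"
    then show "\<exists>j\<in>mesh_range \<rho>. \<xi> \<in> strip c \<rho> j" by (rule strips_cover[OF \<rho>])
  qed (use m1 m2 in auto)
  show "strip_sum c (\<delta> / scale c w) \<le> 16 powr q * 16 * S"
    unfolding S \<rho>_def[symmetric] strip_sum_def
  proof (rule sum_measure_covered_le)
    fix \<xi> assume "\<xi> \<in> cbox (0::real^2) 1"
    then have \<xi>: "wmap w \<xi> \<in> cbox 0 1" by (rule wmap_unit_square[OF w])
    obtain k l where "k \<in> mesh_range \<delta>" "wmap w \<xi> \<in> strip c \<delta> k"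
      and "l \<in> mesh_range \<delta>" "wmap w \<xi> \<in> strip d \<delta> l"
      using strips_cover[OF d \<xi>] by meson
    then show "\<exists>kl\<in>mesh_range \<delta> \<times> mesh_range \<delta>. \<xi> \<in> E kl"
      by (intro bexI[of _ "(k, l)"]) (auto simp: E_def)
  qed (use m1 m2 in \<open>auto simp: Int_commute\<close>)
qed

lemma cylinder_square_sum_major:
  assumes d: "0 < \<delta>" "\<delta> < 1" and w: "w \<in> flat_words \<delta>"
  defines "S \<equiv> (\<Sum>(k, l)\<in>mesh_range \<delta> \<times> mesh_range \<delta>. measure \<mu> (wmap w -` (strip 1 \<delta> k \<inter> strip 2 \<delta> l)) powr q)"
  shows "S \<le> 16 powr q * 16 * strip_sum (major w) (\<delta> / scale (major w) w)"
    and "strip_sum (major w) (\<delta> / scale (major w) w) \<le> 16 powr q * 16 * S"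
proof -
  have "S = (\<Sum>(k, l)\<in>mesh_range \<delta> \<times> mesh_range \<delta>. measure \<mu> (wmap w -` (strip (major w) \<delta> k \<inter> strip (minor w) \<delta> l)) powr q)"
  proof (cases "scale 2 w \<le> scale 1 w")
    case True
    then show ?thesis by (simp add: S_def major_def minor_def)
  next
    case False
    have "S = (\<Sum>k\<in>mesh_range \<delta>. \<Sum>l\<in>mesh_range \<delta>. measure \<mu> (wmap w -` (strip 1 \<delta> k \<inter> strip 2 \<delta> l)) powr q)"
      by (simp add: S_def sum.cartesian_product)
    also have "\<dots> = (\<Sum>l\<in>mesh_range \<delta>. \<Sum>k\<in>mesh_range \<delta>. measure \<mu> (wmap w -` (strip 2 \<delta> l \<inter> strip 1 \<delta> k)) powr q)"
      by (subst sum.swap) (simp only: Int_commute)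
    also have "\<dots> = (\<Sum>(k, l)\<in>mesh_range \<delta> \<times> mesh_range \<delta>. measure \<mu> (wmap w -` (strip 2 \<delta> k \<inter> strip 1 \<delta> l)) powr q)"
      by (rule sum.cartesian_product)
    finally show ?thesis using False by (simp add: major_def minor_def)
  qed
  then show "S \<le> 16 powr q * 16 * strip_sum (major w) (\<delta> / scale (major w) w)"
    "strip_sum (major w) (\<delta> / scale (major w) w) \<le> 16 powr q * 16 * S"
    using cylinder_square_sum[OF flat_words(1)[OF d w] d(1), of "minor w" "major w"]
      flat_words(2)[OF d w] by (simp_all add: scale_minor)
qed

theorem square_sum_comparable:
  obtains C where "0 < C" "\<And>\<delta>. 0 < \<delta> \<Longrightarrow> \<delta> < 1 \<Longrightarrow> square_sum \<delta> \<le> C * word_sum \<delta>"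
    "\<And>\<delta>. 0 < \<delta> \<Longrightarrow> \<delta> < 1 \<Longrightarrow> word_sum \<delta> \<le> C * square_sum \<delta>"
proof -
  define M where "M = (4 / lo + 10)\<^sup>2"
  define C0 :: real where "C0 = 16 powr q * 16"
  have "0 < 4 / lo + 10" using lo_hi(1) by (intro add_pos_pos) auto
  then have M: "0 < M" unfolding M_def by (rule zero_less_power)
  have C0: "0 < C0" by (simp add: C0_def)
  define C where "C = M powr q * C0 + C0 * M"
  have C: "0 < C" using M C0 by (simp add: C_def add_pos_pos)
  have main: "square_sum \<delta> \<le> M powr q * C0 * word_sum \<delta>" "word_sum \<delta> \<le> C0 * M * square_sum \<delta>"
    if d: "0 < \<delta>" "\<delta> < 1" for \<delta>
  proof -
    let ?Q = "\<lambda>kl. strip 1 \<delta> (fst kl) \<inter> strip 2 \<delta> (snd kl)"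
    let ?Z = "mesh_range \<delta> \<times> mesh_range \<delta>"
    let ?V = "\<lambda>kl. {w \<in> flat_words \<delta>. wmap w ` cbox 0 1 \<inter> ?Q kl \<noteq> {}}"
    define f where "f w kl = weight w * measure \<mu> (wmap w -` ?Q kl)" for w kl
    have f0: "0 \<le> f w kl" if "w \<in> flat_words \<delta>" for w kl
      using weight_pos[OF flat_words(1)[OF d that]] by (simp add: f_def)
    have card: "real (card (?V kl)) \<le> M" for kl
      unfolding M_def by (rule card_cylinders_meeting_square[OF d])
    have miss: "wmap w -` ?Q kl \<inter> cbox 0 1 = {}" if "w \<in> flat_words \<delta> - ?V kl" for w kl
      using that by auto
    have outside: "f w kl = 0" if "w \<in> flat_words \<delta> - ?V kl" for w kl
      using measure_eq_0[OF wmap_vimage_borel miss[OF that]] by (simp add: f_def)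
    have mu_eq: "measure \<mu> (?Q kl) = (\<Sum>w\<in>?V kl. f w kl)" for kl
      unfolding f_def
      by (rule measure_stopping_meeting[where P = "\<lambda>w. height w \<le> \<delta>" and n = "nat \<lceil>ln \<delta> / ln hi\<rceil>"])
        (use miss[of _ kl] in \<open>auto simp: flat_words_def\<close>)
    have sq: "(\<Sum>w\<in>?V kl. f w kl powr q) = (\<Sum>w\<in>flat_words \<delta>. f w kl powr q)" for kl
      using finite_flat_words outside by (intro sum.mono_neutral_left) auto
    have swap: "(\<Sum>kl\<in>?Z. \<Sum>w\<in>flat_words \<delta>. f w kl powr q)
        = (\<Sum>w\<in>flat_words \<delta>. weight w powr q * (\<Sum>(k, l)\<in>?Z. measure \<mu> (wmap w -` (strip 1 \<delta> k \<inter> strip 2 \<delta> l)) powr q))"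
    proof (subst sum.swap, rule sum.cong[OF refl])
      fix w assume w: "w \<in> flat_words \<delta>"
      show "(\<Sum>kl\<in>?Z. f w kl powr q) = weight w powr q * (\<Sum>(k, l)\<in>?Z. measure \<mu> (wmap w -` (strip 1 \<delta> k \<inter> strip 2 \<delta> l)) powr q)"
        using weight_pos[OF flat_words(1)[OF d w]]
        by (simp add: f_def powr_mult sum_distrib_left case_prod_beta)
    qed
    have sqsum: "square_sum \<delta> = (\<Sum>kl\<in>?Z. measure \<mu> (?Q kl) powr q)"
      by (simp add: square_sum_def case_prod_beta)
    have "square_sum \<delta> \<le> (\<Sum>kl\<in>?Z. M powr q * (\<Sum>w\<in>?V kl. f w kl powr q))"
      unfolding sqsum mu_eq using f0 card q_nonneg finite_flat_words
      by (intro sum_mono powr_sum_le) auto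
    also have "\<dots> = M powr q * (\<Sum>kl\<in>?Z. \<Sum>w\<in>flat_words \<delta>. f w kl powr q)"
      by (simp only: sq sum_distrib_left)
    also have "\<dots> \<le> M powr q * (\<Sum>w\<in>flat_words \<delta>. weight w powr q * (C0 * strip_sum (major w) (\<delta> / scale (major w) w)))"
      unfolding swap C0_def using cylinder_square_sum_major(1)[OF d]
      by (intro mult_left_mono sum_mono) auto
    also have "\<dots> = M powr q * C0 * word_sum \<delta>"
      by (simp add: word_sum_def sum_distrib_left mult_ac)
    finally show "square_sum \<delta> \<le> M powr q * C0 * word_sum \<delta>" .
    have "word_sum \<delta> \<le> (\<Sum>w\<in>flat_words \<delta>. weight w powr q * (C0 * (\<Sum>(k, l)\<in>?Z. measure \<mu> (wmap w -` (strip 1 \<delta> k \<inter> strip 2 \<delta> l)) powr q)))"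
      unfolding word_sum_def C0_def using cylinder_square_sum_major(2)[OF d]
      by (intro mult_left_mono sum_mono) auto
    also have "\<dots> = C0 * (\<Sum>kl\<in>?Z. \<Sum>w\<in>?V kl. f w kl powr q)"
      unfolding sq swap by (simp add: sum_distrib_left mult_ac)
    also have "\<dots> \<le> C0 * (\<Sum>kl\<in>?Z. M * measure \<mu> (?Q kl) powr q)"
      unfolding mu_eq using f0 card q_nonneg finite_flat_words C0
      by (intro mult_left_mono sum_mono sum_powr_le) auto
    also have "\<dots> = C0 * M * square_sum \<delta>"
      by (simp add: sqsum sum_distrib_left mult_ac)
    finally show "word_sum \<delta> \<le> C0 * M * square_sum \<delta>" .
  qed
  have nonneg: "0 \<le> square_sum \<delta>" "0 \<le> word_sum \<delta>" if d: "0 < \<delta>" "\<delta> < 1" for \<delta>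
  proof -
    show "0 \<le> square_sum \<delta>" by (auto simp: square_sum_def intro!: sum_nonneg)
    show "0 \<le> word_sum \<delta>"
      unfolding word_sum_def
    proof (intro sum_nonneg mult_nonneg_nonneg)
      fix w assume "w \<in> flat_words \<delta>"
      then have "0 < \<delta> / scale (major w) w" using d scale_pos[OF flat_words(1)[OF d]] by simp
      then show "0 \<le> strip_sum (major w) (\<delta> / scale (major w) w)" by (intro less_imp_le strip_sum_pos)
    qed simp
  qed
  show ?thesis
  proof (rule that[OF C])
    fix \<delta> :: real assume d: "0 < \<delta>" "\<delta> < 1"
    have "M powr q * C0 * word_sum \<delta> \<le> C * word_sum \<delta>" "C0 * M * square_sum \<delta> \<le> C * square_sum \<delta>"
      using nonneg[OF d] M C0 by (auto simp: C_def intro!: mult_right_mono)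
    then show "square_sum \<delta> \<le> C * word_sum \<delta>" "word_sum \<delta> \<le> C * square_sum \<delta>"
      using main[OF d] by linarith+
  qed
qed

end

section \<open>Growth exponents\<close>

lemma powr_between:
  fixes l x e :: real
  assumes "0 < l" "l \<le> x" "x \<le> 1"
  shows "l powr \<bar>e\<bar> \<le> x powr e" "x powr e \<le> l powr (- \<bar>e\<bar>)"
proof -
  have ln: "ln l \<le> ln x" "ln x \<le> 0" using assms by simp_all
  have "\<bar>e * ln x\<bar> = \<bar>e\<bar> * - ln x" using ln by (simp add: abs_mult)
  also have "\<dots> \<le> \<bar>e\<bar> * - ln l" using ln by (intro mult_left_mono) auto
  finally have "\<bar>e\<bar> * ln l \<le> e * ln x" "e * ln x \<le> - \<bar>e\<bar> * ln l" by (auto simp: abs_le_iff)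
  then show "l powr \<bar>e\<bar> \<le> x powr e" "x powr e \<le> l powr (- \<bar>e\<bar>)"
    using assms by (simp_all add: powr_def)
qed

lemma powr_le_endpoints:
  fixes x y z e :: real
  assumes "0 < x" "x \<le> y" "y \<le> z"
  shows "y powr e \<le> x powr e + z powr e"
proof (cases "0 \<le> e")
  case True
  then have "y powr e \<le> z powr e" using assms by (intro powr_mono2) auto
  then show ?thesis by (simp add: add_increasing)
next
  case False
  then have "y powr e \<le> x powr e" using assms by (intro powr_mono2') auto
  then show ?thesis by (simp add: add_increasing2)
qed

lemma exponent_less:
  fixes f :: "real \<Rightarrow> real"
  assumes "0 < K" "0 < e" and f: "\<And>\<delta>. 0 < \<delta> \<Longrightarrow> \<delta> < 1 \<Longrightarrow> 0 < f \<delta>"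
    "\<And>\<delta>. 0 < \<delta> \<Longrightarrow> \<delta> < 1 \<Longrightarrow> f \<delta> \<le> K * \<delta> powr (- s - e)"
  shows "\<forall>\<^sub>F \<delta> in at_right 0. ln (f \<delta>) / (- ln \<delta>) < s + 2 * e"
proof -
  have "filterlim (\<lambda>\<delta>::real. - ln \<delta>) at_top (at_right 0)"
    using ln_at_0 by (simp add: filterlim_uminus_at_top)
  then have "\<forall>\<^sub>F \<delta> in at_right 0. ln K / e < - ln \<delta>"
    by (simp add: filterlim_at_top_dense)
  moreover have "\<forall>\<^sub>F \<delta>::real in at_right 0. 0 < \<delta> \<and> \<delta> < 1"
    by (rule eventually_at_rightI[of 0 1]) auto
  ultimately show ?thesis
  proof eventually_elim
    case (elim \<delta>)
    then have d: "0 < \<delta>" "\<delta> < 1" by auto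
    define L where "L = - ln \<delta>"
    have L: "0 < L" "ln K < e * L"
      using elim d \<open>0 < e\<close> by (auto simp: L_def pos_divide_less_eq mult.commute)
    have "ln (f \<delta>) \<le> ln (K * \<delta> powr (- s - e))"
      using \<open>0 < K\<close> f[OF d] d by (subst ln_le_cancel_iff) auto
    also have "\<dots> = ln K + (s + e) * L"
      using \<open>0 < K\<close> d by (simp add: ln_mult ln_powr L_def algebra_simps)
    also have "\<dots> < (s + 2 * e) * L" using L by (simp add: algebra_simps)
    finally show ?case using L(1) by (simp add: pos_divide_less_eq flip: L_def)
  qed
qed

lemma exponent_greater:
  fixes f :: "real \<Rightarrow> real"
  assumes "0 < K" "0 < e" and f: "\<And>\<delta>. 0 < \<delta> \<Longrightarrow> \<delta> < 1 \<Longrightarrow> 0 < f \<delta>"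
    "\<And>\<delta>. 0 < \<delta> \<Longrightarrow> \<delta> < 1 \<Longrightarrow> \<delta> powr (- s + e) \<le> K * f \<delta>"
  shows "\<forall>\<^sub>F \<delta> in at_right 0. s - 2 * e < ln (f \<delta>) / (- ln \<delta>)"
proof -
  have "\<forall>\<^sub>F \<delta> in at_right 0. ln (1 / f \<delta>) / (- ln \<delta>) < - s + 2 * e"
  proof (rule exponent_less[OF assms(1,2)])
    fix \<delta> :: real assume d: "0 < \<delta>" "\<delta> < 1"
    show "0 < 1 / f \<delta>" using f(1)[OF d] by simp
    have "\<delta> powr (- (- s) - e) * \<delta> powr (- s + e) = 1" using d by (simp add: powr_add[symmetric])
    then have "1 \<le> \<delta> powr (- (- s) - e) * (K * f \<delta>)"
      using mult_left_mono[OF f(2)[OF d], of "\<delta> powr (- (- s) - e)"] by simp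
    then show "1 / f \<delta> \<le> K * \<delta> powr (- (- s) - e)"
      using f(1)[OF d] by (simp add: pos_divide_le_eq mult_ac)
  qed
  moreover have "\<forall>\<^sub>F \<delta>::real in at_right 0. 0 < \<delta> \<and> \<delta> < 1"
    by (rule eventually_at_rightI[of 0 1]) auto
  ultimately show ?thesis
  proof eventually_elim
    case (elim \<delta>)
    then show ?case using f(1)[of \<delta>] by (simp add: ln_div)
  qed
qed

text \<open>The limit only controls \<open>f\<close> near \<open>0\<close>, while the rescaled meshes reach sizes up to \<open>R\<close>;
  on the rest of the range \<open>f\<close> and the powers of \<open>\<delta>\<close> lie between positive constants.\<close>

lemma exponent_bounds:
  fixes f :: "real \<Rightarrow> real"
  assumes lim: "((\<lambda>\<delta>. ln (f \<delta>) / (- ln \<delta>)) \<longlongrightarrow> s) (at_right 0)" and "0 < e" "0 < R" "0 \<le> q"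
    and bounds: "\<And>\<delta>. 0 < \<delta> \<Longrightarrow> (1 / \<delta> + 2) powr (- q) \<le> f \<delta>" "\<And>\<delta>. 0 < \<delta> \<Longrightarrow> f \<delta> \<le> 1 / \<delta> + 2"
  obtains K where "0 < K" "\<And>\<delta>. 0 < \<delta> \<Longrightarrow> \<delta> \<le> R \<Longrightarrow> f \<delta> \<le> K * \<delta> powr (- s - e)"
    "\<And>\<delta>. 0 < \<delta> \<Longrightarrow> \<delta> \<le> R \<Longrightarrow> \<delta> powr (- s + e) \<le> K * f \<delta>"
proof -
  have "\<forall>\<^sub>F \<delta> in at_right 0. dist (ln (f \<delta>) / (- ln \<delta>)) s < e"
    using lim \<open>0 < e\<close> by (rule tendstoD)
  then obtain b where b: "0 < b" "\<And>\<delta>. 0 < \<delta> \<Longrightarrow> \<delta> < b \<Longrightarrow> dist (ln (f \<delta>) / (- ln \<delta>)) s < e"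
    by (auto simp: eventually_at_right[of 0 1])
  define r where "r = min (min b R) 1 / 2"
  have r: "0 < r" "r < b" "r < 1" "r \<le> R" using b \<open>0 < R\<close> by (auto simp: r_def)
  define B where "B = 1 / r + 2"
  have B: "0 < B" using r by (simp add: B_def add_pos_pos)
  have fpos: "0 < f \<delta>" if "0 < \<delta>" for \<delta>
  proof -
    have "0 < 1 / \<delta> + 2" using that by (simp add: add_pos_pos)
    then have "0 < (1 / \<delta> + 2) powr (- q)" by simp
    then show ?thesis using bounds(1)[OF that] by linarith
  qed
  define E where "E c = r powr c + R powr c" for c
  have E: "0 < E c" for c using r by (simp add: E_def add_pos_nonneg)
  define K where "K = 1 + B * E (s + e) + E (- s + e) * B powr q"
  have K1: "1 \<le> K" "B * E (s + e) \<le> K" "E (- s + e) * B powr q \<le> K"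
    using B E[of "s + e"] E[of "- s + e"] by (auto simp: K_def add_nonneg_nonneg)
  show ?thesis
  proof (rule that[of K])
    show "0 < K" using K1 by simp
    fix \<delta> :: real assume d: "0 < \<delta>" "\<delta> \<le> R"
    have "f \<delta> \<le> K * \<delta> powr (- s - e) \<and> \<delta> powr (- s + e) \<le> K * f \<delta>"
    proof (cases "\<delta> < r")
      case True
      define L where "L = - ln \<delta>"
      have L: "0 < L" using True r d by (simp add: L_def)
      have "dist (ln (f \<delta>) / L) s < e" using b(2)[of \<delta>] True r d by (simp add: L_def)
      then have "ln (f \<delta>) / L < s + e" "s - e < ln (f \<delta>) / L" by (auto simp: dist_real_def abs_less_iff)
      then have l: "ln (f \<delta>) < (s + e) * L" "(s - e) * L < ln (f \<delta>)"
        using L by (simp_all add: pos_divide_less_eq pos_less_divide_eq)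
      have "f \<delta> = exp (ln (f \<delta>))" using fpos[OF d(1)] by simp
      also have "\<dots> \<le> exp ((s + e) * L)" using l by simp
      also have "\<dots> = \<delta> powr (- s - e)" using d by (simp add: powr_def L_def algebra_simps)
      finally have 1: "f \<delta> \<le> \<delta> powr (- s - e)" .
      have "\<delta> powr (- s + e) = exp ((s - e) * L)" using d by (simp add: powr_def L_def algebra_simps)
      also have "\<dots> \<le> exp (ln (f \<delta>))" using l by simp
      also have "\<dots> = f \<delta>" using fpos[OF d(1)] by simp
      finally have 2: "\<delta> powr (- s + e) \<le> f \<delta>" .
      have "1 * \<delta> powr (- s - e) \<le> K * \<delta> powr (- s - e)" "1 * f \<delta> \<le> K * f \<delta>"
        using K1(1) fpos[OF d(1)] by (intro mult_right_mono; simp)+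
      then show ?thesis using 1 2 by (intro conjI) linarith+
    next
      case False
      then have rd: "r \<le> \<delta>" by simp
      have "1 / \<delta> \<le> 1 / r" using rd r by (simp add: frac_le)
      then have dB: "1 / \<delta> + 2 \<le> B" "0 < 1 / \<delta> + 2" using d by (auto simp: B_def add_pos_pos)
      have "1 = \<delta> powr (s + e) * \<delta> powr (- s - e)" using d by (simp add: powr_add[symmetric])
      also have "\<dots> \<le> E (s + e) * \<delta> powr (- s - e)"
        unfolding E_def using powr_le_endpoints[OF r(1) rd d(2)] by (intro mult_right_mono) auto
      finally have "B * 1 \<le> B * (E (s + e) * \<delta> powr (- s - e))" using B by (intro mult_left_mono) auto
      moreover have "f \<delta> \<le> B" using bounds(2)[OF d(1)] dB by linarith
      moreover have "B * E (s + e) * \<delta> powr (- s - e) \<le> K * \<delta> powr (- s - e)"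
        using K1 by (intro mult_right_mono) auto
      ultimately have 1: "f \<delta> \<le> K * \<delta> powr (- s - e)" by (simp add: mult.assoc)
      have "B powr (- q) \<le> (1 / \<delta> + 2) powr (- q)" using dB \<open>0 \<le> q\<close> by (intro powr_mono2') auto
      then have "B powr (- q) \<le> f \<delta>" using bounds(1)[OF d(1)] by linarith
      then have Bq: "1 \<le> B powr q * f \<delta>" using B by (simp add: powr_minus field_simps)
      have "\<delta> powr (- s + e) \<le> E (- s + e)"
        unfolding E_def by (rule powr_le_endpoints[OF r(1) rd d(2)])
      also have "\<dots> \<le> E (- s + e) * (B powr q * f \<delta>)"
        using mult_left_mono[OF Bq, of "E (- s + e)"] E[of "- s + e"] by simp
      also have "\<dots> \<le> K * f \<delta>"
        using mult_right_mono[OF K1(3), of "f \<delta>"] fpos[OF d(1)] by (simp add: mult.assoc)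
      finally show ?thesis using 1 by blast
    qed
    then show "f \<delta> \<le> K * \<delta> powr (- s - e)" "\<delta> powr (- s + e) \<le> K * f \<delta>" by auto
  qed
qed

text \<open>Jensen's inequality for the exponential function, from its tangent at the mean.\<close>

lemma exp_neg_mean_le:
  fixes g Y :: "'i \<Rightarrow> real"
  assumes "finite S" "\<And>w. w \<in> S \<Longrightarrow> 0 \<le> g w" "sum g S = 1"
  shows "exp (- (\<Sum>w\<in>S. g w * Y w)) \<le> (\<Sum>w\<in>S. g w * exp (- Y w))"
proof -
  define m where "m = (\<Sum>w\<in>S. g w * Y w)"
  have "(\<Sum>w\<in>S. g w * (exp (- m) * (1 + (m - Y w)))) \<le> (\<Sum>w\<in>S. g w * exp (- Y w))"
  proof (intro sum_mono mult_left_mono)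
    fix w
    have "exp (- m) * (1 + (m - Y w)) \<le> exp (- m) * exp (m - Y w)"
      using exp_ge_add_one_self[of "m - Y w"] by (intro mult_left_mono) auto
    then show "exp (- m) * (1 + (m - Y w)) \<le> exp (- Y w)" by (simp add: exp_add[symmetric])
  qed (use assms in auto)
  moreover have "(\<Sum>w\<in>S. g w * (exp (- m) * (1 + (m - Y w)))) = exp (- m) * ((1 + m) * sum g S - m)"
  proof -
    have "(\<Sum>w\<in>S. g w * (exp (- m) * (1 + (m - Y w)))) = (\<Sum>w\<in>S. exp (- m) * ((1 + m) * g w - g w * Y w))"
      by (intro sum.cong refl) (simp add: algebra_simps)
    also have "\<dots> = exp (- m) * ((1 + m) * sum g S - (\<Sum>w\<in>S. g w * Y w))"
      by (simp add: sum_distrib_left sum_subtractf right_diff_distrib)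
    finally show ?thesis by (simp add: m_def)
  qed
  ultimately show ?thesis using assms(3) by (simp add: m_def)
qed

section \<open>Gibbs weights on words\<close>

context diagonal_self_affine
begin

definition tau :: "2 \<Rightarrow> real" where
  "tau c = (SOME t. ((\<lambda>\<delta>. ln (strip_sum c \<delta>) / (- ln \<delta>)) \<longlongrightarrow> t) (at_right 0))"

lemma tau: "((\<lambda>\<delta>. ln (strip_sum c \<delta>) / (- ln \<delta>)) \<longlongrightarrow> tau c) (at_right 0)"
  unfolding tau_def by (rule someI_ex[OF strip_sum_exponent_exists])

text \<open>For \<open>phi x y = 1\<close> the letters carry probabilities, and \<open>gibbs x y\<close> is the law of a word with
  independent letters. Under this law \<open>log_ratio\<close> is a random walk with drift \<open>drift x y\<close>, and
  \<open>fluctuation x y\<close> is its centred version.\<close>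

definition gibbs :: "real \<Rightarrow> real \<Rightarrow> nat list \<Rightarrow> real" where
  "gibbs x y w = weight w powr q * scale 1 w powr x * scale 2 w powr y"

definition phi :: "real \<Rightarrow> real \<Rightarrow> real" where
  "phi x y = (\<Sum>i\<in>letters. gibbs x y [i])"

definition log_ratio :: "nat list \<Rightarrow> real" where
  "log_ratio w = ln (scale 1 w) - ln (scale 2 w)"

definition drift :: "real \<Rightarrow> real \<Rightarrow> real" where
  "drift x y = (\<Sum>i\<in>letters. gibbs x y [i] * log_ratio [i])"

definition fluctuation :: "real \<Rightarrow> real \<Rightarrow> nat list \<Rightarrow> real" where
  "fluctuation x y w = log_ratio w - drift x y * real (length w)"

lemma gibbs_nonneg: "0 \<le> gibbs x y w"
  by (simp add: gibbs_def)

lemma gibbs_Nil: "gibbs x y [] = 1"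
  by (simp add: gibbs_def weight_Nil scale_Nil)

lemma gibbs_Cons:
  assumes "set w \<subseteq> letters" "i \<in> letters"
  shows "gibbs x y (i # w) = gibbs x y [i] * gibbs x y w"
  using weight_pos[OF assms(1)] scale_pos[OF assms(1)] p_pos[OF assms(2)]
  by (simp add: gibbs_def weight_Cons scale_Cons weight_Nil scale_Nil powr_mult less_imp_le mult_ac)

lemma log_ratio_Cons:
  assumes "set w \<subseteq> letters" "i \<in> letters"
  shows "log_ratio (i # w) = log_ratio [i] + log_ratio w"
proof -
  have "ln (scale c (i # w)) = ln (scale c [i]) + ln (scale c w)" for c
    using scale_pos[OF assms(1), of c] contracting[OF assms(2), of c] by (simp add: scale_Cons scale_Nil ln_mult)
  then show ?thesis by (simp add: log_ratio_def)
qed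

lemma sum_gibbs:
  assumes "phi x y = 1"
  shows "(\<Sum>w\<in>stopping P n []. gibbs x y w) = 1"
proof -
  have "(\<Sum>w\<in>stopping P n []. gibbs x y w) = gibbs x y []"
  proof (rule sum_stopping)
    fix u assume u: "set u \<subseteq> letters"
    have "(\<Sum>i\<in>letters. gibbs x y (i # u)) = phi x y * gibbs x y u"
      unfolding phi_def sum_distrib_right by (intro sum.cong refl gibbs_Cons[OF u])
    then show "gibbs x y u = (\<Sum>i\<in>letters. gibbs x y (i # u))" using assms by simp
  qed simp
  then show ?thesis by (simp add: gibbs_Nil)
qed

text \<open>Wald's second identity: \<open>(fluctuation x y w)\<^sup>2 - \<sigma> * length w\<close> is a martingale, where
  \<open>\<sigma>\<close> is the variance of one step.\<close>

lemma sum_gibbs_fluctuation_sq: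
  assumes phi: "phi x y = 1"
  obtains \<sigma> where "0 \<le> \<sigma>" "\<And>P n. (\<Sum>w\<in>stopping P n []. gibbs x y w * (fluctuation x y w)\<^sup>2)
      = \<sigma> * (\<Sum>w\<in>stopping P n []. gibbs x y w * real (length w))"
proof -
  define m where "m = drift x y"
  define \<sigma> where "\<sigma> = (\<Sum>i\<in>letters. gibbs x y [i] * (log_ratio [i] - m)\<^sup>2)"
  show ?thesis
  proof (rule that[of \<sigma>])
    show "0 \<le> \<sigma>" by (auto simp: \<sigma>_def gibbs_nonneg intro!: sum_nonneg mult_nonneg_nonneg)
    fix P n
    define F where "F w = gibbs x y w * ((fluctuation x y w)\<^sup>2 - \<sigma> * real (length w))" for w
    have "(\<Sum>w\<in>stopping P n []. F w) = F []"
    proof (rule sum_stopping)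
      fix u assume u: "set u \<subseteq> letters"
      define f g where "f = fluctuation x y u" and "g = (\<lambda>i. gibbs x y [i])"
      have one: "(\<Sum>i\<in>letters. g i) = 1" using phi by (simp add: phi_def g_def)
      have zero: "(\<Sum>i\<in>letters. g i * (log_ratio [i] - m)) = 0"
        using one by (simp add: m_def drift_def g_def right_diff_distrib sum_subtractf sum_distrib_right[symmetric])
      have "(\<Sum>i\<in>letters. F (i # u)) = (\<Sum>i\<in>letters. gibbs x y u * (g i * (log_ratio [i] - m)\<^sup>2
          + 2 * f * (g i * (log_ratio [i] - m)) + g i * (f\<^sup>2 - \<sigma> * (real (length u) + 1))))"
      proof (rule sum.cong[OF refl])
        fix i assume i: "i \<in> letters"
        have fl: "fluctuation x y (i # u) = f + (log_ratio [i] - m)"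
          unfolding fluctuation_def f_def log_ratio_Cons[OF u i] by (simp add: m_def algebra_simps)
        show "F (i # u) = gibbs x y u * (g i * (log_ratio [i] - m)\<^sup>2
          + 2 * f * (g i * (log_ratio [i] - m)) + g i * (f\<^sup>2 - \<sigma> * (real (length u) + 1)))"
          unfolding F_def gibbs_Cons[OF u i] fl power2_sum by (simp add: g_def algebra_simps)
      qed
      also have "\<dots> = gibbs x y u * (\<sigma> + 2 * f * 0 + 1 * (f\<^sup>2 - \<sigma> * (real (length u) + 1)))"
        unfolding sum_distrib_left[symmetric] sum.distrib sum_distrib_right[symmetric] zero one
        by (simp add: \<sigma>_def g_def)
      also have "\<dots> = F u" by (simp add: F_def f_def algebra_simps)
      finally show "F u = (\<Sum>i\<in>letters. F (i # u))" by simp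
    qed simp
    also have "F [] = 0" by (simp add: F_def fluctuation_def log_ratio_def scale_Nil)
    finally show "(\<Sum>w\<in>stopping P n []. gibbs x y w * (fluctuation x y w)\<^sup>2)
      = \<sigma> * (\<Sum>w\<in>stopping P n []. gibbs x y w * real (length w))"
      by (simp add: F_def right_diff_distrib sum_subtractf sum_distrib_left mult_ac)
  qed
qed

text \<open>The variance of the fluctuation at scale \<open>\<delta>\<close> is \<open>O(- ln \<delta>)\<close>, so its mean size is
  \<open>o(- ln \<delta>)\<close>: the inequality \<open>\<bar>t\<bar> \<le> \<eta> t\<^sup>2 + 1 / (4 \<eta>)\<close>, with \<open>\<eta>\<close> small in
  terms of \<open>e\<close>, makes this quantitative.\<close>

lemma gibbs_exp_fluctuation_ge:
  assumes phi: "phi x y = 1" and "0 \<le> \<kappa>" "0 < e"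
  obtains K where "0 < K" "\<And>\<delta>. 0 < \<delta> \<Longrightarrow> \<delta> < 1 \<Longrightarrow>
      K * \<delta> powr e \<le> (\<Sum>w\<in>flat_words \<delta>. gibbs x y w * exp (- (\<kappa> * \<bar>fluctuation x y w\<bar>)))"
proof -
  obtain \<sigma> where s: "0 \<le> \<sigma>" "\<And>P n. (\<Sum>w\<in>stopping P n []. gibbs x y w * (fluctuation x y w)\<^sup>2)
      = \<sigma> * (\<Sum>w\<in>stopping P n []. gibbs x y w * real (length w))"
    by (rule sum_gibbs_fluctuation_sq[OF phi]) blast
  define H where "H = - ln hi"
  have H: "0 < H" using lo_hi(3,4) by (simp add: H_def)
  define \<eta> where "\<eta> = e * H / (\<kappa> * \<sigma> + 1)"
  have ks: "0 \<le> \<kappa> * \<sigma>" using assms s by simp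
  then have \<eta>: "0 < \<eta>" using assms H by (simp add: \<eta>_def add_nonneg_pos)
  have \<eta>2: "\<kappa> * \<eta> * \<sigma> \<le> e * H"
  proof -
    have "\<kappa> * \<sigma> / (\<kappa> * \<sigma> + 1) \<le> 1" using ks by simp
    then have "e * H * (\<kappa> * \<sigma> / (\<kappa> * \<sigma> + 1)) \<le> e * H * 1" using assms H by (intro mult_left_mono) auto
    then show ?thesis by (simp add: \<eta>_def mult_ac)
  qed
  define C where "C = e * H + \<kappa> / (4 * \<eta>)"
  show ?thesis
  proof (rule that[of "exp (- C)"])
    fix \<delta> :: real assume d: "0 < \<delta>" "\<delta> < 1"
    let ?W = "flat_words \<delta>"
    let ?g = "gibbs x y" let ?f = "fluctuation x y"
    have one: "sum ?g ?W = 1" unfolding flat_words_def by (rule sum_gibbs[OF phi])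
    have amgm: "\<kappa> * \<bar>t\<bar> \<le> \<kappa> * \<eta> * t\<^sup>2 + \<kappa> / (4 * \<eta>)" for t :: real
    proof -
      have "0 \<le> (2 * \<eta> * \<bar>t\<bar> - 1)\<^sup>2 / (4 * \<eta>)" using \<eta> by simp
      also have "\<dots> = \<eta> * t\<^sup>2 + 1 / (4 * \<eta>) - \<bar>t\<bar>"
        using \<eta> by (simp add: power2_diff power_mult_distrib field_simps) (simp add: power2_eq_square)
      finally have "\<kappa> * \<bar>t\<bar> \<le> \<kappa> * (\<eta> * t\<^sup>2 + 1 / (4 * \<eta>))" using assms by (intro mult_left_mono) auto
      then show ?thesis by (simp add: algebra_simps)
    qed
    have "(\<Sum>w\<in>?W. ?g w * (\<kappa> * \<bar>?f w\<bar>)) \<le> (\<Sum>w\<in>?W. ?g w * (\<kappa> * \<eta> * (?f w)\<^sup>2 + \<kappa> / (4 * \<eta>)))"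
      using amgm gibbs_nonneg by (intro sum_mono mult_left_mono) auto
    also have "\<dots> = \<kappa> * \<eta> * (\<Sum>w\<in>?W. ?g w * (?f w)\<^sup>2) + \<kappa> / (4 * \<eta>)"
    proof -
      have "(\<Sum>w\<in>?W. ?g w * (\<kappa> * \<eta> * (?f w)\<^sup>2 + \<kappa> / (4 * \<eta>)))
          = \<kappa> * \<eta> * (\<Sum>w\<in>?W. ?g w * (?f w)\<^sup>2) + \<kappa> / (4 * \<eta>) * sum ?g ?W"
        by (simp add: distrib_left sum.distrib sum_distrib_left mult_ac)
      then show ?thesis using one by simp
    qed
    also have "(\<Sum>w\<in>?W. ?g w * (?f w)\<^sup>2) = \<sigma> * (\<Sum>w\<in>?W. ?g w * real (length w))"
      unfolding flat_words_def by (rule s(2))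
    also have "(\<Sum>w\<in>?W. ?g w * real (length w)) \<le> (\<Sum>w\<in>?W. ?g w * (ln \<delta> / ln hi + 1))"
      using flat_words(4)[OF d] gibbs_nonneg by (intro sum_mono mult_left_mono) auto
    also have "\<dots> = - ln \<delta> / H + 1"
      using one by (simp add: sum_distrib_right[symmetric] H_def)
    also have "\<kappa> * \<eta> * (\<sigma> * (- ln \<delta> / H + 1)) + \<kappa> / (4 * \<eta>) \<le> e * H * (- ln \<delta> / H + 1) + \<kappa> / (4 * \<eta>)"
    proof -
      have "0 \<le> - ln \<delta> / H" using d H by (intro divide_nonneg_pos) auto
      then have "0 \<le> - ln \<delta> / H + 1" by simp
      then show ?thesis using mult_right_mono[OF \<eta>2, of "- ln \<delta> / H + 1"] by (simp add: mult.assoc)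
    qed
    also have "\<dots> = C - e * ln \<delta>" using H by (simp add: C_def field_simps)
    finally have mean: "(\<Sum>w\<in>?W. ?g w * (\<kappa> * \<bar>?f w\<bar>)) \<le> C - e * ln \<delta>"
      using s(1) assms \<eta> by (simp add: mult_left_mono)
    have "exp (- C) * \<delta> powr e = exp (- (C - e * ln \<delta>))"
      using d by (simp add: powr_def exp_add[symmetric])
    also have "\<dots> \<le> exp (- (\<Sum>w\<in>?W. ?g w * (\<kappa> * \<bar>?f w\<bar>)))" using mean by simp
    also have "\<dots> \<le> (\<Sum>w\<in>?W. ?g w * exp (- (\<kappa> * \<bar>?f w\<bar>)))"
      using finite_flat_words gibbs_nonneg one by (intro exp_neg_mean_le) auto
    finally show "exp (- C) * \<delta> powr e \<le> (\<Sum>w\<in>?W. ?g w * exp (- (\<kappa> * \<bar>?f w\<bar>)))" .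
  qed simp
qed

definition major_term :: "real \<Rightarrow> nat list \<Rightarrow> real" where
  "major_term \<delta> w = weight w powr q * (scale (major w) w / \<delta>) powr tau (major w)"

definition coord :: "real \<Rightarrow> real \<Rightarrow> 2 \<Rightarrow> real" where
  "coord x y c = (if c = 1 then x else y)"

lemma major_term_eq:
  fixes x y :: real
  assumes d: "0 < \<delta>" "\<delta> < 1" and w: "w \<in> flat_words \<delta>"
  defines "c \<equiv> major w"
  shows "major_term \<delta> w = gibbs x y w * \<delta> powr (- (x + y))
    * ((scale c w / \<delta>) powr (tau c - coord x y c) * (height w / \<delta>) powr (- coord x y (minor w)))"
proof -
  have W: "set w \<subseteq> letters" by (rule flat_words(1)[OF d w])
  have pos: "0 < scale c w" for c by (rule scale_pos[OF W])
  have sum: "x + y = coord x y c + coord x y (minor w)"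
    by (auto simp: coord_def c_def major_def minor_def)
  have g: "gibbs x y w = weight w powr q * (scale c w powr coord x y c * height w powr coord x y (minor w))"
    unfolding scale_minor[symmetric] by (auto simp: gibbs_def coord_def c_def major_def minor_def)
  have "(scale c w / \<delta>) powr tau c = scale c w powr coord x y c * height w powr coord x y (minor w)
     * (\<delta> powr (- (x + y)) * ((scale c w / \<delta>) powr (tau c - coord x y c)
       * (height w / \<delta>) powr (- coord x y (minor w))))"
    using pos[of c] pos[of "minor w"] d unfolding sum scale_minor[symmetric]
    by (simp add: powr_def ln_div exp_add[symmetric] algebra_simps)
  then show ?thesis unfolding major_term_def g c_def[symmetric] by (simp add: mult_ac)
qed

lemma flat_ratio:
  assumes d: "0 < \<delta>" "\<delta> < 1" and w: "w \<in> flat_words \<delta>"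
  shows "lo \<le> height w / \<delta>" "height w / \<delta> \<le> 1" "lo \<le> scale (major w) w / \<delta>" "scale (major w) w / \<delta> \<le> 1 / \<delta>"
  using flat_words(1-3)[OF d w] d scale_le_1[OF flat_words(1)[OF d w]] scale_major[of w]
  by (auto simp: pos_le_divide_eq divide_right_mono)

lemma major_term_le:
  fixes x y :: real and c :: 2
  assumes "tau c \<le> coord x y c"
  obtains K where "0 < K" "\<And>\<delta> w. 0 < \<delta> \<Longrightarrow> \<delta> < 1 \<Longrightarrow> w \<in> flat_words \<delta> \<Longrightarrow> major w = c \<Longrightarrow>
      major_term \<delta> w \<le> K * (gibbs x y w * \<delta> powr (- (x + y)))"
proof -
  define k where "k = \<bar>x\<bar> + \<bar>y\<bar>"
  show ?thesis
  proof (rule that[of "lo powr (tau c - coord x y c) * lo powr (- k)"])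
    show "0 < lo powr (tau c - coord x y c) * lo powr (- k)" using lo_hi(1) by simp
    fix \<delta> :: real and w assume d: "0 < \<delta>" "\<delta> < 1" and w: "w \<in> flat_words \<delta>" and c: "major w = c"
    note r = flat_ratio[OF d w, unfolded c]
    have 1: "(scale c w / \<delta>) powr (tau c - coord x y c) \<le> lo powr (tau c - coord x y c)"
      using r lo_hi(1) assms by (intro powr_mono2') auto
    have "(height w / \<delta>) powr (- coord x y (minor w)) \<le> lo powr (- \<bar>- coord x y (minor w)\<bar>)"
      by (rule powr_between(2)[OF lo_hi(1) r(1,2)])
    also have "\<dots> \<le> lo powr (- k)"
      using lo_hi(1,2) by (intro powr_mono') (auto simp: coord_def k_def)
    finally have 2: "(height w / \<delta>) powr (- coord x y (minor w)) \<le> lo powr (- k)" .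
    have "major_term \<delta> w = gibbs x y w * \<delta> powr (- (x + y))
        * ((scale c w / \<delta>) powr (tau c - coord x y c) * (height w / \<delta>) powr (- coord x y (minor w)))"
      unfolding c[symmetric] by (rule major_term_eq[OF d w])
    also have "\<dots> \<le> gibbs x y w * \<delta> powr (- (x + y)) * (lo powr (tau c - coord x y c) * lo powr (- k))"
      using 1 2 gibbs_nonneg by (intro mult_left_mono mult_mono) auto
    finally show "major_term \<delta> w \<le> lo powr (tau c - coord x y c) * lo powr (- k) * (gibbs x y w * \<delta> powr (- (x + y)))"
      by (simp add: mult_ac)
  qed
qed

text \<open>If the coordinate of \<open>(x, y)\<close> in the major direction exceeds \<open>tau\<close>, the term is small for
  elongated cylinders. The assumptions say that the walk does not drift towards such cylinders;
  then the logarithm of the aspect ratio is at most the size of the fluctuation.\<close>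

lemma major_term_ge:
  fixes x y :: real
  assumes 1: "x \<le> tau 1 \<or> drift x y \<le> 0" and 2: "y \<le> tau 2 \<or> 0 \<le> drift x y"
  obtains K \<kappa> where "0 < K" "0 \<le> \<kappa>" "\<And>\<delta> w. 0 < \<delta> \<Longrightarrow> \<delta> < 1 \<Longrightarrow> w \<in> flat_words \<delta> \<Longrightarrow>
      K * (gibbs x y w * exp (- (\<kappa> * \<bar>fluctuation x y w\<bar>))) * \<delta> powr (- (x + y)) 
      \<le> major_term \<delta> w"
proof -
  define k where "k = \<bar>x\<bar> + \<bar>y\<bar>"
  define \<kappa> where "\<kappa> = \<bar>tau 1 - x\<bar> + \<bar>tau 2 - y\<bar>"
  show ?thesis
  proof (rule that[of "lo powr \<kappa> * lo powr k" \<kappa>])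
    show "0 < lo powr \<kappa> * lo powr k" using lo_hi(1) by simp
    show "0 \<le> \<kappa>" by (simp add: \<kappa>_def)
    fix \<delta> :: real and w assume d: "0 < \<delta>" "\<delta> < 1" and w: "w \<in> flat_words \<delta>"
    define c where "c = major w"
    define f where "f = exp (- (\<kappa> * \<bar>fluctuation x y w\<bar>))"
    have W: "set w \<subseteq> letters" by (rule flat_words(1)[OF d w])
    note r = flat_ratio[OF d w, folded c_def]
    have f: "0 \<le> f" "f \<le> 1" by (auto simp: f_def \<kappa>_def)
    have k1: "lo powr \<kappa> \<le> 1" using lo_hi(1,2) by (intro powr_le1) (auto simp: \<kappa>_def)
    have kc: "\<bar>tau c - coord x y c\<bar> \<le> \<kappa>" using exhaust_2[of c] by (auto simp: \<kappa>_def coord_def)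
    have A: "lo powr \<kappa> * f \<le> (scale c w / \<delta>) powr (tau c - coord x y c)"
    proof (cases "coord x y c \<le> tau c")
      case True
      have "lo powr \<kappa> * f \<le> lo powr \<kappa> * 1" using f by (intro mult_left_mono) auto
      also have "\<dots> \<le> lo powr (tau c - coord x y c)" using lo_hi(1,2) kc by (simp add: powr_mono')
      also have "\<dots> \<le> (scale c w / \<delta>) powr (tau c - coord x y c)"
        using True r lo_hi(1) by (intro powr_mono2) auto
      finally show ?thesis .
    next
      case False
      have h: "0 < height w" "0 < scale c w" using scale_pos[OF W] scale_minor[of w] by metis+
      have "ln (scale c w / height w) = (if c = 1 then log_ratio w else - log_ratio w)"
        using scale_pos[OF W, of 1] scale_pos[OF W, of 2] unfolding scale_minor[symmetric]
        by (auto simp: c_def major_def minor_def log_ratio_def ln_div)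
      also have "\<dots> \<le> \<bar>fluctuation x y w\<bar>"
      proof (cases "c = 1")
        case True
        then have "drift x y \<le> 0" using False 1 by (simp add: coord_def)
        then have "drift x y * real (length w) \<le> 0" by (simp add: mult_nonpos_nonneg)
        then show ?thesis using True by (simp add: fluctuation_def)
      next
        case c: False
        then have "c = 2" using exhaust_2[of c] by simp
        then have "0 \<le> drift x y" using False 2 by (simp add: coord_def)
        then have "0 \<le> drift x y * real (length w)" by simp
        then show ?thesis using c by (simp add: fluctuation_def)
      qed
      finally have l: "ln (scale c w / height w) \<le> \<bar>fluctuation x y w\<bar>" .
      have l0: "0 \<le> ln (scale c w / height w)" using h scale_major[of w] by (simp add: c_def)
      have "lo powr \<kappa> * f \<le> 1 * f" using f k1 by (intro mult_right_mono) auto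
      also have "f \<le> exp ((tau c - coord x y c) * ln (scale c w / height w))"
      proof -
        have "(coord x y c - tau c) * ln (scale c w / height w) \<le> \<kappa> * \<bar>fluctuation x y w\<bar>"
          using kc l l0 False by (intro mult_mono) auto
        then show ?thesis unfolding f_def by (simp add: algebra_simps)
      qed
      also have "\<dots> = (scale c w / height w) powr (tau c - coord x y c)"
        using h by (simp add: powr_def)
      also have "\<dots> \<le> (scale c w / \<delta>) powr (tau c - coord x y c)"
        using False h d flat_words(2)[OF d w] by (intro powr_mono2') (auto intro!: divide_left_mono)
      finally show ?thesis by simp
    qed
    have "lo powr k \<le> lo powr \<bar>- coord x y (minor w)\<bar>"
      using lo_hi(1,2) by (intro powr_mono') (auto simp: coord_def k_def)
    also have "\<dots> \<le> (height w / \<delta>) powr (- coord x y (minor w))"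
      by (rule powr_between(1)[OF lo_hi(1) r(1,2)])
    finally have B: "lo powr k \<le> (height w / \<delta>) powr (- coord x y (minor w))" .
    have "lo powr \<kappa> * lo powr k * (gibbs x y w * f) * \<delta> powr (- (x + y))
        = gibbs x y w * \<delta> powr (- (x + y)) * ((lo powr \<kappa> * f) * lo powr k)"
      by (simp add: mult_ac)
    also have "\<dots> \<le> gibbs x y w * \<delta> powr (- (x + y)) * ((scale c w / \<delta>) powr (tau c - coord x y c) * (height w / \<delta>) powr (- coord x y (minor w)))"
      using A B f gibbs_nonneg by (intro mult_left_mono mult_mono) auto
    also have "\<dots> = major_term \<delta> w" unfolding c_def by (rule major_term_eq[OF d w, symmetric])
    finally show "lo powr \<kappa> * lo powr k * (gibbs x y w * exp (- (\<kappa> * \<bar>fluctuation x y w\<bar>))) * \<delta> powr (- (x + y))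
        \<le> major_term \<delta> w"
      by (simp add: f_def)
  qed
qed

text \<open>Replacing each one-dimensional sum by its power law costs a factor between \<open>\<delta>\<^sup>e\<close> and
  \<open>\<delta>\<close> to the power \<open>- e\<close>, uniformly in the word: the rescaled mesh size \<open>\<delta> / \<alpha>\<close>
  stays between \<open>\<delta>\<close> and \<open>1 / lo\<close>.\<close>

lemma square_sum_bounds:
  assumes e: "0 < e"
  obtains C where "0 < C"
    "\<And>\<delta>. 0 < \<delta> \<Longrightarrow> \<delta> < 1 \<Longrightarrow> square_sum \<delta> \<le> C * (\<delta> powr (- e) * (\<Sum>w\<in>flat_words \<delta>. major_term \<delta> w))"
    "\<And>\<delta>. 0 < \<delta> \<Longrightarrow> \<delta> < 1 \<Longrightarrow> \<delta> powr e * (\<Sum>w\<in>flat_words \<delta>. major_term \<delta> w) \<le> C * square_sum \<delta>"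
proof -
  obtain C where C: "0 < C" "\<And>\<delta>. 0 < \<delta> \<Longrightarrow> \<delta> < 1 \<Longrightarrow> square_sum \<delta> \<le> C * word_sum \<delta>"
    "\<And>\<delta>. 0 < \<delta> \<Longrightarrow> \<delta> < 1 \<Longrightarrow> word_sum \<delta> \<le> C * square_sum \<delta>"
    by (rule square_sum_comparable) blast
  have "\<exists>K>0. \<forall>\<delta>. 0 < \<delta> \<and> \<delta> \<le> 1 / lo \<longrightarrow>
      strip_sum c \<delta> \<le> K * \<delta> powr (- tau c - e) \<and> \<delta> powr (- tau c + e) \<le> K * strip_sum c \<delta>" for c
  proof -
    have "0 < 1 / lo" using lo_hi(1) by simp
    then show ?thesis
      using exponent_bounds[OF tau[of c] e _ q_nonneg strip_sum_bounds[of _ c]] by metis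
  qed
  then obtain K where K: "\<And>c. 0 < K c"
    "\<And>c \<delta>. 0 < \<delta> \<Longrightarrow> \<delta> \<le> 1 / lo \<Longrightarrow> strip_sum c \<delta> \<le> K c * \<delta> powr (- tau c - e)"
    "\<And>c \<delta>. 0 < \<delta> \<Longrightarrow> \<delta> \<le> 1 / lo \<Longrightarrow> \<delta> powr (- tau c + e) \<le> K c * strip_sum c \<delta>" by metis
  define K0 where "K0 = K 1 + K 2"
  have K0: "0 < K0" "K c \<le> K0" for c
    using K(1)[of 1] K(1)[of 2] exhaust_2[of c] by (auto simp: K0_def)
  have piece: "strip_sum (major w) (\<delta> / scale (major w) w) \<le> K0 * \<delta> powr (- e) * (scale (major w) w / \<delta>) powr tau (major w)"
    "\<delta> powr e * (scale (major w) w / \<delta>) powr tau (major w) \<le> K0 * strip_sum (major w) (\<delta> / scale (major w) w)"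
    if d: "0 < \<delta>" "\<delta> < 1" and w: "w \<in> flat_words \<delta>" for \<delta> w
  proof -
    define c where "c = major w"
    define \<alpha> where "\<alpha> = scale c w"
    have a: "0 < \<alpha>" unfolding \<alpha>_def by (rule scale_pos[OF flat_words(1)[OF d w]])
    note r = flat_ratio[OF d w, folded c_def, folded \<alpha>_def]
    have da: "0 < \<delta> / \<alpha>" "\<delta> / \<alpha> \<le> 1 / lo" using r(3) a d lo_hi(1) by (auto simp: field_simps)
    have inv: "(\<delta> / \<alpha>) powr (- t) = (\<alpha> / \<delta>) powr t" for t
      using a d by (simp add: powr_minus_divide powr_divide)
    have "strip_sum c (\<delta> / \<alpha>) \<le> K c * (\<delta> / \<alpha>) powr (- tau c - e)" by (rule K(2)[OF da])
    also have "\<dots> = K c * ((\<alpha> / \<delta>) powr e * (\<alpha> / \<delta>) powr tau c)"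
      using inv[of "tau c + e"] by (simp add: powr_add mult_ac)
    also have "\<dots> \<le> K0 * (\<delta> powr (- e) * (\<alpha> / \<delta>) powr tau c)"
    proof (intro mult_mono)
      have "(\<alpha> / \<delta>) powr e \<le> (1 / \<delta>) powr e" using r a d e by (intro powr_mono2) auto
      then show "(\<alpha> / \<delta>) powr e \<le> \<delta> powr (- e)" using d by (simp add: powr_minus_divide powr_divide)
    qed (use K0 in \<open>auto simp: less_imp_le\<close>)
    finally show "strip_sum (major w) (\<delta> / scale (major w) w) \<le> K0 * \<delta> powr (- e) * (scale (major w) w / \<delta>) powr tau (major w)"
      by (simp add: c_def \<alpha>_def mult.assoc)
    have "\<delta> powr e * (\<alpha> / \<delta>) powr tau c \<le> (\<delta> / \<alpha>) powr e * (\<alpha> / \<delta>) powr tau c"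
    proof (intro mult_right_mono powr_mono2)
      have "\<alpha> \<le> 1" unfolding \<alpha>_def by (rule scale_le_1[OF flat_words(1)[OF d w]])
      then show "\<delta> \<le> \<delta> / \<alpha>" using a d by (simp add: pos_le_divide_eq mult_left_le)
    qed (use e d in auto)
    also have "\<dots> = (\<delta> / \<alpha>) powr (- tau c + e)" by (simp add: inv[symmetric] powr_add[symmetric] add.commute)
    also have "\<dots> \<le> K c * strip_sum c (\<delta> / \<alpha>)" by (rule K(3)[OF da])
    also have "\<dots> \<le> K0 * strip_sum c (\<delta> / \<alpha>)"
      using K0 strip_sum_pos[OF da(1), of c] by (intro mult_right_mono) auto
    finally show "\<delta> powr e * (scale (major w) w / \<delta>) powr tau (major w) \<le> K0 * strip_sum (major w) (\<delta> / scale (major w) w)"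
      by (simp add: c_def \<alpha>_def)
  qed
  define M where "M \<delta> = (\<Sum>w\<in>flat_words \<delta>. major_term \<delta> w)" for \<delta>
  have word: "word_sum \<delta> \<le> K0 * (\<delta> powr (- e) * M \<delta>)" "\<delta> powr e * M \<delta> \<le> K0 * word_sum \<delta>"
    if d: "0 < \<delta>" "\<delta> < 1" for \<delta>
  proof -
    have "word_sum \<delta> \<le> (\<Sum>w\<in>flat_words \<delta>. weight w powr q
        * (K0 * \<delta> powr (- e) * (scale (major w) w / \<delta>) powr tau (major w)))"
      unfolding word_sum_def using piece(1)[OF d] by (intro sum_mono mult_left_mono) auto
    also have "\<dots> = K0 * (\<delta> powr (- e) * M \<delta>)"
      by (simp add: M_def major_term_def sum_distrib_left mult_ac)
    finally show "word_sum \<delta> \<le> K0 * (\<delta> powr (- e) * M \<delta>)" .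
    have "\<delta> powr e * M \<delta> = (\<Sum>w\<in>flat_words \<delta>. weight w powr q
        * (\<delta> powr e * (scale (major w) w / \<delta>) powr tau (major w)))"
      by (simp add: M_def major_term_def sum_distrib_left mult_ac)
    also have "\<dots> \<le> (\<Sum>w\<in>flat_words \<delta>. weight w powr q
        * (K0 * strip_sum (major w) (\<delta> / scale (major w) w)))"
      using piece(2)[OF d] by (intro sum_mono mult_left_mono) auto
    also have "\<dots> = K0 * word_sum \<delta>"
      by (simp add: word_sum_def sum_distrib_left mult_ac)
    finally show "\<delta> powr e * M \<delta> \<le> K0 * word_sum \<delta>" .
  qed
  show ?thesis
  proof (rule that[of "C * K0", folded M_def])
    show "0 < C * K0" using C K0(1) by simp
    fix \<delta> :: real assume d: "0 < \<delta>" "\<delta> < 1"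
    show "square_sum \<delta> \<le> C * K0 * (\<delta> powr (- e) * M \<delta>)"
      using order_trans[OF C(2)[OF d] mult_left_mono[OF word(1)[OF d]]] C(1) by (simp add: mult.assoc)
    show "\<delta> powr e * M \<delta> \<le> C * K0 * square_sum \<delta>"
      using order_trans[OF word(2)[OF d] mult_left_mono[OF C(3)[OF d]]] K0(1) by (simp add: mult_ac)
  qed
qed

lemma square_sum_pos:
  assumes d: "0 < \<delta>" "\<delta> < 1"
  shows "0 < square_sum \<delta>"
proof -
  have "flat_words \<delta> \<noteq> {}"
    using measure_stopping[of UNIV "\<lambda>w. height w \<le> \<delta>" "nat \<lceil>ln \<delta> / ln hi\<rceil>"]
    by (auto simp: flat_words_def)
  moreover have "0 < weight w powr q * strip_sum (major w) (\<delta> / scale (major w) w)"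
    if w: "w \<in> flat_words \<delta>" for w
    using weight_pos[OF flat_words(1)[OF d w]] scale_pos[OF flat_words(1)[OF d w]] d
    by (intro mult_pos_pos strip_sum_pos divide_pos_pos) auto
  ultimately have "0 < word_sum \<delta>"
    unfolding word_sum_def using finite_flat_words by (intro sum_pos) auto
  moreover obtain C where "0 < C" "word_sum \<delta> \<le> C * square_sum \<delta>"
    using square_sum_comparable d by metis
  ultimately show ?thesis by (smt (verit) mult_nonneg_nonpos)
qed

text \<open>Bounds for the limit superior and the limit inferior of the exponents, stated before any limit
  is known to exist.\<close>

definition growth_le :: "real \<Rightarrow> bool" where
  "growth_le s \<longleftrightarrow> (\<forall>e>0. \<forall>\<^sub>F \<delta> in at_right 0. ln (square_sum \<delta>) / (- ln \<delta>) < s + e)"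

definition growth_ge :: "real \<Rightarrow> bool" where
  "growth_ge s \<longleftrightarrow> (\<forall>e>0. \<forall>\<^sub>F \<delta> in at_right 0. s - e < ln (square_sum \<delta>) / (- ln \<delta>))"

text \<open>Cylinders with major direction \<open>1\<close> are controlled by one point of the curve and those with
  major direction \<open>2\<close> by another. The two points may coincide.\<close>

theorem growth_leI:
  assumes 1: "phi x1 y1 = 1" "tau 1 \<le> x1" "x1 + y1 \<le> s"
    and 2: "phi x2 y2 = 1" "tau 2 \<le> y2" "x2 + y2 \<le> s"
  shows "growth_le s"
  unfolding growth_le_def
proof (intro allI impI)
  fix e0 :: real assume "0 < e0"
  define e where "e = e0 / 2"
  have e: "0 < e" "2 * e = e0" using \<open>0 < e0\<close> by (simp_all add: e_def)
  obtain C where C: "0 < C" "\<And>\<delta>. 0 < \<delta> \<Longrightarrow> \<delta> < 1 \<Longrightarrow>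
      square_sum \<delta> \<le> C * (\<delta> powr (- e) * (\<Sum>w\<in>flat_words \<delta>. major_term \<delta> w))"
    by (rule square_sum_bounds[OF e(1)]) blast
  obtain A1 where A1: "0 < A1" "\<And>\<delta> w. 0 < \<delta> \<Longrightarrow> \<delta> < 1 \<Longrightarrow> w \<in> flat_words \<delta> \<Longrightarrow> major w = 1 \<Longrightarrow>
      major_term \<delta> w \<le> A1 * (gibbs x1 y1 w * \<delta> powr (- (x1 + y1)))"
    using major_term_le[of 1 x1 y1] 1 by (auto simp: coord_def)
  obtain A2 where A2: "0 < A2" "\<And>\<delta> w. 0 < \<delta> \<Longrightarrow> \<delta> < 1 \<Longrightarrow> w \<in> flat_words \<delta> \<Longrightarrow> major w = 2 \<Longrightarrow>
      major_term \<delta> w \<le> A2 * (gibbs x2 y2 w * \<delta> powr (- (x2 + y2)))"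
    using major_term_le[of 2 x2 y2] 2 by (auto simp: coord_def)
  have "square_sum \<delta> \<le> C * (A1 + A2) * \<delta> powr (- s - e)" if d: "0 < \<delta>" "\<delta> < 1" for \<delta>
  proof -
    define U where "U w = A1 * (gibbs x1 y1 w * \<delta> powr (- s))" for w
    define V where "V w = A2 * (gibbs x2 y2 w * \<delta> powr (- s))" for w
    have "major_term \<delta> w \<le> U w + V w" if w: "w \<in> flat_words \<delta>" for w
    proof -
      have "A1 * (gibbs x1 y1 w * \<delta> powr (- (x1 + y1))) \<le> U w"
        "A2 * (gibbs x2 y2 w * \<delta> powr (- (x2 + y2))) \<le> V w"
        unfolding U_def V_def using A1(1) A2(1) 1(3) 2(3) d gibbs_nonneg
        by (auto intro!: mult_left_mono powr_mono')
      moreover have "0 \<le> U w" "0 \<le> V w"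
        unfolding U_def V_def using A1(1) A2(1) gibbs_nonneg by auto
      ultimately show ?thesis
        using A1(2)[OF d w] A2(2)[OF d w] exhaust_2[of "major w"] by linarith
    qed
    then have "(\<Sum>w\<in>flat_words \<delta>. major_term \<delta> w) \<le> (\<Sum>w\<in>flat_words \<delta>. U w + V w)"
      by (rule sum_mono)
    also have "\<dots> = A1 * (sum (gibbs x1 y1) (flat_words \<delta>) * \<delta> powr (- s))
        + A2 * (sum (gibbs x2 y2) (flat_words \<delta>) * \<delta> powr (- s))"
      by (simp add: U_def V_def sum.distrib sum_distrib_left sum_distrib_right)
    also have "\<dots> = (A1 + A2) * \<delta> powr (- s)"
      unfolding flat_words_def sum_gibbs[OF 1(1)] sum_gibbs[OF 2(1)] by (simp add: algebra_simps)
    finally have "C * (\<delta> powr (- e) * (\<Sum>w\<in>flat_words \<delta>. major_term \<delta> w))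
        \<le> C * (\<delta> powr (- e) * ((A1 + A2) * \<delta> powr (- s)))"
      using C(1) by (intro mult_left_mono) auto
    also have "\<dots> = C * (A1 + A2) * (\<delta> powr (- e) * \<delta> powr (- s))" by (simp add: mult_ac)
    also have "\<delta> powr (- e) * \<delta> powr (- s) = \<delta> powr (- s - e)"
      unfolding powr_add[symmetric] by (rule arg_cong[where f = "\<lambda>t. \<delta> powr t"]) simp
    finally show ?thesis using C(2)[OF d] by linarith
  qed
  moreover have "0 < C * (A1 + A2)" using C(1) A1(1) A2(1) by simp
  ultimately show "\<forall>\<^sub>F \<delta> in at_right 0. ln (square_sum \<delta>) / (- ln \<delta>) < s + e0"
    unfolding e(2)[symmetric] using e(1) square_sum_pos by (intro exponent_less) auto
qed

theorem growth_geI: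
  assumes phi: "phi x y = 1"
    and 1: "x \<le> tau 1 \<or> drift x y \<le> 0" and 2: "y \<le> tau 2 \<or> 0 \<le> drift x y"
  shows "growth_ge (x + y)"
  unfolding growth_ge_def
proof (intro allI impI)
  fix e0 :: real assume "0 < e0"
  define e where "e = e0 / 4"
  have e: "0 < e" "2 * (2 * e) = e0" using \<open>0 < e0\<close> by (simp_all add: e_def)
  obtain C where C: "0 < C" "\<And>\<delta>. 0 < \<delta> \<Longrightarrow> \<delta> < 1 \<Longrightarrow>
      \<delta> powr e * (\<Sum>w\<in>flat_words \<delta>. major_term \<delta> w) \<le> C * square_sum \<delta>"
    by (rule square_sum_bounds[OF e(1)]) blast
  obtain B \<kappa> where B: "0 < B" "0 \<le> \<kappa>" "\<And>\<delta> w. 0 < \<delta> \<Longrightarrow> \<delta> < 1 \<Longrightarrow> w \<in> flat_words \<delta> \<Longrightarrow>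
      B * (gibbs x y w * exp (- (\<kappa> * \<bar>fluctuation x y w\<bar>))) * \<delta> powr (- (x + y)) \<le> major_term \<delta> w"
    by (rule major_term_ge[OF 1 2]) blast
  obtain G where G: "0 < G" "\<And>\<delta>. 0 < \<delta> \<Longrightarrow> \<delta> < 1 \<Longrightarrow>
      G * \<delta> powr e \<le> (\<Sum>w\<in>flat_words \<delta>. gibbs x y w * exp (- (\<kappa> * \<bar>fluctuation x y w\<bar>)))"
    by (rule gibbs_exp_fluctuation_ge[OF phi B(2) e(1)]) blast
  have "\<delta> powr (- (x + y) + 2 * e) \<le> C / (B * G) * square_sum \<delta>" if d: "0 < \<delta>" "\<delta> < 1" for \<delta>
  proof -
    let ?s = "\<delta> powr (- (x + y))"
    let ?g = "\<lambda>w. gibbs x y w * exp (- (\<kappa> * \<bar>fluctuation x y w\<bar>))"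
    have "\<delta> powr e * (B * (G * \<delta> powr e) * ?s) \<le> \<delta> powr e * (B * (\<Sum>w\<in>flat_words \<delta>. ?g w) * ?s)"
      using G(2)[OF d] B by (intro mult_left_mono mult_right_mono) auto
    also have "B * (\<Sum>w\<in>flat_words \<delta>. ?g w) * ?s = (\<Sum>w\<in>flat_words \<delta>. B * ?g w * ?s)"
      by (simp add: sum_distrib_left sum_distrib_right)
    also have "\<delta> powr e * \<dots> \<le> \<delta> powr e * (\<Sum>w\<in>flat_words \<delta>. major_term \<delta> w)"
      using B(3)[OF d] by (intro mult_left_mono sum_mono) auto
    also have "\<dots> \<le> C * square_sum \<delta>" by (rule C(2)[OF d])
    finally have "B * G * (\<delta> powr e * \<delta> powr e * ?s) \<le> C * square_sum \<delta>" by (simp add: mult_ac)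
    moreover have "\<delta> powr e * \<delta> powr e * ?s = \<delta> powr (- (x + y) + 2 * e)"
      unfolding powr_add[symmetric] by (rule arg_cong[where f = "\<lambda>t. \<delta> powr t"]) simp
    ultimately show ?thesis using B(1) G(1) by (simp add: pos_le_divide_eq mult_ac)
  qed
  moreover have "0 < C / (B * G)" using B(1) G(1) C(1) by simp
  ultimately show "\<forall>\<^sub>F \<delta> in at_right 0. x + y - e0 < ln (square_sum \<delta>) / (- ln \<delta>)"
    unfolding e(2)[symmetric] using e(1) square_sum_pos by (intro exponent_greater) auto
qed

lemma growth_ge_le:
  assumes "growth_ge s" "growth_le s'"
  shows "s \<le> s'"
proof (rule ccontr)
  assume "\<not> s \<le> s'"
  define e where "e = (s - s') / 2"
  have e: "0 < e" "s - e = s' + e" using \<open>\<not> s \<le> s'\<close> by (auto simp: e_def field_simps)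
  have "\<forall>\<^sub>F \<delta> in at_right 0. s - e < ln (square_sum \<delta>) / (- ln \<delta>)"
    "\<forall>\<^sub>F \<delta> in at_right 0. ln (square_sum \<delta>) / (- ln \<delta>) < s' + e"
    using assms e(1) unfolding growth_ge_def growth_le_def by auto
  then have "\<forall>\<^sub>F \<delta>::real in at_right 0. False"
    by eventually_elim (use e(2) in linarith)
  then show False by simp
qed

lemma growth_limit:
  assumes "growth_ge s" "growth_le s"
  shows "((\<lambda>\<delta>. ln (square_sum \<delta>) / (- ln \<delta>)) \<longlongrightarrow> s) (at_right 0)"
proof (rule order_tendstoI)
  fix a assume "a < s"
  then show "\<forall>\<^sub>F \<delta> in at_right 0. a < ln (square_sum \<delta>) / (- ln \<delta>)"
    using assms(1)[unfolded growth_ge_def, rule_format, of "s - a"] by simp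
next
  fix a assume "s < a"
  then show "\<forall>\<^sub>F \<delta> in at_right 0. ln (square_sum \<delta>) / (- ln \<delta>) < a"
    using assms(2)[unfolded growth_le_def, rule_format, of "a - s"] by simp
qed

end

section \<open>The curve of unit weight\<close>

lemma ex1_powr_sum_eq_1:
  fixes w b :: "'i \<Rightarrow> real"
  assumes S: "finite S" "S \<noteq> {}" and w: "\<And>i. i \<in> S \<Longrightarrow> 0 < w i"
    and b: "\<And>i. i \<in> S \<Longrightarrow> 0 < b i" "\<And>i. i \<in> S \<Longrightarrow> b i < 1"
  shows "\<exists>!y. (\<Sum>i\<in>S. w i * b i powr y) = 1"
proof -
  define F where "F y = (\<Sum>i\<in>S. w i * b i powr y)" for y
  have anti: "F y' < F y" if "y < y'" for y y'
    unfolding F_def using S w b that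
    by (intro sum_strict_mono mult_strict_left_mono powr_less_mono') auto
  have cont: "continuous_on X F" for X
  proof -
    have "b i \<noteq> 0" if "i \<in> S" for i using b(1)[OF that] by simp
    then show ?thesis unfolding F_def by (intro continuous_intros) blast+
  qed
  define h where "h = Max (b ` S)"
  have "h \<in> b ` S" unfolding h_def using S by (intro Max_in) auto
  then have h: "0 < h" "h < 1" using b by auto
  have bh: "b i \<le> h" if "i \<in> S" for i unfolding h_def using S that by simp
  have "0 < w i * b i powr 0" if "i \<in> S" for i using w[OF that] b(1)[OF that] by simp
  then have F0: "0 < F 0" unfolding F_def by (rule sum_pos[OF S])
  have FW: "F 0 = sum w S"
    unfolding F_def by (rule sum.cong[OF refl]) (use b(1) in force)
  define Y where "Y = \<bar>ln (F 0)\<bar> / (- ln h)"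
  have "0 < - ln h" using h by simp
  then have Y: "0 \<le> Y" unfolding Y_def by (intro divide_nonneg_pos) auto
  have hY: "h powr Y = exp (- \<bar>ln (F 0)\<bar>)" "h powr (- Y) = exp \<bar>ln (F 0)\<bar>"
    using h by (simp_all add: powr_def Y_def)
  have "F Y \<le> (\<Sum>i\<in>S. w i * h powr Y)"
    unfolding F_def using w b bh Y by (intro sum_mono mult_left_mono powr_mono2) (auto simp: less_imp_le)
  also have "\<dots> = F 0 * exp (- \<bar>ln (F 0)\<bar>)"
    by (simp add: FW hY sum_distrib_right)
  also have "\<dots> \<le> exp (ln (F 0)) * exp (- \<bar>ln (F 0)\<bar>)" using F0 by simp
  also have "\<dots> \<le> 1" by (simp add: exp_add[symmetric])
  finally have up: "F Y \<le> 1" .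
  have "1 \<le> exp (ln (F 0)) * exp \<bar>ln (F 0)\<bar>" by (simp add: exp_add[symmetric])
  also have "\<dots> = F 0 * exp \<bar>ln (F 0)\<bar>" using F0 by simp
  also have "\<dots> = (\<Sum>i\<in>S. w i * h powr (- Y))"
    by (simp add: FW hY sum_distrib_right)
  also have "\<dots> \<le> F (- Y)"
    unfolding F_def using w b bh Y by (intro sum_mono mult_left_mono powr_mono2') (auto simp: less_imp_le)
  finally have low: "1 \<le> F (- Y)" .
  obtain y where "F y = 1" using IVT2'[of F Y 1 "- Y"] up low Y cont by auto
  moreover have "y = y'" if "F y = 1" "F y' = 1" for y y'
    using anti[of y y'] anti[of y' y] that by (cases y y' rule: linorder_cases) auto
  ultimately show ?thesis unfolding F_def by blast
qed

lemma exp_gt_tangent: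
  fixes t :: real
  assumes "t \<noteq> 0"
  shows "1 + t < exp t"
proof (cases "- 2 < t")
  case True
  have "(1 + t / 2)\<^sup>2 = 1 + t + t\<^sup>2 / 4" by (simp add: power2_eq_square field_simps)
  then have "1 + t < (1 + t / 2)\<^sup>2" using assms by simp
  also have "\<dots> \<le> (exp (t / 2))\<^sup>2"
    using True exp_ge_add_one_self[of "t / 2"] by (intro power_mono) auto
  also have "\<dots> = exp t" by (simp add: power2_eq_square exp_add[symmetric])
  finally show ?thesis .
next
  case False
  then show ?thesis using exp_gt_zero[of t] by linarith
qed

context diagonal_self_affine
begin

lemma phi_eq: "phi x y = (\<Sum>i\<in>letters. p i powr q * \<bar>T i $ 1 $ 1\<bar> powr x * \<bar>T i $ 2 $ 2\<bar> powr y)"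
  by (simp add: phi_def gibbs_def weight_Cons weight_Nil scale_Cons scale_Nil)

lemma drift_eq: "drift x y = (\<Sum>i\<in>letters. p i powr q * \<bar>T i $ 1 $ 1\<bar> powr x * \<bar>T i $ 2 $ 2\<bar> powr y
    * (ln \<bar>T i $ 1 $ 1\<bar> - ln \<bar>T i $ 2 $ 2\<bar>))"
  by (simp add: drift_def gibbs_def log_ratio_def weight_Cons weight_Nil scale_Cons scale_Nil)

lemma gibbs_letter_pos: "i \<in> letters \<Longrightarrow> 0 < gibbs x y [i]"
  using p_pos[of i] contracting[of i 1] contracting[of i 2]
  by (auto simp: gibbs_def weight_Cons weight_Nil scale_Cons scale_Nil)

lemma phi_less:
  assumes "x \<le> x'" "y \<le> y'" "x \<noteq> x' \<or> y \<noteq> y'"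
  shows "phi x' y' < phi x y"
proof -
  have 1: "phi x' y < phi x y" if "x < x'" for x x' y
    unfolding phi_eq
  proof (rule sum_strict_mono)
    fix i assume i: "i \<in> letters"
    show "p i powr q * \<bar>T i $ 1 $ 1\<bar> powr x' * \<bar>T i $ 2 $ 2\<bar> powr y
        < p i powr q * \<bar>T i $ 1 $ 1\<bar> powr x * \<bar>T i $ 2 $ 2\<bar> powr y"
      using p_pos[OF i] contracting[OF i, of 1] contracting[OF i, of 2] that
      by (intro mult_strict_right_mono mult_strict_left_mono powr_less_mono') auto
  qed (use letters_nonempty in simp_all)
  have 2: "phi x y' < phi x y" if "y < y'" for x y y'
    unfolding phi_eq
  proof (rule sum_strict_mono)
    fix i assume i: "i \<in> letters"
    show "p i powr q * \<bar>T i $ 1 $ 1\<bar> powr x * \<bar>T i $ 2 $ 2\<bar> powr y'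
        < p i powr q * \<bar>T i $ 1 $ 1\<bar> powr x * \<bar>T i $ 2 $ 2\<bar> powr y"
      using p_pos[OF i] contracting[OF i, of 1] contracting[OF i, of 2] that
      by (intro mult_strict_left_mono powr_less_mono') auto
  qed (use letters_nonempty in simp_all)
  have "phi x' y \<le> phi x y" "phi x' y' \<le> phi x' y"
    using assms 1[of x x' y] 2[of y y' x'] by (auto simp: le_less)
  moreover have "phi x' y < phi x y \<or> phi x' y' < phi x' y"
    using assms 1[of x x' y] 2[of y y' x'] by (auto simp: le_less)
  ultimately show ?thesis by linarith
qed

lemma phi_curve_antimono:
  assumes "phi x y = phi x' y'"
  shows "x \<le> x' \<longleftrightarrow> y' \<le> y"
proof
  assume "x \<le> x'"
  then show "y' \<le> y" using assms phi_less[of x x' y y'] by (cases "y' \<le> y") auto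
next
  assume "y' \<le> y"
  then show "x \<le> x'" using assms phi_less[of x' x y' y] by (cases "x \<le> x'") auto
qed

lemma ex1_phi: "\<exists>!y. phi x y = 1" "\<exists>!x. phi x y = 1"
proof -
  have c: "0 < \<bar>T i $ c $ c\<bar>" "\<bar>T i $ c $ c\<bar> < 1" if "i \<in> letters" for i c using contracting[OF that, of c] by auto
  have pos: "0 < p i powr q * \<bar>T i $ 1 $ 1\<bar> powr x" "0 < p i powr q * \<bar>T i $ 2 $ 2\<bar> powr y" if "i \<in> letters" for i
    using p_pos[OF that] contracting[OF that, of 1] contracting[OF that, of 2] by auto
  show "\<exists>!y. phi x y = 1" unfolding phi_eq
    by (rule ex1_powr_sum_eq_1[OF finite_atLeastAtMost letters_nonempty pos(1) c(1)[of _ 2] c(2)[of _ 2]])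
  have "phi x y = (\<Sum>i\<in>letters. (p i powr q * \<bar>T i $ 2 $ 2\<bar> powr y) * \<bar>T i $ 1 $ 1\<bar> powr x)" for x
    by (simp add: phi_eq mult_ac)
  then show "\<exists>!x. phi x y = 1"
    using ex1_powr_sum_eq_1[OF finite_atLeastAtMost letters_nonempty pos(2) c(1)[of _ 1] c(2)[of _ 1]] by simp
qed

definition curve :: "real \<Rightarrow> real" where
  "curve x = (THE y. phi x y = 1)"

lemma phi_curve: "phi x (curve x) = 1"
  unfolding curve_def by (rule theI'[OF ex1_phi(1)])

lemma curve_eqI: "phi x y = 1 \<Longrightarrow> curve x = y"
  using ex1_phi(1)[of x] phi_curve[of x] by blast

text \<open>The slope \<open>ln lo / ln hi\<close> is steep enough that moving along it multiplies every summand of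
  \<open>phi\<close> by at least \<open>1\<close>, since \<open>hi\<close> to this power is \<open>lo\<close>.\<close>

lemma curve_lipschitz:
  assumes "x \<le> x'"
  shows "curve x' \<le> curve x" "curve x - ln lo / ln hi * (x' - x) \<le> curve x'"
proof -
  show "curve x' \<le> curve x" using phi_curve_antimono[of x "curve x" x' "curve x'"] assms phi_curve by simp
  define L h where "L = ln lo / ln hi" and "h = x' - x"
  have h: "0 \<le> h" using assms by (simp add: h_def)
  have L: "0 \<le> L" using lo_hi(1-4) by (simp add: L_def divide_nonpos_neg)
  have "phi x (curve x) \<le> phi x' (curve x - L * h)"
    unfolding phi_eq
  proof (rule sum_mono)
    fix i assume i: "i \<in> letters"
    define A B where "A = \<bar>T i $ 1 $ 1\<bar>" and "B = \<bar>T i $ 2 $ 2\<bar>"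
    have AB: "lo \<le> A" "0 < A" "0 < B" "B \<le> hi"
      using lo_le[OF i, of 1] le_hi[OF i, of 2] contracting[OF i, of 1] contracting[OF i, of 2] by (auto simp: A_def B_def)
    have "L * ln B \<le> L * ln hi" using AB L lo_hi(3) by (intro mult_left_mono) auto
    also have "\<dots> = ln lo" using lo_hi(3,4) by (simp add: L_def)
    also have "\<dots> \<le> ln A" using AB lo_hi(1) by simp
    finally have "h * (L * ln B) \<le> h * ln A" using h by (rule mult_left_mono)
    then have e: "1 \<le> exp (h * ln A - L * h * ln B)" by (simp add: mult_ac)
    have "p i powr q * A powr x * B powr curve x * 1 \<le> p i powr q * A powr x * B powr curve x * exp (h * ln A - L * h * ln B)"
      using e by (intro mult_left_mono) auto
    also have "\<dots> = p i powr q * A powr x' * B powr (curve x - L * h)"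
      using AB by (simp add: powr_def exp_add[symmetric] h_def algebra_simps)
    finally show "p i powr q * \<bar>T i $ 1 $ 1\<bar> powr x * \<bar>T i $ 2 $ 2\<bar> powr curve x
        \<le> p i powr q * \<bar>T i $ 1 $ 1\<bar> powr x' * \<bar>T i $ 2 $ 2\<bar> powr (curve x - L * h)"
      by (simp add: A_def B_def)
  qed
  then have "phi x' (curve x') \<le> phi x' (curve x - L * h)" by (simp add: phi_curve)
  then show "curve x - ln lo / ln hi * (x' - x) \<le> curve x'"
    using phi_less[of x' x' "curve x'" "curve x - L * h"] by (fastforce simp: L_def h_def)
qed

lemma continuous_curve: "continuous_on X curve"
proof -
  define L where "L = ln lo / ln hi"
  have L: "0 \<le> L" using lo_hi(1-4) by (simp add: L_def divide_nonpos_neg)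
  have "L-lipschitz_on UNIV curve"
  proof (rule lipschitz_onI[OF _ L])
    fix x x' :: real
    have "\<bar>curve x - curve x'\<bar> \<le> L * \<bar>x - x'\<bar>" if "x \<le> x'" for x x'
      using curve_lipschitz[OF that] that by (simp add: L_def)
    then show "dist (curve x) (curve x') \<le> L * dist x x'"
      unfolding dist_real_def by (metis abs_minus_commute linear)
  qed
  then show ?thesis using lipschitz_on_continuous_on continuous_on_subset by blast
qed

lemma drift_zero_between:
  assumes "x1 \<le> x2" "drift x1 (curve x1) \<le> 0" "0 \<le> drift x2 (curve x2)"
  obtains x where "x1 \<le> x" "x \<le> x2" "drift x (curve x) = 0"
proof -
  have nz: "\<bar>T i $ c $ c\<bar> \<noteq> 0" if "i \<in> letters" for i c using contracting[OF that, of c] by auto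
  have "continuous_on {x1..x2} (\<lambda>x. drift x (curve x))"
    unfolding drift_eq using nz continuous_curve by (intro continuous_intros) auto
  then show ?thesis using IVT'[of "\<lambda>x. drift x (curve x)" x1 0 x2] assms that by auto
qed

text \<open>On the line \<open>x' + y' = x + y\<close> the function \<open>phi\<close> is a sum of exponentials, hence convex, and
  \<open>drift\<close> is its derivative along the line. A drift that vanishes at one point and not at
  another excludes that \<open>phi\<close> is constant, and a zero of the drift is then a strict minimum.\<close>

lemma phi_gt_tangent:
  assumes "phi x y = 1" "drift x y = 0" "x' + y' = x + y" "drift x' y' \<noteq> 0"
  shows "1 < phi x' y'"
proof -
  define t where "t = x' - x"
  have y': "y' - y = - t" using assms(3) by (simp add: t_def)
  have eq: "gibbs x' y' [i] = gibbs x y [i] * exp (t * log_ratio [i])" if i: "i \<in> letters" for i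
  proof -
    have "x' = x + t" "y = y' + t" using y' by (auto simp: t_def)
    then show ?thesis
      using contracting[OF i, of 1] contracting[OF i, of 2]
      by (simp add: gibbs_def log_ratio_def scale_Cons scale_Nil powr_def exp_add[symmetric] algebra_simps)
  qed
  have "t \<noteq> 0" using assms y' by (auto simp: t_def)
  have "\<exists>i\<in>letters. log_ratio [i] \<noteq> 0"
  proof (rule ccontr)
    assume "\<not> ?thesis"
    then have "drift x' y' = 0" unfolding drift_def by (intro sum.neutral) auto
    then show False using assms(4) by simp
  qed
  then obtain j where j: "j \<in> letters" "log_ratio [j] \<noteq> 0" by blast
  have "1 = (\<Sum>i\<in>letters. gibbs x y [i] * (1 + t * log_ratio [i]))"
  proof -
    have "(\<Sum>i\<in>letters. gibbs x y [i] * (1 + t * log_ratio [i])) = phi x y + t * drift x y"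
      by (simp only: phi_def drift_def sum_distrib_left distrib_left sum.distrib) (simp add: mult_ac)
    then show ?thesis using assms by simp
  qed
  also have "\<dots> < (\<Sum>i\<in>letters. gibbs x y [i] * exp (t * log_ratio [i]))"
  proof (rule sum_strict_mono_ex1)
    show "\<forall>i\<in>letters. gibbs x y [i] * (1 + t * log_ratio [i]) \<le> gibbs x y [i] * exp (t * log_ratio [i])"
      using gibbs_nonneg exp_ge_add_one_self by (auto intro!: mult_left_mono)
    show "\<exists>i\<in>letters. gibbs x y [i] * (1 + t * log_ratio [i]) < gibbs x y [i] * exp (t * log_ratio [i])"
      using j gibbs_letter_pos[OF j(1)] exp_gt_tangent[of "t * log_ratio [j]"] \<open>t \<noteq> 0\<close>
      by (intro bexI[of _ j] mult_strict_left_mono) auto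
  qed simp
  also have "\<dots> = phi x' y'" by (simp add: phi_def eq)
  finally show ?thesis .
qed

end

section \<open>The spectrum as a growth exponent\<close>

lemma Lq_sum_reindex:
  assumes mesh: "mesh \<delta> = range f" and "inj f" "finite J"
    and J: "\<And>j. 0 < measure \<nu> (f j) \<Longrightarrow> j \<in> J"
  shows "Lq_sum \<nu> q \<delta> = (\<Sum>j\<in>J. measure \<nu> (f j) powr q)"
proof -
  have "{Q \<in> mesh \<delta>. 0 < measure \<nu> Q} = f ` {j \<in> J. 0 < measure \<nu> (f j)}"
    using J by (auto simp: mesh)
  then have "Lq_sum \<nu> q \<delta> = (\<Sum>j\<in>{j \<in> J. 0 < measure \<nu> (f j)}. measure \<nu> (f j) powr q)"
    unfolding Lq_sum_def using inj_on_subset[OF \<open>inj f\<close>] by (simp add: sum.reindex)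
  also have "\<dots> = (\<Sum>j\<in>J. measure \<nu> (f j) powr q)"
  proof (rule sum.mono_neutral_left[OF \<open>finite J\<close>])
    show "\<forall>j\<in>J - {j \<in> J. 0 < measure \<nu> (f j)}. measure \<nu> (f j) powr q = 0"
      using zero_less_measure_iff[of \<nu>] by auto
  qed auto
  finally show ?thesis .
qed

lemma Lq_spectrum_eqI: "has_Lq_spectrum \<nu> q s \<Longrightarrow> Lq_spectrum \<nu> q = s"
  unfolding Lq_spectrum_def
  by (rule the_equality) (auto simp: has_Lq_spectrum_def intro: tendsto_unique[of "at_right (0::real)"])

lemma has_Lq_spectrum_cong:
  assumes "\<And>\<delta>. 0 < \<delta> \<Longrightarrow> Lq_sum \<nu> q \<delta> = f \<delta>"
    and "((\<lambda>\<delta>. ln (f \<delta>) / (- ln \<delta>)) \<longlongrightarrow> s) (at_right 0)"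
  shows "has_Lq_spectrum \<nu> q s"
  unfolding has_Lq_spectrum_def
proof (rule Lim_transform_eventually[OF assms(2)])
  show "\<forall>\<^sub>F \<delta> in at_right 0. ln (f \<delta>) / - ln \<delta> = ln (Lq_sum \<nu> q \<delta>) / - ln \<delta>"
    using assms(1) by (intro eventually_at_rightI[of 0 1]) auto
qed

lemma mesh_real: "mesh \<delta> = range (\<lambda>j::int. {\<delta> * real_of_int j..\<delta> * (real_of_int j + 1)})"
proof -
  have "(mesh \<delta> :: real set set) = {{\<delta> * k..\<delta> * (k + 1)} |k. k \<in> \<int>}"
    by (simp add: mesh_def)
  also have "\<dots> = range (\<lambda>j::int. {\<delta> * real_of_int j..\<delta> * (real_of_int j + 1)})"
    by (auto simp: Ints_def)
  finally show ?thesis .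
qed

context diagonal_self_affine
begin

lemma Lq_sum_projection:
  assumes d: "0 < \<delta>"
  shows "Lq_sum (distr \<mu> borel (\<lambda>\<xi>. \<xi> $ c)) q \<delta> = strip_sum c \<delta>"
proof -
  let ?f = "\<lambda>j::int. {\<delta> * real_of_int j..\<delta> * (real_of_int j + 1)}"
  have [measurable]: "(\<lambda>\<xi>::real^2. \<xi> $ c) \<in> borel_measurable \<mu>"
    by (subst measurable_cong_sets[OF sets_mu refl]) (intro borel_measurable_continuous_onI continuous_intros)
  have m: "measure (distr \<mu> borel (\<lambda>\<xi>. \<xi> $ c)) (?f j) = measure \<mu> (strip c \<delta> j)" for j
  proof -
    have "(\<lambda>\<xi>::real^2. \<xi> $ c) -` ?f j = strip c \<delta> j" by (auto simp: mem_strip)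
    then show ?thesis by (simp add: measure_distr)
  qed
  have "Lq_sum (distr \<mu> borel (\<lambda>\<xi>. \<xi> $ c)) q \<delta> = (\<Sum>j\<in>mesh_range \<delta>. measure (distr \<mu> borel (\<lambda>\<xi>. \<xi> $ c)) (?f j) powr q)"
  proof (rule Lq_sum_reindex[OF mesh_real])
    show "inj ?f"
    proof (rule injI)
      fix i j assume eq: "?f i = ?f j"
      have "\<delta> * real_of_int i \<in> ?f j" "\<delta> * real_of_int j \<in> ?f i"
        using d unfolding eq[symmetric] by simp (use d in \<open>simp add: eq\<close>)
      then show "i = j" using d by simp
    qed
    fix j assume "0 < measure (distr \<mu> borel (\<lambda>\<xi>. \<xi> $ c)) (?f j)"
    then have "strip c \<delta> j \<inter> cbox 0 1 \<noteq> {}" unfolding m using measure_eq_0[of "strip c \<delta> j"] by fastforce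
    then obtain \<xi> where "\<xi> \<in> strip c \<delta> j" "\<xi> \<in> cbox 0 1" by blast
    then show "j \<in> mesh_range \<delta>"
      using mem_mesh_range[OF d, of "\<xi> $ c" j] by (simp add: mem_strip mem_unit_square)
  qed simp
  then show ?thesis unfolding m by (simp add: strip_sum_def)
qed

lemma mesh_plane: "mesh \<delta> = range (\<lambda>(k, l). strip 1 \<delta> k \<inter> strip 2 \<delta> l)"
proof -
  have one: "(One :: real^2) $ c = 1" for c
  proof -
    have "axis c 1 \<in> (Basis :: (real^2) set)" by (simp add: axis_in_Basis_iff)
    then have "(One :: real^2) \<bullet> axis c 1 = 1" by (rule inner_sum_Basis)
    then show ?thesis by (simp add: inner_axis)
  qed
  have cube: "cbox (\<delta> *\<^sub>R k) (\<delta> *\<^sub>R (k + One)) = {\<xi>::real^2. \<forall>c. \<delta> * k $ c \<le> \<xi> $ c \<and> \<xi> $ c \<le> \<delta> * (k $ c + 1)}" for k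
    using one by (simp add: mem_box_cart set_eq_iff)
  have int: "(\<forall>e\<in>Basis. k \<bullet> e \<in> \<int>) \<longleftrightarrow> (\<forall>c. k $ c \<in> \<int>)" for k :: "real^2"
    by (auto simp: Basis_vec_def inner_axis)
  show ?thesis
  proof (intro equalityI subsetI)
    fix Q :: "(real^2) set" assume "Q \<in> mesh \<delta>"
    then obtain k where k: "Q = {\<xi>. \<forall>c. \<delta> * k $ c \<le> \<xi> $ c \<and> \<xi> $ c \<le> \<delta> * (k $ c + 1)}" "\<forall>c. k $ c \<in> \<int>"
      unfolding mesh_def cube int by blast
    obtain i j where ij: "k $ 1 = real_of_int i" "k $ 2 = real_of_int j" using k(2) by (metis Ints_cases)
    have "Q = strip 1 \<delta> i \<inter> strip 2 \<delta> j" unfolding k(1) by (auto simp: mem_strip forall_2 ij)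
    then show "Q \<in> range (\<lambda>(k, l). strip 1 \<delta> k \<inter> strip 2 \<delta> l)" by force
  next
    fix Q assume "Q \<in> range (\<lambda>(k, l). strip 1 \<delta> k \<inter> strip 2 \<delta> l)"
    then obtain i j where Q: "Q = strip 1 \<delta> i \<inter> strip 2 \<delta> j" by auto
    define k :: "real^2" where "k = vector [real_of_int i, real_of_int j]"
    have "Q = {\<xi>. \<forall>c. \<delta> * k $ c \<le> \<xi> $ c \<and> \<xi> $ c \<le> \<delta> * (k $ c + 1)}" "\<forall>c. k $ c \<in> \<int>"
      unfolding Q by (auto simp: mem_strip forall_2 k_def)
    then show "Q \<in> mesh \<delta>" unfolding mesh_def cube int by blast
  qed
qed

lemma Lq_sum_plane:
  assumes d: "0 < \<delta>"
  shows "Lq_sum \<mu> q \<delta> = square_sum \<delta>"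
proof -
  let ?f = "\<lambda>(k, l). strip 1 \<delta> k \<inter> strip 2 \<delta> l"
  have "Lq_sum \<mu> q \<delta> = (\<Sum>kl\<in>mesh_range \<delta> \<times> mesh_range \<delta>. measure \<mu> (?f kl) powr q)"
  proof (rule Lq_sum_reindex[OF mesh_plane])
    show "inj ?f"
    proof (rule injI, clarify)
      fix k l k' l' assume eq: "strip 1 \<delta> k \<inter> strip 2 \<delta> l = strip 1 \<delta> k' \<inter> strip 2 \<delta> l'"
      have in_self: "vector [\<delta> * real_of_int i, \<delta> * real_of_int j] \<in> strip 1 \<delta> i \<inter> strip 2 \<delta> j" for i j
        using d by (simp add: mem_strip)
      have "vector [\<delta> * real_of_int k, \<delta> * real_of_int l] \<in> strip 1 \<delta> k' \<inter> strip 2 \<delta> l'"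
        using in_self[of k l] unfolding eq .
      moreover have "vector [\<delta> * real_of_int k', \<delta> * real_of_int l'] \<in> strip 1 \<delta> k \<inter> strip 2 \<delta> l"
        using in_self[of k' l'] unfolding eq .
      ultimately show "k = k' \<and> l = l'" using d by (simp add: mem_strip)
    qed
    fix kl assume "0 < measure \<mu> (?f kl)"
    then have pos: "0 < measure \<mu> (strip 1 \<delta> (fst kl) \<inter> strip 2 \<delta> (snd kl))" by (simp add: case_prod_beta)
    have "strip 1 \<delta> (fst kl) \<inter> strip 2 \<delta> (snd kl) \<inter> cbox 0 1 \<noteq> {}"
      using pos measure_eq_0[of "strip 1 \<delta> (fst kl) \<inter> strip 2 \<delta> (snd kl)"] by fastforce
    then obtain \<xi> where "\<xi> \<in> strip 1 \<delta> (fst kl)" "\<xi> \<in> strip 2 \<delta> (snd kl)" "\<xi> \<in> cbox 0 1" by blast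
    then show "kl \<in> mesh_range \<delta> \<times> mesh_range \<delta>"
      using mem_mesh_range[OF d, of "\<xi> $ 1" "fst kl"] mem_mesh_range[OF d, of "\<xi> $ 2" "snd kl"]
      by (simp add: mem_strip mem_unit_square mem_Times_iff)
  qed simp
  then show ?thesis by (simp add: square_sum_def case_prod_beta)
qed

lemma tau_A_eq: "tau_A \<mu> q = tau 1" and tau_B_eq: "tau_B \<mu> q = tau 2"
  unfolding tau_A_def tau_B_def
  by (intro Lq_spectrum_eqI has_Lq_spectrum_cong[OF Lq_sum_projection tau]; assumption)+

lemma has_Lq_spectrum_growth:
  assumes "growth_ge s" "growth_le s"
  shows "has_Lq_spectrum \<mu> q s"
  by (rule has_Lq_spectrum_cong[OF Lq_sum_plane growth_limit[OF assms]])

section \<open>Extremal points of the arc\<close>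

text \<open>The point \<open>(tau 1, tau 2)\<close> lies on or above the curve. All points of the arc give lower
  bounds, and the ends give the upper bound, one for each major direction.\<close>

lemma spectrum_max_on_arc:
  assumes 1: "phi (tau 1) y1 = 1" and 2: "phi x2 (tau 2) = 1" and "y1 \<le> tau 2"
  defines "s \<equiv> max (tau 1 + y1) (x2 + tau 2)"
  shows "growth_ge s" "growth_le s"
    and "is_maximum {x + y |x y. phi x y = 1 \<and> x2 \<le> x \<and> x \<le> tau 1} s"
    and "is_maximum {x + y |x y. phi x y = 1 \<and> y1 \<le> y \<and> y \<le> tau 2} s"
proof -
  have le: "x2 \<le> tau 1" using assms(3) phi_curve_antimono[of x2 "tau 2" "tau 1" y1] 1 2 by simp
  have ge1: "growth_ge (tau 1 + y1)" using growth_geI[OF 1] assms(3) by simp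
  have ge2: "growth_ge (x2 + tau 2)" using growth_geI[OF 2] le by simp
  show ge: "growth_ge s" using ge1 ge2 by (simp add: s_def max_def)
  show gl: "growth_le s" by (rule growth_leI[OF 1 _ _ 2]) (auto simp: s_def)
  have below: "x + y \<le> s" if "phi x y = 1" "x \<le> tau 1" "y \<le> tau 2" for x y
    using growth_ge_le[OF growth_geI[OF that(1)] gl] that by simp
  have anti: "x2 \<le> x \<longleftrightarrow> y \<le> tau 2" "x \<le> tau 1 \<longleftrightarrow> y1 \<le> y" if "phi x y = 1" for x y
    using phi_curve_antimono[of x2 "tau 2" x y] phi_curve_antimono[of x y "tau 1" y1] 1 2 that by auto
  have mem: "\<exists>x y. s = x + y \<and> phi x y = 1 \<and> x2 \<le> x \<and> x \<le> tau 1 \<and> y1 \<le> y \<and> y \<le> tau 2"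
  proof (cases "tau 1 + y1 \<le> x2 + tau 2")
    case True
    then show ?thesis using 2 le assms(3) by (intro exI[of _ x2] exI[of _ "tau 2"]) (simp add: s_def)
  next
    case False
    then show ?thesis using 1 le assms(3) by (intro exI[of _ "tau 1"] exI[of _ y1]) (simp add: s_def)
  qed
  show "is_maximum {x + y |x y. phi x y = 1 \<and> x2 \<le> x \<and> x \<le> tau 1} s"
    "is_maximum {x + y |x y. phi x y = 1 \<and> y1 \<le> y \<and> y \<le> tau 2} s"
    unfolding is_maximum_def using mem below anti by blast+
qed

text \<open>The point \<open>(tau 1, tau 2)\<close> lies on or below the curve. All points of the arc give upper
  bounds. A matching lower bound comes from the left end if the drift there is nonnegative, from
  the right end if the drift there is nonpositive, and otherwise from a zero of the drift between
  them, by the intermediate value theorem.\<close>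

lemma spectrum_min_on_arc:
  assumes 1: "phi (tau 1) y1 = 1" and 2: "phi x2 (tau 2) = 1" and "tau 2 \<le> y1"
  obtains s where "growth_ge s" "growth_le s"
    "is_minimum {x + y |x y. phi x y = 1 \<and> tau 1 \<le> x \<and> x \<le> x2} s"
    "is_minimum {x + y |x y. phi x y = 1 \<and> tau 2 \<le> y \<and> y \<le> y1} s"
    "0 \<le> drift (tau 1) y1 \<Longrightarrow> s = tau 1 + y1"
    "drift x2 (tau 2) \<le> 0 \<Longrightarrow> s = x2 + tau 2"
    "drift (tau 1) y1 < 0 \<Longrightarrow> 0 < drift x2 (tau 2) \<Longrightarrow>
      \<exists>x y. x \<in> {tau 1..x2} \<and> y \<in> {tau 2..y1} \<and> phi x y = 1 \<and> drift x y = 0 \<and> s = x + y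
        \<and> s < min (tau 1 + y1) (x2 + tau 2)"
proof -
  have le: "tau 1 \<le> x2" using assms(3) phi_curve_antimono[of "tau 1" y1 x2 "tau 2"] 1 2 by simp
  have anti: "x \<le> x2 \<longleftrightarrow> tau 2 \<le> y" "tau 1 \<le> x \<longleftrightarrow> y \<le> y1" if "phi x y = 1" for x y
    using phi_curve_antimono[of x y x2 "tau 2"] phi_curve_antimono[of "tau 1" y1 x y] 1 2 that by auto
  have gl: "growth_le (x + y)" if "phi x y = 1" "tau 1 \<le> x" "tau 2 \<le> y" for x y
    using that by (intro growth_leI[of x y _ x y]) auto
  have gl1: "growth_le (tau 1 + y1)" and gl2: "growth_le (x2 + tau 2)"
    using gl[OF 1] gl[OF 2] assms(3) le by auto
  have ge1: "growth_ge (tau 1 + y1)" if "0 \<le> drift (tau 1) y1" using growth_geI[OF 1] that by simp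
  have ge2: "growth_ge (x2 + tau 2)" if "drift x2 (tau 2) \<le> 0" using growth_geI[OF 2] that by simp
  have "\<exists>x y. phi x y = 1 \<and> tau 1 \<le> x \<and> x \<le> x2 \<and> growth_ge (x + y) \<and>
      (drift (tau 1) y1 < 0 \<and> 0 < drift x2 (tau 2) \<longrightarrow> drift x y = 0)"
  proof -
    consider "0 \<le> drift (tau 1) y1" | "drift x2 (tau 2) \<le> 0" | "drift (tau 1) y1 < 0" "0 < drift x2 (tau 2)"
      by linarith
    then show ?thesis
    proof cases
      case 1
      then show ?thesis using ge1 le \<open>phi (tau 1) y1 = 1\<close> by (intro exI[of _ "tau 1"] exI[of _ y1]) auto
    next
      case 2
      then show ?thesis using ge2 le \<open>phi x2 (tau 2) = 1\<close> by (intro exI[of _ x2] exI[of _ "tau 2"]) auto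
    next
      case 3
      obtain x where x: "tau 1 \<le> x" "x \<le> x2" "drift x (curve x) = 0"
        using drift_zero_between[OF le] 3 curve_eqI[OF 1] curve_eqI[OF 2] by auto
      then have "growth_ge (x + curve x)" by (intro growth_geI phi_curve) auto
      then show ?thesis using x phi_curve by blast
    qed
  qed
  then obtain x y where xy: "phi x y = 1" "tau 1 \<le> x" "x \<le> x2" "growth_ge (x + y)"
    "drift (tau 1) y1 < 0 \<Longrightarrow> 0 < drift x2 (tau 2) \<Longrightarrow> drift x y = 0" by blast
  have y: "tau 2 \<le> y" "y \<le> y1" using anti[OF xy(1)] xy(2,3) by auto
  have below: "x + y \<le> x' + y'" if "phi x' y' = 1" "tau 1 \<le> x'" "tau 2 \<le> y'" for x' y'
    by (rule growth_ge_le[OF xy(4) gl[OF that]])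
  show ?thesis
  proof (rule that[of "x + y"])
    show "growth_ge (x + y)" by (rule xy(4))
    show "growth_le (x + y)" using gl xy y by blast
    show "is_minimum {x + y |x y. phi x y = 1 \<and> tau 1 \<le> x \<and> x \<le> x2} (x + y)"
      "is_minimum {x + y |x y. phi x y = 1 \<and> tau 2 \<le> y \<and> y \<le> y1} (x + y)"
      unfolding is_minimum_def using xy y below anti by blast+
    show "x + y = tau 1 + y1" if "0 \<le> drift (tau 1) y1"
      using growth_ge_le[OF ge1[OF that] \<open>growth_le (x + y)\<close>] growth_ge_le[OF xy(4) gl1] by simp
    show "x + y = x2 + tau 2" if "drift x2 (tau 2) \<le> 0"
      using growth_ge_le[OF ge2[OF that] \<open>growth_le (x + y)\<close>] growth_ge_le[OF xy(4) gl2] by simp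
    assume d: "drift (tau 1) y1 < 0" "0 < drift x2 (tau 2)"
    have "x + y \<noteq> tau 1 + y1" using phi_gt_tangent[OF xy(1) xy(5)[OF d], of "tau 1" y1] 1 d by auto
    moreover have "x + y \<noteq> x2 + tau 2" using phi_gt_tangent[OF xy(1) xy(5)[OF d], of x2 "tau 2"] 2 d by auto
    ultimately have "x + y < min (tau 1 + y1) (x2 + tau 2)"
      using growth_ge_le[OF xy(4) gl1] growth_ge_le[OF xy(4) gl2] by simp
    then show "\<exists>x' y'. x' \<in> {tau 1..x2} \<and> y' \<in> {tau 2..y1} \<and> phi x' y' = 1 \<and> drift x' y' = 0 \<and> x + y = x' + y'
        \<and> x + y < min (tau 1 + y1) (x2 + tau 2)"
      using xy y d by (intro exI[of _ x] exI[of _ y]) auto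
  qed
qed

end

theorem corollary2p5:
  fixes N :: nat and T :: "nat \<Rightarrow> real^2^2" and v :: "nat \<Rightarrow> real^2"
    and a b p :: "nat \<Rightarrow> real" and \<mu> :: "(real^2) measure" and q :: real
  assumes "diagonal_box_like_ifs N T a b"
    and "ROSC N T v"
    and "positive_prob_vector N p"
    and "self_affine_measure N T v p \<mu>"
    and "0 \<le> q"
  defines "\<tau> \<equiv> Lq_spectrum \<mu> q"
    and "\<tau>A \<equiv> tau_A \<mu> q"
    and "\<tau>B \<equiv> tau_B \<mu> q"
    and "\<gamma>A \<equiv> gamma_A N a b p \<mu> q"
    and "\<gamma>B \<equiv> gamma_B N a b p \<mu> q"
    and "\<Phi> \<equiv> \<lambda>x y. \<Sum>i=1..N. p i powr q * a i powr x * b i powr y"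
    and "\<Psi> \<equiv> \<lambda>x y. \<Sum>i=1..N. p i powr q * a i powr x * b i powr y * ln (a i / b i)"
  shows "has_Lq_spectrum \<mu> q \<tau> \<and>
    (max \<gamma>A \<gamma>B \<le> \<tau>A + \<tau>B \<or> \<tau>A + \<tau>B \<le> min \<gamma>A \<gamma>B) \<and>
    (max \<gamma>A \<gamma>B \<le> \<tau>A + \<tau>B \<longrightarrow>
       \<tau> = max \<gamma>A \<gamma>B \<and>
       is_maximum {x + y |x y. \<Phi> x y = 1 \<and> \<gamma>B - \<tau>B \<le> x \<and> x \<le> \<tau>A} \<tau> \<and>
       is_maximum {x + y |x y. \<Phi> x y = 1 \<and> \<gamma>A - \<tau>A \<le> y \<and> y \<le> \<tau>B} \<tau>) \<and>
    (\<tau>A + \<tau>B \<le> min \<gamma>A \<gamma>B \<longrightarrow>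
       is_minimum {x + y |x y. \<Phi> x y = 1 \<and> \<tau>A \<le> x \<and> x \<le> \<gamma>B - \<tau>B} \<tau> \<and>
       is_minimum {x + y |x y. \<Phi> x y = 1 \<and> \<tau>B \<le> y \<and> y \<le> \<gamma>A - \<tau>A} \<tau> \<and>
       (0 \<le> \<Psi> \<tau>A (\<gamma>A - \<tau>A) \<longrightarrow> \<tau> = \<gamma>A) \<and>
       (\<Psi> (\<gamma>B - \<tau>B) \<tau>B \<le> 0 \<longrightarrow> \<tau> = \<gamma>B) \<and>
       (\<not> 0 \<le> \<Psi> \<tau>A (\<gamma>A - \<tau>A) \<and> \<not> \<Psi> (\<gamma>B - \<tau>B) \<tau>B \<le> 0 \<longrightarrow>
          (\<exists>x y. x \<in> {\<tau>A..\<gamma>B - \<tau>B} \<and> y \<in> {\<tau>B..\<gamma>A - \<tau>A} \<and> \<Phi> x y = 1 \<and> \<Psi> x y = 0 \<and>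
             \<tau> = x + y \<and> \<tau> < min \<gamma>A \<gamma>B)))"
proof -
  have ifs: "T i $ 1 $ 2 = 0" "T i $ 2 $ 1 = 0" "\<bar>T i $ 1 $ 1\<bar> = a i" "\<bar>T i $ 2 $ 2\<bar> = b i"
    "0 < a i" "a i < 1" "0 < b i" "b i < 1" if "i \<in> {1..N}" for i
    using assms(1) that unfolding diagonal_box_like_ifs_def by auto
  interpret diagonal_self_affine N T v p \<mu> q
  proof
    fix i and c d :: 2 assume i: "i \<in> {1..N}"
    show "T i $ c $ d = 0" if "c \<noteq> d"
      using that ifs(1,2)[OF i] exhaust_2[of c] exhaust_2[of d] by auto
    show "0 < \<bar>T i $ c $ c\<bar> \<and> \<bar>T i $ c $ c\<bar> < 1"
      using ifs[OF i] exhaust_2[of c] by auto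
  qed (use assms in auto)
  have \<Phi>: "\<Phi> = phi" unfolding \<Phi>_def phi_eq by (intro ext sum.cong) (auto simp: ifs)
  have \<Psi>: "\<Psi> = drift" unfolding \<Psi>_def drift_eq by (intro ext sum.cong) (auto simp: ifs ln_div)
  have \<tau>A: "\<tau>A = tau 1" and \<tau>B: "\<tau>B = tau 2" by (simp_all add: \<tau>A_def \<tau>B_def tau_A_eq tau_B_eq)
  have "\<gamma>A = (THE g. phi (tau 1) (g - tau 1) = 1)"
    unfolding \<gamma>A_def gamma_A_def tau_A_eq \<Phi>[symmetric] \<Phi>_def ..
  moreover obtain y1 where "\<And>y. phi (tau 1) y = 1 \<longleftrightarrow> y = y1"
    using ex1_phi(1)[of "tau 1"] by blast
  ultimately have gA: "phi (tau 1) (\<gamma>A - tau 1) = 1" by (simp add: diff_eq_eq)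
  have "\<gamma>B = (THE g. phi (g - tau 2) (tau 2) = 1)"
    unfolding \<gamma>B_def gamma_B_def tau_B_eq \<Phi>[symmetric] \<Phi>_def ..
  moreover obtain x2 where "\<And>x. phi x (tau 2) = 1 \<longleftrightarrow> x = x2"
    using ex1_phi(2)[of "tau 2"] by blast
  ultimately have gB: "phi (\<gamma>B - tau 2) (tau 2) = 1" by (simp add: diff_eq_eq)
  have anti: "\<gamma>A - tau 1 \<le> tau 2 \<longleftrightarrow> \<gamma>B - tau 2 \<le> tau 1" "tau 2 \<le> \<gamma>A - tau 1 \<longleftrightarrow> tau 1 \<le> \<gamma>B - tau 2"
    using phi_curve_antimono[of "\<gamma>B - tau 2" "tau 2" "tau 1" "\<gamma>A - tau 1"]
      phi_curve_antimono[of "tau 1" "\<gamma>A - tau 1" "\<gamma>B - tau 2" "tau 2"] gA gB by auto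
  have spectrum: "has_Lq_spectrum \<mu> q s \<and> \<tau> = s" if "growth_ge s" "growth_le s" for s
    using has_Lq_spectrum_growth[OF that] Lq_spectrum_eqI by (auto simp: \<tau>_def)
  show ?thesis
    unfolding \<Phi> \<Psi> \<tau>A \<tau>B
  proof (intro conjI impI)
    show "has_Lq_spectrum \<mu> q \<tau>"
    proof (cases "\<gamma>A - tau 1 \<le> tau 2")
      case True
      then show ?thesis using spectrum_max_on_arc(1,2)[OF gA gB] spectrum by blast
    next
      case False
      then have "tau 2 \<le> \<gamma>A - tau 1" by simp
      then show ?thesis using spectrum_min_on_arc[OF gA gB] spectrum by metis
    qed
    show "max \<gamma>A \<gamma>B \<le> tau 1 + tau 2 \<or> tau 1 + tau 2 \<le> min \<gamma>A \<gamma>B" using anti by linarith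
  next
    assume "max \<gamma>A \<gamma>B \<le> tau 1 + tau 2"
    then have "\<gamma>A - tau 1 \<le> tau 2" by simp
    note r = spectrum_max_on_arc[OF gA gB this]
    show eq: "\<tau> = max \<gamma>A \<gamma>B" using spectrum[OF r(1,2)] by simp
    show "is_maximum {x + y |x y. phi x y = 1 \<and> \<gamma>B - tau 2 \<le> x \<and> x \<le> tau 1} \<tau>"
      "is_maximum {x + y |x y. phi x y = 1 \<and> \<gamma>A - tau 1 \<le> y \<and> y \<le> tau 2} \<tau>"
      using r(3,4) by (simp_all add: eq)
  next
    assume "tau 1 + tau 2 \<le> min \<gamma>A \<gamma>B"
    then have le: "tau 2 \<le> \<gamma>A - tau 1" by simp
    obtain s where s: "growth_ge s" "growth_le s"
      "is_minimum {x + y |x y. phi x y = 1 \<and> tau 1 \<le> x \<and> x \<le> \<gamma>B - tau 2} s"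
      "is_minimum {x + y |x y. phi x y = 1 \<and> tau 2 \<le> y \<and> y \<le> \<gamma>A - tau 1} s"
      "0 \<le> drift (tau 1) (\<gamma>A - tau 1) \<Longrightarrow> s = tau 1 + (\<gamma>A - tau 1)"
      "drift (\<gamma>B - tau 2) (tau 2) \<le> 0 \<Longrightarrow> s = \<gamma>B - tau 2 + tau 2"
      "drift (tau 1) (\<gamma>A - tau 1) < 0 \<Longrightarrow> 0 < drift (\<gamma>B - tau 2) (tau 2) \<Longrightarrow>
        \<exists>x y. x \<in> {tau 1..\<gamma>B - tau 2} \<and> y \<in> {tau 2..\<gamma>A - tau 1} \<and> phi x y = 1 \<and> drift x y = 0 \<and> s = x + y
          \<and> s < min (tau 1 + (\<gamma>A - tau 1)) (\<gamma>B - tau 2 + tau 2)"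
      by (rule spectrum_min_on_arc[OF gA gB le]) blast
    have eq: "\<tau> = s" using spectrum[OF s(1,2)] by simp
    show "is_minimum {x + y |x y. phi x y = 1 \<and> tau 1 \<le> x \<and> x \<le> \<gamma>B - tau 2} \<tau>"
      "is_minimum {x + y |x y. phi x y = 1 \<and> tau 2 \<le> y \<and> y \<le> \<gamma>A - tau 1} \<tau>"
      using s(3,4) by (simp_all add: eq)
    show "\<tau> = \<gamma>A" if "0 \<le> drift (tau 1) (\<gamma>A - tau 1)" using s(5)[OF that] by (simp add: eq)
    show "\<tau> = \<gamma>B" if "drift (\<gamma>B - tau 2) (tau 2) \<le> 0" using s(6)[OF that] by (simp add: eq)
    show "\<exists>x y. x \<in> {tau 1..\<gamma>B - tau 2} \<and> y \<in> {tau 2..\<gamma>A - tau 1} \<and> phi x y = 1 \<and> drift x y = 0 \<and>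
             \<tau> = x + y \<and> \<tau> < min \<gamma>A \<gamma>B"
      if "\<not> 0 \<le> drift (tau 1) (\<gamma>A - tau 1) \<and> \<not> drift (\<gamma>B - tau 2) (tau 2) \<le> 0"
      using s(7) that by (simp add: eq not_le)
  qed
qed

end
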